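(* Let $0<\gamma<n$, $1<p<q<\infty$, $0<\kappa<p/q$ and $b\in\mathrm{BMO}(\mathbb R^n)$. Given a pair of weights $(w,\nu)$ on $\mathbb R^n$, suppose that for some $r>1$ there is a constant $C<\infty$ such that for all cubes $Q$ in $\mathbb R^n$, $$|Q|^{\gamma/n+1/q-1/p}\cdot\bigg(\frac{1}{|Q|}\int_Q w(x)^r\,dx\bigg)^{1/(rq)}\big\|\nu^{-1/p}\big\|_{\mathcal A,Q}\leq C,$$ where $\mathcal A(t)=t^{p'}(1+\log^+t)^{p'}$. If $w\in A_\infty$, then the linear commutator $[b,I_\gamma]$ is bounded from $L^{p,\kappa}(\nu,w)$ into $WL^{q,(\kappa q)/p}(w)$.
   Context: A weight on $\mathbb R^n$ is a nonnegative locally integrable function; for a weight $w$ and a measurable set $E$, $w(E)=\int_E w(x)\,dx$, and $|E|$ is Lebesgue measure. $p'=p/(p-1)$ and $\log^+t=\max\{\log t,0\}$. All cubes have sides parallel to the coordinate axes. A weight $w$ is in $A_p$ ($1<p<\infty$) if there is $C>0$ with $\big(\frac1{|Q|}\int_Qw\,dx\big)^{1/p}\big(\frac1{|Q|}\int_Qw^{-p'/p}\,dx\big)^{1/p'}\le C$ for every cube $Q$; $A_\infty=\bigcup_{1<p<\infty}A_p$. For a Young function $\mathcal A$ (continuous, convex, strictly increasing on $[0,\infty)$, $\mathcal A(0)=0$, $\mathcal A(t)\to\infty$ as $t\to\infty$) and a cube $Q$, the Luxemburg norm is $$\|f\|_{\mathcal A,Q}:=\inf\Big\{\lambda>0:\frac1{|Q|}\int_Q\mathcal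 A\Big(\frac{|f(x)|}\lambda\Big)dx\le1\Big\}.$$ $\mathrm{BMO}(\mathbb R^n)$ is the set of $b\in L^1_{loc}(\mathbb R^n)$ with $\|b\|_*:=\sup_Q\frac1{|Q|}\int_Q|b(x)-b_Q|\,dx<\infty$, where $b_Q=\frac1{|Q|}\int_Qb(y)\,dy$ and the supremum is over all cubes $Q$. Fractional integral operator and commutator: for $0<\gamma<n$, with $\zeta(\gamma)=\pi^{n/2}2^\gamma\Gamma(\gamma/2)/\Gamma((n-\gamma)/2)$, $$I_\gamma f(x)=\frac1{\zeta(\gamma)}\int_{\mathbb R^n}\frac{f(y)}{|x-y|^{n-\gamma}}\,dy,$$ $$[b,I_\gamma]f(x)=b(x)\cdot I_\gamma f(x)-I_\gamma(bf)(x)=\frac1{\zeta(\gamma)}\int_{\mathbb R^n}\frac{[b(x)-b(y)]f(y)}{|x-y|^{n-\gamma}}\,dy.$$ Weighted Morrey space: for $1<p<\infty$, $0\le\kappa<1$ and weights $w,\nu$, $L^{p,\kappa}(\nu,w)$ is the set of $f\in L^p_{loc}(\nu)$ with $$\|f\|_{L^{p,\kappa}(\nu,w)}:=\sup_{Q}\bigg(\frac1{w(Q)^\kappa}\int_Q|f(x)|^p\nu(x)\,dx\bigg)^{1/p}<\infty,$$ the supremum being over all cubes $Q$ in $\mathbb R^n$. Weighted weak Morrey space: for $1<p<\infty$, $0\le\kappa<1$ and a weight $w$, $WL^{p,\kappa}(w)$ is the set of measurable $f$ with $$\|f\|_{WL^{p,\kappa}(w)}:=\sup_Q\sup_{\sigma>0}\frac1{w(Q)^{\kappa/p}}\,\sigma\cdot\big[w(\{x\in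 Q:|f(x)|>\sigma\})\big]^{1/p}<\infty.$$ An operator $T$ is bounded from $X$ into $Y$ if there is a constant $C$ with $\|Tf\|_Y\le C\|f\|_X$ for all $f\in X$. *)

theory Defs
  imports "HOL-Analysis.Analysis"
begin

text \<open>
  The space is \<open>real ^ 'n\<close>, of dimension \<open>n = CARD('n)\<close>, with Lebesgue measurability throughout.
  Integrals of nonnegative functions, suprema and norms are taken in \<open>ennreal\<close>, so that they are
  defined, possibly infinite, for every argument.
\<close>

definition cubes :: "(real ^ 'n) set set" where
  "cubes = {cbox a (\<chi> i. a $ i + l) | a l. 0 < l}"

text \<open>
  Real powers on \<open>[0,\<infinity>]\<close>.  The library's \<open>0 powr a = 0\<close> is wrong for \<open>a < 0\<close>: a negative power of a
  weight must be infinite where the weight vanishes.  Since \<open>enn2real \<infinity> = 0\<close>, the last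
  branch gives \<open>\<infinity>\<^sup>a = 0\<close> for \<open>a < 0\<close>.
\<close>
definition epowr :: "ennreal \<Rightarrow> real \<Rightarrow> ennreal" (infixr "epowr" 80) where
  "x epowr a =
     (if a = 0 then 1
      else if (a < 0 \<and> x = 0) \<or> (a > 0 \<and> x = \<infinity>) then \<infinity>
      else ennreal (enn2real x powr a))"

definition conj_exp :: "real \<Rightarrow> real" where
  "conj_exp p = p / (p - 1)"

definition log_plus :: "real \<Rightarrow> real" where
  "log_plus t = max (ln t) 0"

definition locally_integrable :: "(real ^ 'n \<Rightarrow> real) \<Rightarrow> bool" where
  "locally_integrable f \<longleftrightarrow> (\<forall>K. compact K \<longrightarrow> set_integrable lebesgue K f)"

definition weight :: "(real ^ 'n \<Rightarrow> real) \<Rightarrow> bool" where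
  "weight w \<longleftrightarrow> (\<forall>x. 0 \<le> w x) \<and> locally_integrable w"

definition weight_measure :: "(real ^ 'n \<Rightarrow> real) \<Rightarrow> (real ^ 'n) set \<Rightarrow> ennreal" where
  "weight_measure w E = (\<integral>\<^sup>+x\<in>E. ennreal (w x) \<partial>lebesgue)"

definition nn_average :: "(real ^ 'n) set \<Rightarrow> (real ^ 'n \<Rightarrow> ennreal) \<Rightarrow> ennreal" where
  "nn_average Q F = (\<integral>\<^sup>+x\<in>Q. F x \<partial>lebesgue) / emeasure lebesgue Q"

definition average :: "(real ^ 'n) set \<Rightarrow> (real ^ 'n \<Rightarrow> real) \<Rightarrow> real" where
  "average Q f = set_lebesgue_integral lebesgue Q f / measure lebesgue Q"

text \<open>
  As \<open>0 * \<infinity> = 0\<close> in \<open>ennreal\<close>, the finiteness of the second average is required explicitly; this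
  only keeps out weights vanishing almost everywhere, for which the product is undefined.
\<close>
definition A_class :: "real \<Rightarrow> (real ^ 'n \<Rightarrow> real) set" where
  "A_class p = {w. weight w \<and>
     (\<exists>C::real. C > 0 \<and> (\<forall>Q\<in>cubes.
        nn_average Q (\<lambda>x. ennreal (w x) epowr (- conj_exp p / p)) < \<infinity> \<and>
        nn_average Q (\<lambda>x. ennreal (w x)) epowr (1 / p)
          * nn_average Q (\<lambda>x. ennreal (w x) epowr (- conj_exp p / p)) epowr (1 / conj_exp p)
          \<le> ennreal C))}"

definition A_infinity :: "(real ^ 'n \<Rightarrow> real) set" where
  "A_infinity = (\<Union>p\<in>{1<..}. A_class p)"

text \<open>
  \<open>g\<close> plays the role of \<open>|f|\<close> and may take the value \<open>\<infinity>\<close>, as \<open>\<nu> powr (-1/p)\<close> does where \<open>\<nu>\<close>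
  vanishes; a Young function \<open>A\<close>, given on \<open>[0,\<infinity>)\<close>, is extended by \<open>A \<infinity> = \<infinity>\<close>.
\<close>
definition young_ext :: "(real \<Rightarrow> real) \<Rightarrow> ennreal \<Rightarrow> ennreal" where
  "young_ext A t = (if t = \<infinity> then \<infinity> else ennreal (A (enn2real t)))"

definition luxemburg_norm ::
    "(real \<Rightarrow> real) \<Rightarrow> (real ^ 'n) set \<Rightarrow> (real ^ 'n \<Rightarrow> ennreal) \<Rightarrow> ennreal" where
  "luxemburg_norm A Q g =
     Inf {ennreal l | l. 0 < l \<and> nn_average Q (\<lambda>x. young_ext A (g x / ennreal l)) \<le> 1}"

definition log_young :: "real \<Rightarrow> real \<Rightarrow> real" where
  "log_young p t = t powr conj_exp p * (1 + log_plus t) powr conj_exp p"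

definition bmo_norm :: "(real ^ 'n \<Rightarrow> real) \<Rightarrow> ennreal" where
  "bmo_norm b = (SUP Q\<in>cubes. nn_average Q (\<lambda>x. ennreal \<bar>b x - average Q b\<bar>))"

definition BMO :: "(real ^ 'n \<Rightarrow> real) set" where
  "BMO = {b. locally_integrable b \<and> bmo_norm b < \<infinity>}"

definition riesz_const :: "real \<Rightarrow> real \<Rightarrow> real" where
  "riesz_const n \<gamma> = pi powr (n / 2) * 2 powr \<gamma> * Gamma (\<gamma> / 2) / Gamma ((n - \<gamma>) / 2)"

definition riesz_integrand ::
    "real \<Rightarrow> (real ^ 'n \<Rightarrow> real) \<Rightarrow> real ^ 'n \<Rightarrow> real ^ 'n \<Rightarrow> real" where
  "riesz_integrand \<gamma> f x y = f y / norm (x - y) powr (real CARD('n) - \<gamma>)"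

definition fractional_integral ::
    "real \<Rightarrow> (real ^ 'n \<Rightarrow> real) \<Rightarrow> real ^ 'n \<Rightarrow> real" where
  "fractional_integral \<gamma> f x =
     1 / riesz_const (real CARD('n)) \<gamma> * (\<integral>y. riesz_integrand \<gamma> f x y \<partial>lebesgue)"

definition commutator ::
    "(real ^ 'n \<Rightarrow> real) \<Rightarrow> ((real ^ 'n \<Rightarrow> real) \<Rightarrow> real ^ 'n \<Rightarrow> real)
       \<Rightarrow> (real ^ 'n \<Rightarrow> real) \<Rightarrow> real ^ 'n \<Rightarrow> real" where
  "commutator b T f x = b x * T f x - T (\<lambda>y. b y * f y) x"

text \<open>
  The Bochner integral is \<open>0\<close> for a non-integrable integrand, so the existence of the two integrals
  that make up \<open>[b, I\<^sub>\<gamma>] f (x)\<close> has to be expressed separately.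
\<close>
definition commutator_exists_at ::
    "(real ^ 'n \<Rightarrow> real) \<Rightarrow> real \<Rightarrow> (real ^ 'n \<Rightarrow> real) \<Rightarrow> real ^ 'n \<Rightarrow> bool" where
  "commutator_exists_at b \<gamma> f x \<longleftrightarrow>
     integrable lebesgue (riesz_integrand \<gamma> f x) \<and>
     integrable lebesgue (riesz_integrand \<gamma> (\<lambda>y. b y * f y) x)"

definition Lp_loc :: "real \<Rightarrow> (real ^ 'n \<Rightarrow> real) \<Rightarrow> (real ^ 'n \<Rightarrow> real) set" where
  "Lp_loc p \<nu> = {f. f \<in> borel_measurable lebesgue \<and>
     (\<forall>K. compact K \<longrightarrow> (\<integral>\<^sup>+x\<in>K. ennreal (\<bar>f x\<bar> powr p * \<nu> x) \<partial>lebesgue) < \<infinity>)}"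

definition morrey_norm ::
    "real \<Rightarrow> real \<Rightarrow> (real ^ 'n \<Rightarrow> real) \<Rightarrow> (real ^ 'n \<Rightarrow> real) \<Rightarrow> (real ^ 'n \<Rightarrow> real) \<Rightarrow> ennreal" where
  "morrey_norm p \<kappa> \<nu> w f =
     (SUP Q\<in>cubes. ((\<integral>\<^sup>+x\<in>Q. ennreal (\<bar>f x\<bar> powr p * \<nu> x) \<partial>lebesgue)
                       / weight_measure w Q epowr \<kappa>) epowr (1 / p))"

definition morrey_space ::
    "real \<Rightarrow> real \<Rightarrow> (real ^ 'n \<Rightarrow> real) \<Rightarrow> (real ^ 'n \<Rightarrow> real) \<Rightarrow> (real ^ 'n \<Rightarrow> real) set" where
  "morrey_space p \<kappa> \<nu> w = {f. f \<in> Lp_loc p \<nu> \<and> morrey_norm p \<kappa> \<nu> w f < \<infinity>}"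

definition weak_morrey_norm ::
    "real \<Rightarrow> real \<Rightarrow> (real ^ 'n \<Rightarrow> real) \<Rightarrow> (real ^ 'n \<Rightarrow> real) \<Rightarrow> ennreal" where
  "weak_morrey_norm p \<kappa> w f =
     (SUP Q\<in>cubes. SUP \<sigma>\<in>{0::real<..}.
        ennreal \<sigma> * weight_measure w {x\<in>Q. \<bar>f x\<bar> > \<sigma>} epowr (1 / p)
          / weight_measure w Q epowr (\<kappa> / p))"

definition weak_morrey_space ::
    "real \<Rightarrow> real \<Rightarrow> (real ^ 'n \<Rightarrow> real) \<Rightarrow> (real ^ 'n \<Rightarrow> real) set" where
  "weak_morrey_space p \<kappa> w =
     {f. f \<in> borel_measurable lebesgue \<and> weak_morrey_norm p \<kappa> w f < \<infinity>}"

definition bounded_operator ::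
    "((real ^ 'n \<Rightarrow> real) \<Rightarrow> real ^ 'n \<Rightarrow> real)
       \<Rightarrow> (real ^ 'n \<Rightarrow> real) set \<Rightarrow> ((real ^ 'n \<Rightarrow> real) \<Rightarrow> ennreal)
       \<Rightarrow> (real ^ 'n \<Rightarrow> real) set \<Rightarrow> ((real ^ 'n \<Rightarrow> real) \<Rightarrow> ennreal) \<Rightarrow> bool" where
  "bounded_operator T X normX Y normY \<longleftrightarrow>
     (\<exists>C::real. \<forall>f\<in>X. T f \<in> Y \<and> normY (T f) \<le> ennreal C * normX f)"

end

theory Submission
  imports Defs
begin

text \<open>
  Since \<open>p < q\<close> and \<open>w \<in> A\<^sub>\<infinity>\<close>, no maximal function is needed.  Let \<open>Q\<^sub>k(x)\<close> be the cube with
  centre \<open>x\<close> and half side \<open>2\<^sup>k\<close>, and write \<open>u\<^sub>k(x) = w(Q\<^sub>k(x))\<close>, \<open>G\<^sub>k(x)\<close> for the integral of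
  \<open>|f|\<^sup>p \<nu>\<close> over \<open>Q\<^sub>k(x)\<close>, and \<open>d\<^sub>k(x) = 1 + |b(x) - b\<^bsub>Q\<^sub>k(x)\<^esub>|\<close>.  The Orlicz bump on \<open>\<nu>\<close> is dual to the
  exponential integrability of \<open>b\<close> (John--Nirenberg), so that splitting the kernel dyadically gives
  \<open>|[b, I\<^sub>\<gamma>] f(x)| \<le> C \<Sum>\<^sub>k a\<^sub>k(x)\<close> with \<open>a\<^sub>k = u\<^sub>k powr (-1/q) * G\<^sub>k powr (1/p) * d\<^sub>k\<close>.  To bound the measure of
  \<open>{\<Sum>\<^sub>k a\<^sub>k > \<sigma>}\<close> inside a cube \<open>Z\<close>, put \<open>m = (\<parallel>f\<parallel> w(Z) powr (\<kappa>/p) / \<sigma>)\<^sup>q\<close>.  Because \<open>u\<^sub>k(x)\<close> grows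
  geometrically in \<open>k\<close>, some \<open>k\<close> has \<open>a\<^sub>k > c \<sigma> min (u\<^sub>k/m, m/u\<^sub>k) powr \<epsilon>\<close>; Chebyshev's inequality with exponent
  \<open>p\<close> where \<open>u\<^sub>k \<le> m\<close>, and with a large exponent where \<open>u\<^sub>k > m\<close>, then makes the sum over \<open>k\<close> a
  geometric series of total size \<open>O(m)\<close>.
\<close>

section \<open>Cubes and weights\<close>

text \<open>Each hypothesis on the exponents enters through the power of u_k left after integration.
  With exponent p, exchanging the integrations in x and y leaves the power 1 - p/q - \<epsilon> p,
  summable over u_k \<le> m because p < q. Where u_k > m and the cubes are still of the size of Z, a
  power s \<ge> p is used: one factor G_k is kept for the exchange and the others are bounded by the
  energy of the doubled cube. Cubes that outgrow Z have no local energy, so the Morrey bound on G_k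
  replaces it; the decay left is s (1/q - \<kappa>/p - \<epsilon>), positive because \<kappa> < p/q.
  If w(Z) \<le> m there is nothing to prove. Membership in \<open>A_infinity\<close> supplies three
  facts: doubling, which lets u_k(x) be replaced by u_k(y) for y in Q_k(x); reverse doubling, which
  makes the sums geometric; and integrability of every power of d_k against w. The 1 in d_k makes
  deviations multiplicative, 1 + |b(x) - b(y)| \<le> d_k(x) (1 + |b(y) - b_Q|), and lets the same
  majorant dominate the kernel of I_\<gamma> f, so that the weak estimate also yields the existence
  of the two integrals.\<close>

definition centered_cube :: "real ^ 'n \<Rightarrow> real \<Rightarrow> (real ^ 'n) set" where
  "centered_cube x r = {y. \<forall>i. \<bar>y $ i - x $ i\<bar> \<le> r}"

lemma centered_cube_eq_cbox: "centered_cube x r = cbox (\<chi> i. x $ i - r) (\<chi> i. x $ i + r)"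
  by (auto simp: centered_cube_def mem_box_cart abs_le_iff algebra_simps; metis add.commute)

lemma centered_cube_sets [measurable, simp]: "centered_cube x r \<in> sets lebesgue"
  and centered_cube_compact: "compact (centered_cube x r)"
  by (simp_all add: centered_cube_eq_cbox)

lemma mem_cubes_iff: "Q \<in> cubes \<longleftrightarrow> (\<exists>x r. 0 < r \<and> Q = centered_cube x r)"
proof
  assume "Q \<in> cubes"
  then obtain a l where l: "0 < l" "Q = cbox a (\<chi> i. a $ i + l)" by (auto simp: cubes_def)
  have "Q = centered_cube (\<chi> i. a $ i + l/2) (l/2)"
    unfolding l centered_cube_eq_cbox by (rule arg_cong2[where f=cbox]) (auto simp: vec_eq_iff field_simps)
  then show "\<exists>x r. 0 < r \<and> Q = centered_cube x r" using l by (metis half_gt_zero)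
next
  assume "\<exists>x r. 0 < r \<and> Q = centered_cube x r"
  then obtain x r where r: "0 < r" "Q = centered_cube x r" by blast
  have "Q = cbox (\<chi> i. x $ i - r) (\<chi> i. (\<chi> i. x $ i - r) $ i + 2 * r)"
    unfolding r centered_cube_eq_cbox by (rule arg_cong2[where f=cbox]) (auto simp: vec_eq_iff)
  then show "Q \<in> cubes" unfolding cubes_def using r by (intro CollectI exI[of _ "\<chi> i. x $ i - r"] exI[of _
      "2*r"]) auto
qed

lemma centered_cube_in_cubes: "0 < r \<Longrightarrow> centered_cube x r \<in> cubes"
  by (auto simp: mem_cubes_iff)

lemma cubes_sets [measurable_dest, simp]: "Q \<in> cubes \<Longrightarrow> Q \<in> sets lebesgue"
  and cubes_compact: "Q \<in> cubes \<Longrightarrow> compact Q"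
  by (auto simp: mem_cubes_iff centered_cube_compact)

lemma measure_centered_cube:
  fixes x :: "real ^ 'n"
  assumes "0 \<le> r" shows "measure lebesgue (centered_cube x r) = (2 * r) ^ CARD('n)"
proof -
  have "centered_cube x r \<noteq> {}" using assms by (auto simp: centered_cube_def intro!: exI[of _ x])
  then show ?thesis unfolding centered_cube_eq_cbox by (simp add: content_cbox_cart)
qed

lemma emeasure_lebesgue_compact: "compact K \<Longrightarrow> emeasure lebesgue K < \<infinity>"
  using lmeasurable_compact[of K] by (simp add: fmeasurable_def del: emeasure_completion)

lemma emeasure_cubes: "Q \<in> cubes \<Longrightarrow> emeasure lebesgue Q = ennreal (measure lebesgue Q)"
  by (metis cubes_compact emeasure_lebesgue_compact emeasure_eq_ennreal_measure infinity_ennreal_def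
      less_irrefl)

lemma measure_cubes_pos: "Q \<in> cubes \<Longrightarrow> 0 < measure lebesgue Q"
  by (auto simp: mem_cubes_iff measure_centered_cube)

text \<open>Cubes are described by centre and half side for the sake of this symmetry: it turns an
  integral over y near x into one over x near y when the order of integration is exchanged.\<close>

lemma centered_cube_sym: "y \<in> centered_cube x r \<longleftrightarrow> x \<in> centered_cube y r"
  by (auto simp: centered_cube_def abs_minus_commute)

lemma centered_cube_subset: "y \<in> centered_cube x r \<Longrightarrow> r + s \<le> t \<Longrightarrow> centered_cube y s \<subseteq> centered_cube x t"
  unfolding centered_cube_def subset_iff mem_Collect_eq
proof (intro allI impI)
  fix z i assume *: "\<forall>i. \<bar>y $ i - x $ i\<bar> \<le> r" "\<forall>i. \<bar>z $ i - y $ i\<bar> \<le> s" "r + s \<le> t"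
  have "\<bar>y $ i - x $ i\<bar> \<le> r" "\<bar>z $ i - y $ i\<bar> \<le> s" using * by auto
  then show "\<bar>z $ i - x $ i\<bar> \<le> t" using *(3) by linarith
qed

lemma centered_cube_mono: "r \<le> s \<Longrightarrow> centered_cube x r \<subseteq> centered_cube x s"
  by (auto simp: centered_cube_def intro: order_trans)

lemma centered_cube_self: "0 \<le> r \<Longrightarrow> x \<in> centered_cube x r"
  by (auto simp: centered_cube_def)

section \<open>Sigma-finiteness, and measurability of integrals over moving cubes\<close>

lemma sigma_finite_lebesgue: "sigma_finite_measure (lebesgue :: (real ^ 'n) measure)"
proof
  show "\<exists>A. countable A \<and> A \<subseteq> sets (lebesgue :: (real ^ 'n) measure) \<and> \<Union> A = space lebesgue \<and> (\<forall>a\<in>A. emeasure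
      lebesgue a \<noteq> \<infinity>)"
  proof (intro exI[of _ "range (\<lambda>n::nat. centered_cube 0 (real n))"] conjI ballI)
    show "\<Union> (range (\<lambda>n::nat. centered_cube (0::real^'n) (real n))) = space lebesgue"
    proof -
      have "\<exists>n::nat. \<forall>i. \<bar>x $ i\<bar> \<le> real n" for x :: "real ^ 'n"
      proof -
        obtain n :: nat where n: "norm x \<le> real n" using real_arch_simple by blast
        then show ?thesis using component_le_norm_cart[of x] order_trans by blast
      qed
      then show ?thesis by (auto simp: centered_cube_def)
    qed
    show "range (\<lambda>n::nat. centered_cube (0::real^'n) (real n)) \<subseteq> sets lebesgue" by (auto simp: image_iff)
    show "emeasure lebesgue a \<noteq> \<infinity>" if "a \<in> range (\<lambda>n::nat. centered_cube (0::real^'n) (real n))" for a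
      using that emeasure_lebesgue_compact[OF centered_cube_compact] by (auto simp: less_top)
  qed auto
qed

lemma pair_sigma_finite_lebesgue:
  "pair_sigma_finite (lebesgue :: (real ^ 'n) measure) (lebesgue :: (real ^ 'n) measure)"
  by (simp add: pair_sigma_finite_def sigma_finite_lebesgue)

lemma lebesgue_borel_ident: "(\<lambda>x::real^'n. x) \<in> borel_measurable lebesgue"
  by (simp add: measurable_completion)

lemma borel_measurable_vec_nth_comp [measurable]:
  "f \<in> borel_measurable M \<Longrightarrow> (\<lambda>z. (f z :: real ^ 'n) $ i) \<in> borel_measurable M"
  using borel_measurable_nth[of i] by (rule measurable_compose[rotated])

lemma measurable_mem_centered_cube [measurable]:
  assumes [measurable]: "f \<in> borel_measurable M" "g \<in> borel_measurable M"
  shows "Measurable.pred M (\<lambda>z. (f z :: real ^ 'n) \<in> centered_cube (g z) r)"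
  unfolding centered_cube_def mem_Collect_eq by measurable

text \<open>The conditions defining a moving cube are Borel in the pair of points, so Borel
  measurability of the projections suffices even though the factors carry the completed
  sigma-algebra.\<close>

lemma fst_snd_lebesgue [measurable]:
  "fst \<in> borel_measurable ((lebesgue :: (real ^ 'n) measure) \<Otimes>\<^sub>M N)"
  "snd \<in> borel_measurable (N \<Otimes>\<^sub>M (lebesgue :: (real ^ 'n) measure))"
  using measurable_compose[OF measurable_fst lebesgue_borel_ident]
    measurable_compose[OF measurable_snd lebesgue_borel_ident] by auto

lemma borel_measurable_set_nn_integral_centered_cube:
  fixes g :: "real ^ 'n \<Rightarrow> ennreal"
  assumes [measurable]: "g \<in> borel_measurable lebesgue"
  shows "(\<lambda>x. \<integral>\<^sup>+y\<in>centered_cube x r. g y \<partial>lebesgue) \<in> borel_measurable lebesgue"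
proof -
  interpret sigma_finite_measure "lebesgue :: (real ^ 'n) measure" by (rule sigma_finite_lebesgue)
  have [measurable]: "(\<lambda>z. g (snd z) * indicator (centered_cube (fst z) r) (snd z)) \<in> borel_measurable
      (lebesgue \<Otimes>\<^sub>M lebesgue)"
    by (simp add: indicator_def of_bool_def) measurable
  show ?thesis by (rule borel_measurable_nn_integral) (simp add: case_prod_beta')
qed

lemma borel_measurable_set_integral_centered_cube:
  fixes g :: "real ^ 'n \<Rightarrow> real"
  assumes [measurable]: "g \<in> borel_measurable lebesgue"
  shows "(\<lambda>x. set_lebesgue_integral lebesgue (centered_cube x r) g) \<in> borel_measurable lebesgue"
proof -
  interpret sigma_finite_measure "lebesgue :: (real ^ 'n) measure" by (rule sigma_finite_lebesgue)
  have [measurable]: "(\<lambda>z. indicator (centered_cube (fst z) r) (snd z) *\<^sub>R g (snd z)) \<in> borel_measurable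
      (lebesgue \<Otimes>\<^sub>M lebesgue)"
    by (simp add: indicator_def of_bool_def) measurable
  show ?thesis unfolding set_lebesgue_integral_def
    by (rule borel_measurable_lebesgue_integral) (simp add: case_prod_beta')
qed

text \<open>The function is the pointwise limit of its truncations to cubes of half side
  \<open>n\<close>, each of which is integrable.\<close>

lemma locally_integrable_measurable:
  assumes "locally_integrable f" shows "f \<in> borel_measurable lebesgue"
proof -
  have m: "(\<lambda>x. indicator (centered_cube 0 (real n)) x *\<^sub>R f x) \<in> borel_measurable lebesgue" for n :: nat
    using assms centered_cube_compact[of 0 "real n"] unfolding locally_integrable_def set_integrable_def by
        (blast intro: borel_measurable_integrable)
  have "(\<lambda>n. indicator (centered_cube 0 (real n)) x *\<^sub>R f x) \<longlonglongrightarrow> f x" for x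
  proof (rule tendsto_eventually)
    obtain n0 :: nat where n: "norm x \<le> real n0" using real_arch_simple by blast
    show "\<forall>\<^sub>F n in sequentially. indicator (centered_cube 0 (real n)) x *\<^sub>R f x = f x"
    proof (rule eventually_sequentiallyI[of n0])
      fix k assume "n0 \<le> k"
      then have "\<bar>x $ i\<bar> \<le> real k" for i using component_le_norm_cart[of x i] n by linarith
      then have "x \<in> centered_cube 0 (real k)" by (simp add: centered_cube_def)
      then show "indicator (centered_cube 0 (real k)) x *\<^sub>R f x = f x" by simp
    qed
  qed
  then show ?thesis by (intro borel_measurable_LIMSEQ_real[OF _ m])
qed

lemma locally_integrable_nn:
  assumes "locally_integrable f" "compact K" shows "(\<integral>\<^sup>+x\<in>K. ennreal \<bar>f x\<bar> \<partial>lebesgue) < \<infinity>"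
proof -
  have "integrable lebesgue (\<lambda>x. indicator K x *\<^sub>R f x)"
    using assms by (simp add: locally_integrable_def set_integrable_def)
  then have "(\<integral>\<^sup>+x. ennreal (norm (indicator K x *\<^sub>R f x)) \<partial>lebesgue) < \<infinity>"
    by (simp add: integrable_iff_bounded)
  also have "(\<integral>\<^sup>+x. ennreal (norm (indicator K x *\<^sub>R f x)) \<partial>lebesgue) = (\<integral>\<^sup>+x\<in>K. ennreal \<bar>f x\<bar> \<partial>lebesgue)"
    by (intro nn_integral_cong) (auto simp: indicator_def)
  finally show ?thesis .
qed

lemma weight_measurable [measurable_dest]: "weight w \<Longrightarrow> w \<in> borel_measurable lebesgue"
  by (simp add: weight_def locally_integrable_measurable)

lemma weight_measure_finite: "weight w \<Longrightarrow> compact K \<Longrightarrow> weight_measure w K < \<infinity>"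
  using locally_integrable_nn[of w K] by (simp add: weight_def weight_measure_def)

lemma weight_measure_mono: "A \<subseteq> B \<Longrightarrow> weight_measure w A \<le> weight_measure w B"
  unfolding weight_measure_def by (intro nn_integral_mono) (auto simp: indicator_def)

lemma nn_average_eq:
  "Q \<in> cubes \<Longrightarrow> nn_average Q F * ennreal (measure lebesgue Q) = (\<integral>\<^sup>+x\<in>Q. F x \<partial>lebesgue)"
  unfolding nn_average_def
  using measure_cubes_pos[of Q] by (simp add: emeasure_cubes ennreal_divide_times del: emeasure_completion)

lemma epowr_pos: "0 < a \<Longrightarrow> 0 \<le> x \<Longrightarrow> ennreal x epowr a = ennreal (x powr a)"
  by (simp add: epowr_def)

lemma epowr_neg: "a < 0 \<Longrightarrow> 0 < x \<Longrightarrow> ennreal x epowr a = ennreal (x powr a)"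
  by (auto simp: epowr_def ennreal_eq_0_iff)

lemma epowr_measurable [measurable]:
  assumes [measurable]: "f \<in> borel_measurable M" shows "(\<lambda>x. f x epowr a) \<in> borel_measurable M"
  unfolding epowr_def by measurable

section \<open>\<open>A\<^sub>\<infinity>\<close> weights\<close>

lemma weight_measure_cube_real:
  "weight w \<Longrightarrow> Q \<in> cubes \<Longrightarrow> weight_measure w Q = ennreal (enn2real (weight_measure w Q))"
  using weight_measure_finite[OF _ cubes_compact, of w Q] by (simp add: less_top)

text \<open>This stands in for Hoelder's inequality in the \<open>A_class\<close> condition: either
  \<open>z\<close> or its negative power is at least 1. It is integrated with a rescaled weight in
  place of \<open>z\<close>.\<close>

lemma one_le_plus_powr_neg:
  fixes z e :: real assumes "0 < z" "0 < e" shows "1 \<le> z + z powr - e"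
proof (cases "z \<ge> 1")
  case True then show ?thesis using powr_ge_zero[of z "-e"] by linarith
next
  case False
  then have "1 powr (-e) \<le> z powr (-e)" using assms by (intro powr_mono2') auto
  then show ?thesis using assms by simp
qed

text \<open>A weight without mass on \<open>Q\<close> vanishes almost everywhere there, and its
  negative power is then infinite almost everywhere, against the finite dual average.\<close>

lemma weight_measure_cube_pos:
  assumes w: "weight w" and Q: "Q \<in> cubes"
    and fin: "nn_average Q (\<lambda>x. ennreal (w x) epowr a) < \<infinity>" and a: "a < 0"
  shows "0 < weight_measure w Q"
proof (rule ccontr)
  note [measurable] = weight_measurable[OF w] cubes_sets[OF Q]
  assume "\<not> 0 < weight_measure w Q"
  then have "(\<integral>\<^sup>+x\<in>Q. ennreal (w x) \<partial>lebesgue) = 0" by (simp add: weight_measure_def)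
  then have z: "AE x in lebesgue. ennreal (w x) * indicator Q x = 0"
    by (subst (asm) nn_integral_0_iff_AE) auto
  have "(\<integral>\<^sup>+x\<in>Q. ennreal (w x) epowr a \<partial>lebesgue) < \<infinity>"
    using fin nn_average_eq[OF Q, of "\<lambda>x. ennreal (w x) epowr a", symmetric]
    by (simp add: ennreal_mult_less_top)
  then have "AE x in lebesgue. (ennreal (w x) epowr a) * indicator Q x \<noteq> \<infinity>"
    by (intro nn_integral_noteq_infinite) auto
  then have "AE x in lebesgue. x \<notin> Q" using z
  proof eventually_elim
    case (elim x)
    then show ?case using a by (auto simp: epowr_def indicator_def split: if_splits)
  qed
  then have "emeasure lebesgue Q = 0"
    by (subst (asm) AE_iff_null_sets[symmetric, of Q lebesgue]) (auto simp: Q)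
  then show False using emeasure_cubes[OF Q] measure_cubes_pos[OF Q] by simp
qed

lemma A_infinity_weight: "w \<in> A_infinity \<Longrightarrow> weight w"
  by (auto simp: A_infinity_def A_class_def)

text \<open>Integrate 1 \<le> z + z^(-e) over \<open>E\<close>, with z a multiple of w divided by
  its average on \<open>Q\<close>. The \<open>A_class\<close> condition bounds the second term by
  half of \<eta> |Q|, so the first, a multiple of w(E)/w(Q) |Q|, must carry the other half.\<close>

lemma A_infinity_large_subset:
  fixes w :: "real ^ 'n \<Rightarrow> real"
  assumes w: "w \<in> A_infinity" and \<eta>: "0 < \<eta>"
  shows "\<exists>c>0. \<forall>Q\<in>cubes. 0 < weight_measure w Q \<and>
    (\<forall>E\<in>sets lebesgue. E \<subseteq> Q \<longrightarrow> \<eta> * measure lebesgue Q \<le> measure lebesgue E \<longrightarrow>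
       ennreal c * weight_measure w Q \<le> weight_measure w E)"
proof -
  have wt: "weight w" using A_infinity_weight[OF w] .
  note [measurable] = weight_measurable[OF wt]
  have w0: "0 \<le> w x" for x using wt by (simp add: weight_def)
  obtain p where p: "1 < p" and "w \<in> A_class p" using w by (auto simp: A_infinity_def)
  then obtain C where C: "0 < C" and
    AC: "\<And>Q. Q \<in> cubes \<Longrightarrow> nn_average Q (\<lambda>x. ennreal (w x) epowr (- conj_exp p / p)) < \<infinity>"
    "\<And>Q. Q \<in> cubes \<Longrightarrow> nn_average Q (\<lambda>x. ennreal (w x)) epowr (1 / p)
          * nn_average Q (\<lambda>x. ennreal (w x) epowr (- conj_exp p / p)) epowr (1 / conj_exp p) \<le> ennreal C"
    unfolding A_class_def by auto
  define p' where "p' = conj_exp p"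
  have p': "1 < p'" "1/p + 1/p' = 1" using p by (auto simp: p'_def conj_exp_def field_simps)
  define e where "e = p' / p"
  have e: "0 < e" using p p' by (simp add: e_def)
  \<comment> \<open>The scale at which the dual term is exactly \<open>\<eta> / 2\<close> times the
    measure of \<open>Q\<close>, as the equation \<open>se\<close> records.\<close>
  define s where "s = (\<eta> / (2 * C powr p')) powr (- 1 / e)"
  have s: "0 < s" using \<eta> C by (simp add: s_def)
  have se: "s powr (-e) * C powr p' = \<eta> / 2"
    using \<eta> C e unfolding s_def powr_powr by (simp add: field_simps)
  show ?thesis
  proof (intro exI[of _ "\<eta> / (2 * s)"] conjI ballI impI)
    show "0 < \<eta> / (2 * s)" using s \<eta> by simp
    fix Q :: "(real ^ 'n) set" assume Q: "Q \<in> cubes"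
    note [measurable] = cubes_sets[OF Q]
    define m where "m = measure lebesgue Q"
    have m: "0 < m" using measure_cubes_pos[OF Q] by (simp add: m_def)
    show WQ: "0 < weight_measure w Q"
      using weight_measure_cube_pos[OF wt Q AC(1)[OF Q]] p p' by (simp add: p'_def)
    define WQ' where "WQ' = enn2real (weight_measure w Q)"
    have WQ': "weight_measure w Q = ennreal WQ'" "0 < WQ'"
      using weight_measure_cube_real[OF wt Q] WQ weight_measure_finite[OF wt cubes_compact[OF Q]]
      by (auto simp: WQ'_def enn2real_positive_iff)
    define a where "a = WQ' / m"
    have a: "0 < a" using m WQ' by (simp add: a_def)
    have aQ: "nn_average Q (\<lambda>x. ennreal (w x)) = ennreal a"
      unfolding nn_average_def emeasure_cubes[OF Q] a_def
      using WQ' m by (simp add: weight_measure_def m_def divide_ennreal)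
    define B where "B = enn2real (nn_average Q (\<lambda>x. ennreal (w x) epowr (- e)))"
    have ee: "- conj_exp p / p = - e" by (simp add: e_def p'_def)
    have BQ: "nn_average Q (\<lambda>x. ennreal (w x) epowr (- e)) = ennreal B"
      using AC(1)[OF Q] unfolding ee by (simp add: B_def less_top)
    have B0: "0 \<le> B" by (simp add: B_def)
    have "ennreal (a powr (1/p)) * ennreal (B powr (1/p')) \<le> ennreal C"
      using AC(2)[OF Q, unfolded ee BQ aQ, folded p'_def] p p' a B0 by (simp add: epowr_pos)
    then have "a powr (1/p) * B powr (1/p') \<le> C"
      using C by (simp flip: ennreal_mult)
    \<comment> \<open>The power p' makes \<open>B\<close> appear linearly, as it does in the
      integrated inequality.\<close>
    then have "(a powr (1/p) * B powr (1/p')) powr p' \<le> C powr p'"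
      using p' by (intro powr_mono2) auto
    then have aB: "a powr e * B \<le> C powr p'"
      using p' a B0 p by (simp add: powr_mult powr_powr e_def field_simps)
    fix E :: "(real ^ 'n) set" assume E[measurable]: "E \<in> sets lebesgue" and EQ: "E \<subseteq> Q"
      and big: "\<eta> * measure lebesgue Q \<le> measure lebesgue E"
    have "emeasure lebesgue E \<le> emeasure lebesgue Q" using EQ by (intro emeasure_mono) auto
    then have emE: "emeasure lebesgue E = ennreal (measure lebesgue E)"
      using emeasure_cubes[OF Q] by (intro emeasure_eq_ennreal_measure) (auto simp: top_unique)
    have "weight_measure w E \<le> weight_measure w Q" by (rule weight_measure_mono[OF EQ])
    then obtain WE where WE: "weight_measure w E = ennreal WE" "0 \<le> WE"
      using WQ' by (cases "weight_measure w E") (auto simp: top_unique)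
    \<comment> \<open>At a zero of w the negative power is infinite, so the inequality holds there
      as well.\<close>
    have pt: "1 \<le> ennreal (s / a) * ennreal (w x) + ennreal ((s / a) powr - e) * (ennreal (w x) epowr (-e))"
        for x
    proof (cases "w x = 0")
      case True then show ?thesis using s a e by (simp add: epowr_def ennreal_mult_top)
    next
      case False
      then have "0 < w x" using w0[of x] by simp
      then have "1 \<le> (s/a) * w x + ((s/a) * w x) powr (-e)"
        using one_le_plus_powr_neg[of "(s/a) * w x" e] s a e by simp
      also have "\<dots> = (s/a) * w x + (s/a) powr (-e) * (w x) powr (-e)"
        using s a \<open>0 < w x\<close> powr_mult[of "s/a" "w x" "-e"] by simp
      finally show ?thesis using s a \<open>0 < w x\<close> e
        by (simp add: epowr_neg flip: ennreal_mult ennreal_plus ennreal_1)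
    qed
    have "emeasure lebesgue E = (\<integral>\<^sup>+x\<in>E. 1 \<partial>lebesgue)" by (simp del: emeasure_completion)
    also have "\<dots> \<le> (\<integral>\<^sup>+x. ennreal (s / a) * (ennreal (w x) * indicator E x) +
        ennreal ((s / a) powr - e) * (ennreal (w x) epowr (-e) * indicator Q x) \<partial>lebesgue)"
      using pt EQ by (intro nn_integral_mono) (auto simp: indicator_def)
    also have "\<dots> = ennreal (s / a) * weight_measure w E + ennreal ((s / a) powr - e) * (ennreal B * ennreal
        m)"
      unfolding BQ[symmetric] m_def nn_average_eq[OF Q] weight_measure_def
      by (subst nn_integral_add) (auto simp: nn_integral_cmult)
    finally have "ennreal (measure lebesgue E) \<le> ennreal (s / a * WE + (s / a) powr - e * (B * m))"
      unfolding WE emE using s a WE B0 m by (simp flip: ennreal_mult ennreal_plus)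
    then have up: "measure lebesgue E \<le> s / a * WE + (s / a) powr - e * (B * m)"
      using s a WE B0 m by (subst (asm) ennreal_le_iff) auto
    have "(s / a) powr - e * (B * m) = s powr (-e) * (a powr e * B) * m"
      using s a by (simp add: powr_divide powr_minus field_simps)
    also have "\<dots> \<le> s powr (-e) * C powr p' * m"
      using aB m by (intro mult_right_mono mult_left_mono) auto
    also have "\<dots> = \<eta> / 2 * m" unfolding se ..
    finally have "\<eta> / 2 * m \<le> s / a * WE" using up big unfolding m_def by argo
    then have "\<eta> / (2 * s) * WQ' \<le> WE"
      using s a m WQ' by (simp add: a_def field_simps)
    then show "ennreal (\<eta> / (2 * s)) * weight_measure w Q \<le> weight_measure w E"
      unfolding WE WQ'(1) using s \<eta> WQ' by (auto simp flip: ennreal_mult intro!: ennreal_leI)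
  qed
qed

text \<open>Needed to pass from sets of w-measure zero to Lebesgue null sets. Zeros of w are
  infinities of the dual power, whose integral is finite on every cube.\<close>

lemma A_infinity_AE_pos:
  assumes w: "w \<in> A_infinity" shows "AE x in lebesgue. 0 < w x"
proof -
  have wt: "weight w" using A_infinity_weight[OF w] .
  note [measurable] = weight_measurable[OF wt]
  obtain p where p: "1 < p" and "w \<in> A_class p" using w by (auto simp: A_infinity_def)
  then have fin: "nn_average Q (\<lambda>x. ennreal (w x) epowr (- conj_exp p / p)) < \<infinity>" if "Q \<in> cubes" for Q
    using that unfolding A_class_def by auto
  have e: "- conj_exp p / p < 0" using p by (simp add: conj_exp_def)
  have "AE x in lebesgue. x \<in> centered_cube 0 (real (Suc n)) \<longrightarrow> 0 < w x" for n
  proof -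
    have Q: "centered_cube 0 (real (Suc n)) \<in> cubes" by (intro centered_cube_in_cubes) simp
    have "(\<integral>\<^sup>+x\<in>centered_cube 0 (real (Suc n)). ennreal (w x) epowr (- conj_exp p / p) \<partial>lebesgue) < \<infinity>"
      using fin[OF Q] nn_average_eq[OF Q, of "\<lambda>x. ennreal (w x) epowr (- conj_exp p / p)", symmetric]
      by (simp add: ennreal_mult_less_top)
    then have "AE x in lebesgue. (ennreal (w x) epowr (- conj_exp p / p)) * indicator (centered_cube 0 (real
        (Suc n))) x \<noteq> \<infinity>"
      by (intro nn_integral_noteq_infinite) auto
    then show ?thesis
    proof eventually_elim
      case (elim x)
      have "0 \<le> w x" using wt by (simp add: weight_def)
      moreover have "ennreal 0 epowr (- conj_exp p / p) = \<infinity>" using e unfolding epowr_def by auto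
      ultimately show ?case using elim by (cases "w x = 0") (auto simp: indicator_def)
    qed
  qed
  then have "AE x in lebesgue. \<forall>n. x \<in> centered_cube 0 (real (Suc n)) \<longrightarrow> 0 < w x" unfolding AE_all_countable by
      blast
  then show ?thesis
  proof eventually_elim
    case (elim x)
    obtain n0 :: nat where n: "norm x \<le> real n0" using real_arch_simple by blast
    have "\<bar>x $ i\<bar> \<le> real (Suc n0)" for i using component_le_norm_cart[of x i] n by simp
    then show ?case using elim by (auto simp: centered_cube_def)
  qed
qed

text \<open>A subcube with at least a quarter of the side fills at least
  \<open>(1/4) ^ CARD('n)\<close> of the measure, so \<open>A_infinity_large_subset\<close> applies.
  The two centres may differ.\<close>

lemma A_infinity_doubling:
  fixes w :: "real ^ 'n \<Rightarrow> real"
  assumes w: "w \<in> A_infinity"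
  shows "\<exists>D\<ge>1. \<forall>x y r s. 0 < r \<longrightarrow> s \<le> 4 * r \<longrightarrow> centered_cube y r \<subseteq> centered_cube x s \<longrightarrow> weight_measure w
      (centered_cube x s) \<le> ennreal D * weight_measure w (centered_cube y r)"
proof -
  have "(0::real) < (1/4) ^ CARD('n)" by simp
  from A_infinity_large_subset[OF w this] obtain c where c: "0 < c" and
    cc: "\<And>Q E. Q \<in> cubes \<Longrightarrow> E \<in> sets lebesgue \<Longrightarrow> E \<subseteq> Q \<Longrightarrow> (1/4) ^ CARD('n) * measure lebesgue Q \<le> measure
        lebesgue E \<Longrightarrow>
       ennreal c * weight_measure w Q \<le> weight_measure w E" by blast
  show ?thesis
  proof (intro exI[of _ "max 1 (1/c)"] conjI allI impI)
    fix x y :: "real ^ 'n" and r s :: real assume r: "0 < r" "s \<le> 4 * r" "centered_cube y r \<subseteq> centered_cube x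
        s"
    have "y \<in> centered_cube x s" using r centered_cube_self[of r y] by auto
    then have s0: "0 \<le> s" unfolding centered_cube_def by (auto intro: order_trans[OF abs_ge_zero])
    \<comment> \<open>The inner cube has positive measure, which excludes a degenerate outer
      cube.\<close>
    have "measure lebesgue (centered_cube y r) \<le> measure lebesgue (centered_cube x s)"
      using r centered_cube_compact by (intro measure_mono_fmeasurable lmeasurable_compact) auto
    moreover have "0 < measure lebesgue (centered_cube y r)" using r by (intro measure_cubes_pos
        centered_cube_in_cubes)
    moreover have "measure lebesgue (centered_cube x 0) = 0" using measure_centered_cube[of 0 x] by simp
    ultimately have "s \<noteq> 0" by (metis linorder_not_le)
    then have s: "0 < s" using s0 by simp
    have "(1/4) ^ CARD('n) * (2 * s) ^ CARD('n) = (s/2) ^ CARD('n)" by (subst power_mult_distrib[symmetric])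
        simp
    also have "\<dots> \<le> (2*r) ^ CARD('n)" using r s by (intro power_mono) auto
    finally have "ennreal c * weight_measure w (centered_cube x s) \<le> weight_measure w (centered_cube y r)"
      using r s by (intro cc centered_cube_in_cubes) (auto simp: measure_centered_cube)
    then have "ennreal (1/c) * (ennreal c * weight_measure w (centered_cube x s)) \<le> ennreal (1/c) *
        weight_measure w (centered_cube y r)"
      by (rule mult_left_mono) simp
    also have "ennreal (1/c) * (ennreal c * weight_measure w (centered_cube x s)) = weight_measure w
        (centered_cube x s)"
      using c by (simp add: mult.assoc[symmetric] flip: ennreal_mult)
    also have "ennreal (1/c) * weight_measure w (centered_cube y r) \<le> ennreal (max 1 (1/c)) * weight_measure w
        (centered_cube y r)"
      by (intro mult_right_mono ennreal_leI) auto
    finally show "weight_measure w (centered_cube x s) \<le> ennreal (max 1 (1/c)) * weight_measure w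
        (centered_cube y r)" .
  qed simp
qed

text \<open>The only property of a measure that the John--Nirenberg iteration uses.  Lebesgue measure and \<open>A\<^sub>\<infinity>\<close>
  weights both have it, so one proof gives the exponential and the weighted integrability of \<open>b\<close>.\<close>
definition half_bounded :: "(real ^ 'n \<Rightarrow> real) \<Rightarrow> real \<Rightarrow> bool" where
  "half_bounded v \<beta> \<longleftrightarrow> (\<forall>Q\<in>cubes. \<forall>E\<in>sets lebesgue. E \<subseteq> Q \<longrightarrow> 2 * measure lebesgue E \<le> measure lebesgue Q \<longrightarrow>
     weight_measure v E \<le> ennreal \<beta> * weight_measure v Q)"

text \<open>The complement of \<open>E\<close> in \<open>Q\<close> has at least half the measure,
  hence by \<open>A_infinity_large_subset\<close> a fixed share \<open>c\<close> of the weight;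
  \<open>E\<close> gets at most the rest.\<close>

lemma A_infinity_half_bounded:
  fixes w :: "real ^ 'n \<Rightarrow> real"
  assumes w: "w \<in> A_infinity"
  shows "\<exists>\<beta>. 0 < \<beta> \<and> \<beta> < 1 \<and> half_bounded w \<beta>"
proof -
  have wt: "weight w" using A_infinity_weight[OF w] .
  note [measurable] = weight_measurable[OF wt]
  from A_infinity_large_subset[OF w, of "1/2"] obtain c where c: "0 < c" and
    cc: "\<And>Q E. Q \<in> cubes \<Longrightarrow> E \<in> sets lebesgue \<Longrightarrow> E \<subseteq> Q \<Longrightarrow> 1/2 * measure lebesgue Q \<le> measure lebesgue E \<Longrightarrow>
       ennreal c * weight_measure w Q \<le> weight_measure w E" by auto
  \<comment> \<open>The minimum with 1/2 keeps the constant strictly between 0 and 1 whatever the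
    size of \<open>c\<close>.\<close>
  show ?thesis
  proof (intro exI[of _ "1 - min c (1/2)"] conjI)
    show "0 < 1 - min c (1/2)" "1 - min c (1/2) < 1" using c by auto
    show "half_bounded w (1 - min c (1/2))" unfolding half_bounded_def
    proof (intro ballI impI)
      fix Q E :: "(real ^ 'n) set" assume Q: "Q \<in> cubes" and E[measurable]: "E \<in> sets lebesgue" and EQ: "E \<subseteq>
          Q"
        and sm: "2 * measure lebesgue E \<le> measure lebesgue Q"
      note [measurable] = cubes_sets[OF Q]
      have QM: "Q \<in> fmeasurable lebesgue" using Q by (simp add: cubes_compact lmeasurable_compact)
      have "measure lebesgue (Q - E) = measure lebesgue Q - measure lebesgue E"
        using QM EQ by (intro measurable_measure_Diff) auto
      then have "ennreal c * weight_measure w Q \<le> weight_measure w (Q - E)"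
        using sm by (intro cc Q) auto
      moreover have "weight_measure w Q = weight_measure w E + weight_measure w (Q - E)"
        unfolding weight_measure_def using EQ
        by (subst nn_integral_add[symmetric]) (auto intro!: nn_integral_cong simp: indicator_def)
      moreover obtain q where q: "weight_measure w Q = ennreal q" "0 \<le> q"
        using weight_measure_cube_real[OF wt Q] enn2real_nonneg by blast
      moreover obtain u where u: "weight_measure w E = ennreal u" "0 \<le> u"
        using weight_measure_mono[OF EQ, of w] q by (cases "weight_measure w E") (auto simp: top_unique)
      moreover obtain v where v: "weight_measure w (Q - E) = ennreal v" "0 \<le> v"
        using weight_measure_mono[of "Q - E" Q w] q by (cases "weight_measure w (Q - E)") (auto simp:
            top_unique)
      ultimately have "c * q \<le> v" "q = u + v" using c by (auto simp flip: ennreal_mult ennreal_plus)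
      moreover have "min c (1/2) * q \<le> c * q" using q by (intro mult_right_mono) auto
      ultimately have "u \<le> (1 - min c (1/2)) * q" by (simp add: algebra_simps)
      then show "weight_measure w E \<le> ennreal (1 - min c (1/2)) * weight_measure w Q"
        unfolding u(1) q(1) using q c by (auto simp flip: ennreal_mult intro!: ennreal_leI)
    qed
  qed
qed

lemma half_bounded_one: "half_bounded (\<lambda>_ :: real ^ 'n. 1) (1/2)"
  unfolding half_bounded_def weight_measure_def
proof (intro ballI impI)
  fix Q E :: "(real ^ 'n) set" assume Q: "Q \<in> cubes" and E[measurable]: "E \<in> sets lebesgue" and EQ: "E \<subseteq> Q"
    and sm: "2 * measure lebesgue E \<le> measure lebesgue Q"
  have "emeasure lebesgue E \<le> emeasure lebesgue Q" using EQ Q by (intro emeasure_mono) auto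
  then have emE: "emeasure lebesgue E = ennreal (measure lebesgue E)"
    using emeasure_cubes[OF Q] by (intro emeasure_eq_ennreal_measure) (auto simp: top_unique)
  show "(\<integral>\<^sup>+x\<in>E. ennreal 1 \<partial>lebesgue) \<le> ennreal (1/2) * (\<integral>\<^sup>+x\<in>Q. ennreal 1 \<partial>lebesgue)" (is "?L \<le> _ * ?R")
  proof -
    have "?L = ennreal (measure lebesgue E)" "?R = ennreal (measure lebesgue Q)"
      using Q by (simp_all add: emE emeasure_cubes del: emeasure_completion)
    moreover have "ennreal (measure lebesgue E) \<le> ennreal (1/2 * measure lebesgue Q)" using sm by (intro
        ennreal_leI) simp
    ultimately show ?thesis by (subst (asm) ennreal_mult) auto
  qed
qed

lemma weight_one: "weight (\<lambda>_ :: real ^ 'n. 1)"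
  unfolding weight_def locally_integrable_def set_integrable_def
  using lmeasurable_compact by (auto simp: fmeasurable_def intro!: integrable_real_indicator simp del:
      emeasure_completion)

section \<open>Dyadic cells\<close>

text \<open>Stopping arguments give estimates cell by cell; countable additivity of the two
  densities adds them up over the whole, possibly infinite, family.\<close>

lemma nn_integral_UN_le:
  assumes I: "countable I" and X: "disjoint_family_on X I" "\<And>i. i \<in> I \<Longrightarrow> X i \<in> sets M"
    and [measurable]: "f \<in> borel_measurable M" "g \<in> borel_measurable M"
    and le: "\<And>i. i \<in> I \<Longrightarrow> (\<integral>\<^sup>+x\<in>X i. f x \<partial>M) \<le> c * (\<integral>\<^sup>+x\<in>X i. g x \<partial>M)"
  shows "(\<integral>\<^sup>+x\<in>(\<Union>i\<in>I. X i). f x \<partial>M) \<le> c * (\<integral>\<^sup>+x\<in>(\<Union>i\<in>I. X i). g x \<partial>M)"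
proof -
  have U: "(\<Union>i\<in>I. X i) \<in> sets M" using I X(2) by (intro sets.countable_UN') auto
  have eq: "(\<integral>\<^sup>+x\<in>(\<Union>i\<in>I. X i). h x \<partial>M) = (\<integral>\<^sup>+i. (\<integral>\<^sup>+x\<in>X i. h x \<partial>M) \<partial>count_space I)"
    if [measurable]: "h \<in> borel_measurable M" for h
  proof -
    have "(\<integral>\<^sup>+x\<in>(\<Union>i\<in>I. X i). h x \<partial>M) = emeasure (density M h) (\<Union>i\<in>I. X i)"
      using U by (subst emeasure_density) auto
    also have "\<dots> = (\<integral>\<^sup>+i. emeasure (density M h) (X i) \<partial>count_space I)"
      using I X by (intro emeasure_UN_countable) auto
    also have "\<dots> = (\<integral>\<^sup>+i. (\<integral>\<^sup>+x\<in>X i. h x \<partial>M) \<partial>count_space I)"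
      using X(2) by (intro nn_integral_cong) (subst emeasure_density, auto)
    finally show ?thesis .
  qed
  have "(\<integral>\<^sup>+x\<in>(\<Union>i\<in>I. X i). f x \<partial>M) \<le> (\<integral>\<^sup>+i. c * (\<integral>\<^sup>+x\<in>X i. g x \<partial>M) \<partial>count_space I)"
    unfolding eq[OF assms(4)] using le by (intro nn_integral_mono) auto
  then show ?thesis unfolding eq[OF assms(5)] by (simp add: nn_integral_cmult)
qed

section \<open>Nested dyadic grids adapted to a given cube\<close>

definition grid_coord :: "real ^ 'n \<Rightarrow> real \<Rightarrow> nat \<Rightarrow> real ^ 'n \<Rightarrow> 'n \<Rightarrow> real" where
  "grid_coord a l m x i = 2 ^ m * (x $ i - a $ i) / l"

definition grid_index :: "real ^ 'n \<Rightarrow> real \<Rightarrow> nat \<Rightarrow> real ^ 'n \<Rightarrow> int ^ 'n" where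
  "grid_index a l m x = (\<chi> i. \<lfloor>grid_coord a l m x i\<rfloor>)"

definition grid_cell :: "real ^ 'n \<Rightarrow> real \<Rightarrow> nat \<Rightarrow> int ^ 'n \<Rightarrow> (real ^ 'n) set" where
  "grid_cell a l m z = {x. grid_index a l m x = z}"

text \<open>The half-open \<open>grid_cell\<close> partitions the space exactly at each generation,
  which disjointness needs; averages and mean oscillation are defined over closed cubes. Both
  versions are kept, and they agree up to a null set.\<close>

definition grid_cube :: "real ^ 'n \<Rightarrow> real \<Rightarrow> nat \<Rightarrow> int ^ 'n \<Rightarrow> (real ^ 'n) set" where
  "grid_cube a l m z = {x. \<forall>i. of_int (z $ i) \<le> grid_coord a l m x i \<and> grid_coord a l m x i \<le> of_int (z $ i) +
      1}"

lemma grid_coord_Suc: "grid_coord a l (Suc m) x i = 2 * grid_coord a l m x i"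
  by (simp add: grid_coord_def)

lemma grid_cell_alt: "grid_cell a l m z =
    {x. \<forall>i. of_int (z $ i) \<le> grid_coord a l m x i \<and> grid_coord a l m x i < of_int (z $ i) + 1}"
  by (auto simp: grid_cell_def grid_index_def vec_eq_iff floor_eq_iff)

lemma grid_cell_subset_cube: "grid_cell a l m z \<subseteq> grid_cube a l m z"
  unfolding grid_cell_alt grid_cube_def by (auto intro: less_imp_le)

lemma grid_cube_eq_centered_cube:
  fixes z :: "int ^ 'n"
  assumes "0 < l"
  shows "grid_cube a l m z = centered_cube (\<chi> i. a $ i + (of_int (z $ i) + 1/2) * l / 2 ^ m) (l / 2 ^ Suc m)"
proof -
  have "(of_int (z $ i) \<le> grid_coord a l m x i \<and> grid_coord a l m x i \<le> of_int (z $ i) + 1) \<longleftrightarrow>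
      \<bar>x $ i - (a $ i + (of_int (z $ i) + 1/2) * l / 2 ^ m)\<bar> \<le> l / 2 ^ Suc m" for x :: "real ^ 'n" and i
  proof -
    have "x $ i - (a $ i + (of_int (z $ i) + 1/2) * l / 2 ^ m) = (grid_coord a l m x i - of_int (z $ i) - 1/2)
        * (l / 2 ^ m)"
      using assms by (simp add: grid_coord_def field_simps)
    also have "\<bar>\<dots>\<bar> \<le> l / 2 ^ Suc m \<longleftrightarrow> \<bar>grid_coord a l m x i - of_int (z $ i) - 1/2\<bar> * (l / 2 ^ m) \<le> 1/2 * (l /
        2 ^ m)"
      using assms by (simp add: abs_mult)
    also have "\<dots> \<longleftrightarrow> \<bar>grid_coord a l m x i - of_int (z $ i) - 1/2\<bar> \<le> 1/2"
      using assms by (intro mult_le_cancel_right_pos) simp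
    finally show ?thesis by linarith
  qed
  then show ?thesis by (simp add: grid_cube_def centered_cube_def)
qed

lemma grid_cube_in_cubes: "0 < l \<Longrightarrow> grid_cube a l m z \<in> cubes"
  by (simp add: grid_cube_eq_centered_cube centered_cube_in_cubes)

lemma measure_grid_cube: "0 < l \<Longrightarrow> measure lebesgue (grid_cube a l m (z :: int ^ 'n)) = (l / 2 ^ m) ^ CARD('n)"
  by (simp add: grid_cube_eq_centered_cube measure_centered_cube)

lemma grid_cell_sets [measurable, simp]: "grid_cell a l m z \<in> sets lebesgue"
proof -
  have "Measurable.pred borel (\<lambda>x. \<forall>i. of_int (z $ i) \<le> grid_coord a l m x i \<and> grid_coord a l m x i < of_int
      (z $ i) + 1)"
    unfolding grid_coord_def by measurable
  then have "grid_cell a l m z \<in> sets borel" unfolding grid_cell_alt by (simp add: pred_def)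
  then show ?thesis by (simp add: sets_completionI_sets)
qed

text \<open>The two sets differ only on upper faces, which lie in finitely many coordinate
  hyperplanes.\<close>

lemma AE_grid_cube_iff_cell:
  fixes z :: "int ^ 'n"
  assumes l: "0 < l" shows "AE x in lebesgue. x \<in> grid_cube a l m z \<longleftrightarrow> x \<in> grid_cell a l m z"
proof -
  have null: "{x. x $ i = c} \<in> null_sets lebesgue" for i :: 'n and c :: real
    using negligible_standard_hyperplane[of "axis i 1 :: real ^ 'n" c]
    by (simp add: negligible_iff_null_sets cart_eq_inner_axis axis_in_Basis_iff)
  have "AE x in lebesgue. x $ i \<noteq> a $ i + (of_int (z $ i) + 1) * l / 2 ^ m" for i
    by (rule AE_I'[OF null[of i "a $ i + (of_int (z $ i) + 1) * l / 2 ^ m"]]) auto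
  then have "AE x in lebesgue. \<forall>i. x $ i \<noteq> a $ i + (of_int (z $ i) + 1) * l / 2 ^ m"
    unfolding AE_all_countable by blast
  then show ?thesis
  proof eventually_elim
    case (elim x)
    have "grid_coord a l m x i \<noteq> of_int (z $ i) + 1" for i
      using elim[rule_format, of i] l by (auto simp: grid_coord_def field_simps)
    then show ?case unfolding grid_cube_def grid_cell_alt by (auto simp: less_le)
  qed
qed

text \<open>The floor of 2t determines the floor of t, so a finer cell lies in a single coarser
  one.\<close>

lemma grid_index_Suc_cong: "grid_index a l (Suc m) x = grid_index a l (Suc m) y \<Longrightarrow> grid_index a l m x =
    grid_index a l m y"
proof -
  assume "grid_index a l (Suc m) x = grid_index a l (Suc m) y"
  then have *: "\<lfloor>2 * grid_coord a l m x i\<rfloor> = \<lfloor>2 * grid_coord a l m y i\<rfloor>" for i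
    by (simp add: grid_index_def vec_eq_iff grid_coord_Suc)
  have "\<lfloor>grid_coord a l m x i\<rfloor> = \<lfloor>grid_coord a l m y i\<rfloor>" for i
  proof -
    have "2 * \<lfloor>t\<rfloor> \<le> \<lfloor>2 * t\<rfloor>" "\<lfloor>2 * t\<rfloor> \<le> 2 * \<lfloor>t\<rfloor> + 1" for t :: real by linarith+
    from this[of "grid_coord a l m x i"] this[of "grid_coord a l m y i"] show ?thesis using *[of i] by
        linarith
  qed
  then show ?thesis by (simp add: grid_index_def)
qed

lemma grid_index_cong: "grid_index a l m x = grid_index a l m y \<Longrightarrow> j \<le> m \<Longrightarrow> grid_index a l j x = grid_index a l
    j y"
  by (induction m) (auto simp: le_Suc_eq dest: grid_index_Suc_cong)

lemma grid_cube_Suc_subset: "grid_cube a l (Suc m) (grid_index a l (Suc m) x) \<subseteq> grid_cube a l m (grid_index a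
    l m x)"
proof
  fix y assume "y \<in> grid_cube a l (Suc m) (grid_index a l (Suc m) x)"
  then have *: "of_int \<lfloor>2 * grid_coord a l m x i\<rfloor> \<le> 2 * grid_coord a l m y i \<and> 2 * grid_coord a l m y i \<le>
      of_int \<lfloor>2 * grid_coord a l m x i\<rfloor> + 1" for i
    by (simp add: grid_cube_def grid_index_def grid_coord_Suc)
  have "of_int \<lfloor>grid_coord a l m x i\<rfloor> \<le> grid_coord a l m y i \<and> grid_coord a l m y i \<le> of_int \<lfloor>grid_coord a l m
      x i\<rfloor> + 1" for i
  proof -
    have "2 * \<lfloor>grid_coord a l m x i\<rfloor> \<le> \<lfloor>2 * grid_coord a l m x i\<rfloor>" "\<lfloor>2 * grid_coord a l m x i\<rfloor> \<le> 2 *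
        \<lfloor>grid_coord a l m x i\<rfloor> + 1" by linarith+
    then show ?thesis using *[of i] by linarith
  qed
  then show "y \<in> grid_cube a l m (grid_index a l m x)" by (simp add: grid_cube_def grid_index_def)
qed

lemma grid_cube_antimono: "j \<le> m \<Longrightarrow> grid_cube a l m (grid_index a l m x) \<subseteq> grid_cube a l j (grid_index a l j
    x)"
  by (induction m rule: dec_induct) (use grid_cube_Suc_subset in blast)+

lemma grid_cube_small:
  fixes x :: "real ^ 'n"
  assumes l: "0 < l" and U: "open U" "x \<in> U"
  shows "\<exists>m. grid_cube a l m (grid_index a l m x) \<subseteq> U"
proof -
  obtain e where e: "0 < e" "ball x e \<subseteq> U" using U open_contains_ball by blast
  have "0 < e / (l * real CARD('n))" using e l zero_less_card_finite by (intro divide_pos_pos mult_pos_pos)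
      auto
  \<comment> \<open>Coordinates in one cube of generation \<open>m\<close> differ by at most
    \<open>l / 2 ^ m\<close>; the sum over all coordinates dominates the Euclidean norm and must
    stay below \<open>e\<close>.\<close>
  then obtain m where m: "(1/2) ^ m < e / (l * real CARD('n))"
    using real_arch_pow_inv[of "e / (l * real CARD('n))" "1/2"] by auto
  have "y \<in> ball x e" if y: "y \<in> grid_cube a l m (grid_index a l m x)" for y
  proof -
    have c: "\<bar>(y - x) $ i\<bar> \<le> l / 2 ^ m" for i
    proof -
      have "of_int \<lfloor>grid_coord a l m x i\<rfloor> \<le> grid_coord a l m y i" "grid_coord a l m y i \<le> of_int \<lfloor>grid_coord a
          l m x i\<rfloor> + 1"
        using y by (auto simp: grid_cube_def grid_index_def)
      then have "\<bar>grid_coord a l m y i - grid_coord a l m x i\<bar> \<le> 1" by linarith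
      moreover have "grid_coord a l m y i - grid_coord a l m x i = (y - x) $ i * (2 ^ m / l)"
        using l by (simp add: grid_coord_def field_simps)
      ultimately have "\<bar>(y - x) $ i * (2 ^ m / l)\<bar> \<le> 1" by simp
      also have "\<bar>(y - x) $ i * (2 ^ m / l)\<bar> = \<bar>(y - x) $ i\<bar> * (2 ^ m / l)" using l by (subst abs_mult) simp
      finally show ?thesis using l by (simp add: pos_le_divide_eq)
    qed
    have "norm (y - x) \<le> (\<Sum>i\<in>UNIV. \<bar>(y - x) $ i\<bar>)" by (rule norm_le_l1_cart)
    also have "\<dots> \<le> (\<Sum>i\<in>(UNIV::'n set). l / 2 ^ m)" using c by (intro sum_mono)
    also have "\<dots> = real CARD('n) * l * (1/2) ^ m" by (simp add: power_one_over)
    also have "\<dots> < e" using m l by (simp add: field_simps)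
    finally show ?thesis by (simp add: dist_norm norm_minus_commute)
  qed
  then show ?thesis using e by blast
qed

text \<open>Generation and position of the maximal cells that satisfy \<open>P\<close> and meet \<open>S\<close>.\<close>
definition stop_index :: "real ^ 'n \<Rightarrow> real \<Rightarrow> (nat \<Rightarrow> int ^ 'n \<Rightarrow> bool) \<Rightarrow> (real ^ 'n) set \<Rightarrow> (nat \<times> (int ^ 'n))
    set" where
  "stop_index a l P S = {(m, grid_index a l m x) | m x. x \<in> S \<and> P m (grid_index a l m x) \<and> (\<forall>j<m. \<not> P j
      (grid_index a l j x))}"

text \<open>If cells of generations m < m' met, the finer would lie inside the coarser. The coarser
  satisfies \<open>P\<close>, so the finer would have had an ancestor at which to stop
  earlier.\<close>

lemma stop_index_disjoint: "disjoint_family_on (\<lambda>(m, z). grid_cell a l m z) (stop_index a l P S)"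
proof -
  have key: "m' \<le> m" if "m < m' \<Longrightarrow> False" for m m' :: nat using that by force
  have main: False if i: "(m, z) \<in> stop_index a l P S" "(m', z') \<in> stop_index a l P S" "y \<in> grid_cell a l m z"
    "y \<in> grid_cell a l m' z'" "m < m'" for m z m' z' y
  proof -
    obtain x' where x': "z' = grid_index a l m' x'" "\<forall>j<m'. \<not> P j (grid_index a l j x')"
      using i(2) by (auto simp: stop_index_def)
    have "P m z" using i(1) by (auto simp: stop_index_def)
    moreover have "grid_index a l m x' = grid_index a l m y"
      using i x' by (intro grid_index_cong[of a l m' x' y m]) (auto simp: grid_cell_def)
    ultimately show False using x' i by (auto simp: grid_cell_def)
  qed
  show ?thesis unfolding disjoint_family_on_def
  proof (intro ballI impI)
    fix i j assume ij: "i \<in> stop_index a l P S" "j \<in> stop_index a l P S" "i \<noteq> j"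
    obtain m z m' z' where e: "i = (m, z)" "j = (m', z')" by fastforce
    have False if y: "y \<in> grid_cell a l m z" "y \<in> grid_cell a l m' z'" for y
    proof -
      have "m = m'" using main[of m z m' z' y] main[of m' z' m z y] ij y e by (metis nat_neq_iff)
      then show False using y ij e by (auto simp: grid_cell_def)
    qed
    then show "(case i of (m, z) \<Rightarrow> grid_cell a l m z) \<inter> (case j of (m, z) \<Rightarrow> grid_cell a l m z) = {}"
      unfolding e by auto
  qed
qed

lemma stop_index_cover:
  assumes "x \<in> S" "P m (grid_index a l m x)"
  shows "x \<in> (\<Union>(m, z)\<in>stop_index a l P S. grid_cell a l m z)"
proof -
  define k where "k = (LEAST m. P m (grid_index a l m x))"
  have "P k (grid_index a l k x)" using assms(2) unfolding k_def by (rule LeastI)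
  moreover have "\<forall>j<k. \<not> P j (grid_index a l j x)" unfolding k_def using not_less_Least by blast
  ultimately have "(k, grid_index a l k x) \<in> stop_index a l P S" using assms(1) by (auto simp: stop_index_def)
  then show ?thesis by (force simp: grid_cell_def)
qed

lemma countable_stop_index: "countable (stop_index a l P S)"
  by (rule countable_subset[of _ UNIV]) auto

lemma nn_integral_grid_cube:
  assumes l: "0 < l"
  shows "(\<integral>\<^sup>+x\<in>grid_cell a l m z. f x \<partial>lebesgue) = (\<integral>\<^sup>+x\<in>grid_cube a l m z. f x \<partial>lebesgue)"
  using AE_grid_cube_iff_cell[OF l, of a m z]
  by (intro nn_integral_cong_AE) (auto elim!: eventually_mono simp: indicator_def)

text \<open>This replaces Lebesgue's differentiation theorem: the set where \<open>g > L\<close> is covered by the maximal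
  cells inside an open superset of almost the same measure.\<close>
lemma AE_le_of_grid_averages:
  fixes g :: "real ^ 'n \<Rightarrow> ennreal"
  assumes l: "0 < l" and g[measurable]: "g \<in> borel_measurable lebesgue"
    and N[measurable]: "N \<in> sets lebesgue" and fin: "emeasure lebesgue N < \<infinity>" and L: "L < \<infinity>"
    and avg: "\<And>x m. x \<in> N \<Longrightarrow> nn_average (grid_cube a l m (grid_index a l m x)) g \<le> L"
  shows "AE x in lebesgue. x \<in> N \<longrightarrow> g x \<le> L"
proof -
  define E where "E = {x \<in> space lebesgue. x \<in> N \<and> L < g x}"
  have E[measurable]: "E \<in> sets lebesgue" unfolding E_def by measurable
  have EN: "E \<subseteq> N" by (auto simp: E_def)
  have finE: "emeasure lebesgue E < \<infinity>"
    using emeasure_mono[OF EN N] fin by (simp add: le_less_trans del: emeasure_completion)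
  have bound: "(\<integral>\<^sup>+x\<in>E. g x \<partial>lebesgue) \<le> L * (emeasure lebesgue E + ennreal e)" if e: "0 < e" for e :: real
  proof -
    obtain U where U: "open U" "E \<subseteq> U" "U - E \<in> lmeasurable" "emeasure lebesgue (U - E) < ennreal e"
      using sets_lebesgue_outer_open[OF E e] by blast
    have [measurable]: "U \<in> sets lebesgue" using U by (simp add: lebesgue_openin)
    define P where "P m z \<longleftrightarrow> grid_cube a l m z \<subseteq> U" for m z
    define J where "J = stop_index a l P E"
    let ?X = "\<lambda>(m, z). grid_cell a l m z"
    have cover: "E \<subseteq> (\<Union>i\<in>J. ?X i)"
    proof
      fix x assume x: "x \<in> E"
      then obtain m where "P m (grid_index a l m x)"
        using grid_cube_small[OF l U(1), where x=x and a=a] U(2) by (auto simp: P_def)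
      then show "x \<in> (\<Union>i\<in>J. ?X i)" unfolding J_def by (rule stop_index_cover[OF x])
    qed
    have "(\<integral>\<^sup>+x\<in>E. g x \<partial>lebesgue) \<le> (\<integral>\<^sup>+x\<in>(\<Union>i\<in>J. ?X i). g x \<partial>lebesgue)"
      using cover by (intro nn_integral_mono) (auto simp: indicator_def)
    also have "\<dots> \<le> L * (\<integral>\<^sup>+x\<in>(\<Union>i\<in>J. ?X i). 1 \<partial>lebesgue)"
    proof (rule nn_integral_UN_le)
      show "countable J" "disjoint_family_on ?X J" unfolding J_def by (rule countable_stop_index
          stop_index_disjoint)+
      fix i assume "i \<in> J"
      then obtain m x where i: "i = (m, grid_index a l m x)" "x \<in> E" by (auto simp: J_def stop_index_def)
      define K where "K = grid_cube a l m (grid_index a l m x)"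
      have K: "K \<in> cubes" unfolding K_def by (rule grid_cube_in_cubes[OF l])
      show "?X i \<in> sets lebesgue" by (simp add: i)
      have "(\<integral>\<^sup>+x\<in>?X i. g x \<partial>lebesgue) = (\<integral>\<^sup>+x\<in>K. g x \<partial>lebesgue)"
        by (simp add: i K_def nn_integral_grid_cube[OF l])
      also have "\<dots> \<le> L * emeasure lebesgue K"
        using avg[of x m] i EN unfolding K_def[symmetric] nn_average_eq[OF K, symmetric] emeasure_cubes[OF K]
        by (intro mult_right_mono) auto
      also have "emeasure lebesgue K = (\<integral>\<^sup>+x\<in>?X i. 1 \<partial>lebesgue)"
        using K nn_integral_grid_cube[OF l, where f = "\<lambda>_. 1" and a = a and m = m and z = "grid_index a l m
            x"] by (simp add: i K_def del: emeasure_completion)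
      finally show "(\<integral>\<^sup>+x\<in>?X i. g x \<partial>lebesgue) \<le> L * (\<integral>\<^sup>+x\<in>?X i. 1 \<partial>lebesgue)" .
    qed auto
    also have "(\<integral>\<^sup>+x\<in>(\<Union>i\<in>J. ?X i). 1 \<partial>lebesgue) \<le> (\<integral>\<^sup>+x\<in>U. 1 \<partial>lebesgue)"
    proof (intro nn_integral_mono)
      have "(\<Union>i\<in>J. ?X i) \<subseteq> U"
        unfolding J_def stop_index_def P_def using grid_cell_subset_cube by fastforce
      then show "1 * indicator (\<Union>i\<in>J. ?X i) x \<le> (1 * indicator U x :: ennreal)" for x by (auto simp:
          indicator_def)
    qed
    also have "\<dots> = emeasure lebesgue U" by (simp del: emeasure_completion)
    also have "\<dots> = emeasure lebesgue E + emeasure lebesgue (U - E)"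
      using U(2) by (subst plus_emeasure) (auto simp: Un_absorb1 simp del: emeasure_completion)
    also have "\<dots> \<le> emeasure lebesgue E + ennreal e" using U by (intro add_left_mono) simp
    finally show ?thesis by (simp add: mult_left_mono)
  qed
  have le: "(\<integral>\<^sup>+x\<in>E. g x \<partial>lebesgue) \<le> L * emeasure lebesgue E"
  proof (rule ennreal_le_epsilon)
    fix e :: real assume e: "0 < e"
    \<comment> \<open>The denominator exceeds \<open>L\<close> by 1 so that \<open>L = 0\<close>
      needs no separate treatment.\<close>
    have "(\<integral>\<^sup>+x\<in>E. g x \<partial>lebesgue) \<le> L * (emeasure lebesgue E + ennreal (e / (enn2real L + 1)))"
      using e by (intro bound) (simp add: add_nonneg_pos)
    also have "\<dots> = L * emeasure lebesgue E + L * ennreal (e / (enn2real L + 1))" by (simp add: distrib_left)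
    also have "L * ennreal (e / (enn2real L + 1)) = ennreal (enn2real L * (e / (enn2real L + 1)))"
      using L e by (subst ennreal_mult) (auto simp: less_top)
    also have "enn2real L * (e / (enn2real L + 1)) \<le> e"
      using e enn2real_nonneg[of L] by (simp add: pos_divide_le_eq add_pos_nonneg add_nonneg_pos
          algebra_simps)
    finally show "(\<integral>\<^sup>+x\<in>E. g x \<partial>lebesgue) \<le> L * emeasure lebesgue E + ennreal e"
      by (simp add: add_left_mono ennreal_leI)
  qed
  \<comment> \<open>On \<open>E\<close> the truncated difference is a true one and strictly
    positive. Cancelling the finite term \<open>L * emeasure lebesgue E\<close> shows that its
    integral is 0, which forces \<open>E\<close> to be null.\<close>
  have "(\<integral>\<^sup>+x\<in>E. g x \<partial>lebesgue) = (\<integral>\<^sup>+x\<in>E. (g x - L) \<partial>lebesgue) + (\<integral>\<^sup>+x\<in>E. L \<partial>lebesgue)"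
    by (subst nn_integral_add[symmetric]) (auto intro!: nn_integral_cong simp: indicator_def E_def
        diff_add_cancel_ennreal)
  moreover have "(\<integral>\<^sup>+x\<in>E. L \<partial>lebesgue) = L * emeasure lebesgue E" by (simp add: nn_integral_cmult_indicator
      del: emeasure_completion)
  ultimately have "L * emeasure lebesgue E + (\<integral>\<^sup>+x\<in>E. (g x - L) \<partial>lebesgue) \<le> L * emeasure lebesgue E + 0"
    using le by (simp add: add.commute)
  moreover have "L * emeasure lebesgue E < \<infinity>" using finE L by (simp add: ennreal_mult_less_top del:
      emeasure_completion)
  ultimately have "(\<integral>\<^sup>+x\<in>E. (g x - L) \<partial>lebesgue) = 0"
    by (subst (asm) ennreal_add_left_cancel_le) (auto simp del: emeasure_completion)
  then have "AE x in lebesgue. (g x - L) * indicator E x = 0"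
    by (subst (asm) nn_integral_0_iff_AE) auto
  then show ?thesis
    by eventually_elim (auto simp: E_def indicator_def diff_eq_0_iff_ennreal not_le)
qed

section \<open>The John--Nirenberg inequality\<close>

lemma nn_average_le_iff:
  assumes Q: "Q \<in> cubes"
  shows "nn_average Q F \<le> c \<longleftrightarrow> (\<integral>\<^sup>+x\<in>Q. F x \<partial>lebesgue) \<le> c * ennreal (measure lebesgue Q)"
proof
  show "nn_average Q F \<le> c \<Longrightarrow> (\<integral>\<^sup>+x\<in>Q. F x \<partial>lebesgue) \<le> c * ennreal (measure lebesgue Q)"
    unfolding nn_average_eq[OF Q, symmetric] by (rule mult_right_mono) simp_all
  show "(\<integral>\<^sup>+x\<in>Q. F x \<partial>lebesgue) \<le> c * ennreal (measure lebesgue Q) \<Longrightarrow> nn_average Q F \<le> c"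
    unfolding nn_average_def emeasure_cubes[OF Q]
    using measure_cubes_pos[OF Q] by (intro divide_le_posI_ennreal) (auto simp: mult.commute)
qed

text \<open>Subdivide \<open>Q\<close> and stop at the first cube whose average exceeds
  \<open>2 * M\<close>. Its parent did not stop, and passing to the parent costs
  \<open>2 ^ CARD('n)\<close> in measure: this gives the upper bound. Chebyshev's inequality at
  height \<open>2 * M\<close> gives the factor 2 in the measure bound. Off the cells no average
  exceeds \<open>2 * M\<close>.\<close>

lemma Calderon_Zygmund_cells:
  fixes g :: "real ^ 'n \<Rightarrow> ennreal"
  assumes Q: "Q \<in> cubes" and g[measurable]: "g \<in> borel_measurable lebesgue"
    and M: "0 < M" "nn_average Q g \<le> ennreal M"
  obtains I :: "(nat \<times> (int ^ 'n)) set" and X K where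
    "countable I" "disjoint_family_on X I" "\<And>i. i \<in> I \<Longrightarrow> X i \<in> sets lebesgue"
    "\<And>i. i \<in> I \<Longrightarrow> K i \<in> cubes" "\<And>i. i \<in> I \<Longrightarrow> X i \<subseteq> K i" "\<And>i. i \<in> I \<Longrightarrow> K i \<subseteq> Q"
    "\<And>i. i \<in> I \<Longrightarrow> AE x in lebesgue. x \<in> K i \<longleftrightarrow> x \<in> X i"
    "\<And>i. i \<in> I \<Longrightarrow> nn_average (K i) g \<le> ennreal (2 ^ Suc CARD('n) * M)"
    "2 * measure lebesgue (\<Union>i\<in>I. X i) \<le> measure lebesgue Q"
    "AE x in lebesgue. x \<in> Q \<longrightarrow> x \<notin> (\<Union>i\<in>I. X i) \<longrightarrow> g x \<le> ennreal (2 * M)"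
proof -
  note [measurable] = cubes_sets[OF Q]
  obtain x0 r where r: "0 < r" "Q = centered_cube x0 r" using Q by (auto simp: mem_cubes_iff)
  \<comment> \<open>Anchoring the grid at the lower corner, with unit equal to the side, makes
    \<open>Q\<close> the closed cube of generation 0 and index 0.\<close>
  define a where "a = (\<chi> i. x0 $ i - r)"
  define l where "l = 2 * r"
  have l: "0 < l" using r by (simp add: l_def)
  have Q0: "grid_cube a l 0 0 = Q"
    unfolding grid_cube_eq_centered_cube[OF l] r by (rule arg_cong2[where f = centered_cube]) (auto simp:
        a_def l_def vec_eq_iff field_simps)
  define P where "P m z \<longleftrightarrow> ennreal (2 * M) < nn_average (grid_cube a l m z) g" for m z
  define S where "S = grid_cell a l 0 0"
  define I where "I = stop_index a l P S"
  define X where "X = (\<lambda>(m, z). grid_cell a l m z)"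
  define K where "K = (\<lambda>(m, z). grid_cube a l m z)"
  have nP0: "\<not> P 0 0" unfolding P_def Q0 using M by (auto simp: not_less intro: order_trans ennreal_leI)
  have SQ: "S \<subseteq> Q" unfolding S_def Q0[symmetric] by (rule grid_cell_subset_cube)
  have Kc: "K i \<in> cubes" for i unfolding K_def by (cases i) (simp add: grid_cube_in_cubes[OF l])
  have Xm[measurable]: "X i \<in> sets lebesgue" for i unfolding X_def by (cases i) simp
  have XK: "X i \<subseteq> K i" for i unfolding X_def K_def by (cases i) (simp add: grid_cell_subset_cube)
  have AEX: "AE x in lebesgue. x \<in> K i \<longleftrightarrow> x \<in> X i" for i
    unfolding X_def K_def by (cases i) (simp add: AE_grid_cube_iff_cell[OF l])
  have intX: "(\<integral>\<^sup>+x\<in>X i. h x \<partial>lebesgue) = (\<integral>\<^sup>+x\<in>K i. h x \<partial>lebesgue)" for i h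
    unfolding X_def K_def by (cases i) (simp add: nn_integral_grid_cube[OF l])
  have KQ: "K i \<subseteq> Q" and Kavg: "nn_average (K i) g \<le> ennreal (2 ^ Suc CARD('n) * M)"
    and Klow: "ennreal (2 * M) \<le> nn_average (K i) g" if i: "i \<in> I" for i
  proof -
    obtain m x where x: "i = (m, grid_index a l m x)" "x \<in> S" "P m (grid_index a l m x)"
      "\<And>j. j < m \<Longrightarrow> \<not> P j (grid_index a l j x)"
      using i unfolding I_def stop_index_def by blast
    have x0: "grid_index a l 0 x = 0" using x(2) by (simp add: S_def grid_cell_def)
    show "K i \<subseteq> Q" using grid_cube_antimono[of 0 m a l x] unfolding x0 Q0 K_def x(1) by simp
    show "ennreal (2 * M) \<le> nn_average (K i) g" using x(3) unfolding P_def K_def x(1) by simp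
    \<comment> \<open>The initial cube has average at most \<open>M\<close>, so it does not stop and
      every stopping cube has a parent inside \<open>Q\<close>.\<close>
    have "m \<noteq> 0" using x(3) x0 nP0 by (metis)
    then obtain j where j: "m = Suc j" by (cases m) auto
    define R where "R = grid_cube a l j (grid_index a l j x)"
    have R: "R \<in> cubes" unfolding R_def by (rule grid_cube_in_cubes[OF l])
    have KR: "K i \<subseteq> R" unfolding K_def R_def x(1) j by (simp add: grid_cube_Suc_subset)
    have "\<not> P j (grid_index a l j x)" using x(4) j by simp
    then have "nn_average R g \<le> ennreal (2 * M)" by (simp add: P_def R_def)
    then have "(\<integral>\<^sup>+x\<in>R. g x \<partial>lebesgue) \<le> ennreal (2 * M) * ennreal (measure lebesgue R)"
      using nn_average_le_iff[OF R] by blast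
    also have "measure lebesgue R = 2 ^ CARD('n) * measure lebesgue (K i)"
      unfolding R_def K_def x(1) j using l by (simp add: measure_grid_cube power_divide power_mult_distrib)
    also have "ennreal (2 * M) * ennreal (2 ^ CARD('n) * measure lebesgue (K i)) =
        ennreal (2 ^ Suc CARD('n) * M) * ennreal (measure lebesgue (K i))"
      using M by (simp flip: ennreal_mult add: mult_ac)
    finally have "(\<integral>\<^sup>+x\<in>R. g x \<partial>lebesgue) \<le> ennreal (2 ^ Suc CARD('n) * M) * ennreal (measure lebesgue (K i))"
        .
    moreover have "(\<integral>\<^sup>+x\<in>K i. g x \<partial>lebesgue) \<le> (\<integral>\<^sup>+x\<in>R. g x \<partial>lebesgue)"
      using KR by (intro nn_integral_mono) (auto simp: indicator_def)
    ultimately show "nn_average (K i) g \<le> ennreal (2 ^ Suc CARD('n) * M)"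
      unfolding nn_average_le_iff[OF Kc] by (rule order_trans[rotated])
  qed
  have cI: "countable I" and dX: "disjoint_family_on X I"
    unfolding I_def X_def by (rule countable_stop_index stop_index_disjoint)+
  have Um[measurable]: "(\<Union>i\<in>I. X i) \<in> sets lebesgue" using cI by (intro sets.countable_UN') auto
  have UQ: "(\<Union>i\<in>I. X i) \<subseteq> Q" using XK KQ by fast
  have "emeasure lebesgue (\<Union>i\<in>I. X i) = (\<integral>\<^sup>+x\<in>(\<Union>i\<in>I. X i). 1 \<partial>lebesgue)"
    by (simp del: emeasure_completion)
  also have "\<dots> \<le> ennreal (1 / (2 * M)) * (\<integral>\<^sup>+x\<in>(\<Union>i\<in>I. X i). g x \<partial>lebesgue)"
  proof (rule nn_integral_UN_le[OF cI dX])
    fix i assume i: "i \<in> I"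
    have "ennreal (2 * M) * ennreal (measure lebesgue (K i)) \<le> (\<integral>\<^sup>+x\<in>K i. g x \<partial>lebesgue)"
      using Klow[OF i] unfolding nn_average_eq[OF Kc, symmetric] by (rule mult_right_mono) simp
    then have "ennreal (1 / (2 * M)) * (ennreal (2 * M) * ennreal (measure lebesgue (K i))) \<le> ennreal (1 / (2
        * M)) * (\<integral>\<^sup>+x\<in>K i. g x \<partial>lebesgue)"
      by (rule mult_left_mono) simp
    also have "ennreal (1 / (2 * M)) * (ennreal (2 * M) * ennreal (measure lebesgue (K i))) = emeasure
        lebesgue (K i)"
      using M by (simp add: emeasure_cubes[OF Kc] mult.assoc[symmetric] flip: ennreal_mult)
    finally show "(\<integral>\<^sup>+x\<in>X i. 1 \<partial>lebesgue) \<le> ennreal (1 / (2 * M)) * (\<integral>\<^sup>+x\<in>X i. g x \<partial>lebesgue)"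
      using Kc[of i] unfolding intX by (simp del: emeasure_completion)
  qed auto
  also have "(\<integral>\<^sup>+x\<in>(\<Union>i\<in>I. X i). g x \<partial>lebesgue) \<le> (\<integral>\<^sup>+x\<in>Q. g x \<partial>lebesgue)"
    using UQ by (intro nn_integral_mono) (auto simp: indicator_def)
  also have "\<dots> \<le> ennreal M * ennreal (measure lebesgue Q)"
    using M nn_average_le_iff[OF Q] by blast
  finally have em: "emeasure lebesgue (\<Union>i\<in>I. X i) \<le> ennreal (1 / (2 * M) * (M * measure lebesgue Q))"
    using M by (simp add: mult_left_mono flip: ennreal_mult)
  have "measure lebesgue (\<Union>i\<in>I. X i) \<le> 1 / (2 * M) * (M * measure lebesgue Q)"
    using enn2real_mono[OF em] M measure_cubes_pos[OF Q]
    unfolding measure_def[of lebesgue "\<Union>i\<in>I. X i"] by (simp del: emeasure_completion)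
  then have half: "2 * measure lebesgue (\<Union>i\<in>I. X i) \<le> measure lebesgue Q" using M by simp
  have "AE x in lebesgue. x \<in> S - (\<Union>i\<in>I. X i) \<longrightarrow> g x \<le> ennreal (2 * M)"
  proof (rule AE_le_of_grid_averages[OF l])
    have Sm: "S \<in> sets lebesgue" by (simp add: S_def)
    then show "S - (\<Union>i\<in>I. X i) \<in> sets lebesgue" by measurable
    have "emeasure lebesgue (S - (\<Union>i\<in>I. X i)) \<le> emeasure lebesgue Q"
      using SQ by (intro emeasure_mono) auto
    then show "emeasure lebesgue (S - (\<Union>i\<in>I. X i)) < \<infinity>"
      using emeasure_cubes[OF Q] by (auto simp: le_less_trans simp del: emeasure_completion)
    fix x m assume x: "x \<in> S - (\<Union>i\<in>I. X i)"
    have "\<not> P m (grid_index a l m x)"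
      using stop_index_cover[of x S P m a l] x unfolding I_def X_def by blast
    then show "nn_average (grid_cube a l m (grid_index a l m x)) g \<le> ennreal (2 * M)"
      by (simp add: P_def)
  qed auto
  moreover have "AE x in lebesgue. x \<in> Q \<longleftrightarrow> x \<in> S"
    using AE_grid_cube_iff_cell[OF l, of a 0 0] by (simp add: Q0 S_def)
  ultimately have "AE x in lebesgue. x \<in> Q \<longrightarrow> x \<notin> (\<Union>i\<in>I. X i) \<longrightarrow> g x \<le> ennreal (2 * M)"
    by eventually_elim auto
  with that[of I X K] cI dX Xm Kc XK KQ AEX Kavg half show thesis by blast
qed

lemma locally_integrable_set_integrable:
  "locally_integrable b \<Longrightarrow> Q \<in> cubes \<Longrightarrow> set_integrable lebesgue Q b"
  by (simp add: locally_integrable_def cubes_compact)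

lemma average_minus_const_le:
  assumes b: "locally_integrable b" and Q: "Q \<in> cubes" and L: "0 \<le> L"
    and le: "nn_average Q (\<lambda>x. ennreal \<bar>b x - c\<bar>) \<le> ennreal L"
  shows "\<bar>average Q b - c\<bar> \<le> L"
proof -
  define m where "m = measure lebesgue Q"
  have m: "0 < m" using measure_cubes_pos[OF Q] by (simp add: m_def)
  have ib: "set_integrable lebesgue Q b" using locally_integrable_set_integrable[OF b Q] .
  have ic: "set_integrable lebesgue Q (\<lambda>_. c)"
    unfolding set_integrable_def using emeasure_cubes[OF Q] Q
    by (intro integrable_scaleR_left integrable_real_indicator) (auto simp del: emeasure_completion)
  have int: "integrable lebesgue (\<lambda>x. indicator Q x *\<^sub>R (b x - c))"
    using set_integral_diff(1)[OF ib ic] by (simp add: set_integrable_def)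
  have "(LINT x:Q|lebesgue. b x - c) = (LINT x:Q|lebesgue. b x) - (LINT x:Q|lebesgue. c)"
    using set_integral_diff(2)[OF ib ic] .
  also have "(LINT x:Q|lebesgue. c) = m * c"
    using Q emeasure_cubes[OF Q] by (simp add: set_integral_const m_def del: emeasure_completion)
  finally have eq: "(LINT x:Q|lebesgue. b x - c) = m * (average Q b - c)"
    using m by (simp add: average_def m_def[symmetric] algebra_simps)
  have "ennreal \<bar>LINT x:Q|lebesgue. b x - c\<bar> \<le> (\<integral>\<^sup>+x. norm (indicator Q x *\<^sub>R (b x - c)) \<partial>lebesgue)"
    using integral_norm_bound_ennreal[OF int] by (simp add: set_lebesgue_integral_def)
  also have "\<dots> = (\<integral>\<^sup>+x\<in>Q. ennreal \<bar>b x - c\<bar> \<partial>lebesgue)"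
    by (intro nn_integral_cong) (auto simp: indicator_def)
  also have "\<dots> \<le> ennreal L * ennreal m" using le unfolding nn_average_le_iff[OF Q] m_def .
  finally have "m * \<bar>average Q b - c\<bar> \<le> L * m" unfolding eq using m L
    by (simp add: abs_mult flip: ennreal_mult)
  then show ?thesis using m by (simp add: mult.commute)
qed

text \<open>A strictly positive bound is fixed instead of the norm itself, so that stopping heights
  stay positive even for constant \<open>b\<close>.\<close>

definition bmo_bound :: "(real ^ 'n \<Rightarrow> real) \<Rightarrow> real \<Rightarrow> bool" where
  "bmo_bound b M \<longleftrightarrow> locally_integrable b \<and> 0 < M \<and>
     (\<forall>Q\<in>cubes. nn_average Q (\<lambda>x. ennreal \<bar>b x - average Q b\<bar>) \<le> ennreal M)"

lemma BMO_bound: "b \<in> BMO \<Longrightarrow> \<exists>M. bmo_bound b M"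
proof -
  assume b: "b \<in> BMO"
  have "nn_average Q (\<lambda>x. ennreal \<bar>b x - average Q b\<bar>) \<le> ennreal (enn2real (bmo_norm b) + 1)" if "Q \<in> cubes"
      for Q
  proof -
    have "nn_average Q (\<lambda>x. ennreal \<bar>b x - average Q b\<bar>) \<le> bmo_norm b"
      unfolding bmo_norm_def using that by (rule SUP_upper)
    also have "\<dots> = ennreal (enn2real (bmo_norm b))" using b by (simp add: BMO_def less_top)
    also have "\<dots> \<le> ennreal (enn2real (bmo_norm b) + 1)" by (intro ennreal_leI) simp
    finally show ?thesis .
  qed
  then show ?thesis using b unfolding bmo_bound_def BMO_def
    by (intro exI[of _ "enn2real (bmo_norm b) + 1"]) (auto simp: add_nonneg_pos)
qed

text \<open>Induction on the level, for all cubes at once. Stop at a multiple of the mean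
  oscillation. Off the cells the first level is not reached; on a cell, replacing the average over
  \<open>Q\<close> by that over the cell costs one level. The induction hypothesis on each cell and
  \<open>half_bounded\<close> for their union contribute the factors \<open>\<beta> ^ j\<close> and
  \<open>\<beta>\<close>.\<close>

lemma John_Nirenberg_distribution:
  fixes b v :: "real ^ 'n \<Rightarrow> real"
  assumes b: "bmo_bound b M" and v: "weight v" and \<beta>: "half_bounded v \<beta>" "0 \<le> \<beta>"
    and Q: "Q \<in> cubes"
  shows "(\<integral>\<^sup>+x\<in>Q. ennreal (v x) * indicator {x. real j * (2 ^ Suc CARD('n) * M) < \<bar>b x - average Q b\<bar>} x
      \<partial>lebesgue)
      \<le> ennreal (\<beta> ^ j) * weight_measure v Q"
  using Q
proof (induction j arbitrary: Q)
  case 0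
  show ?case unfolding weight_measure_def by (simp, intro nn_integral_mono) (auto simp: indicator_def)
next
  case (Suc j)
  note [measurable] = weight_measurable[OF v] cubes_sets[OF Suc.prems]
  have bl: "locally_integrable b" and M: "0 < M" using b by (auto simp: bmo_bound_def)
  note [measurable] = locally_integrable_measurable[OF bl]
  define H where "H = 2 ^ Suc CARD('n) * M"
  have HM: "2 * M \<le> H" unfolding H_def power_Suc using M by simp
  define g where "g x = ennreal \<bar>b x - average Q b\<bar>" for x
  have [measurable]: "g \<in> borel_measurable lebesgue" unfolding g_def by measurable
  have gav: "nn_average Q g \<le> ennreal M" using b Suc.prems by (simp add: bmo_bound_def g_def[abs_def])
  obtain I :: "(nat \<times> (int ^ 'n)) set" and X K where
    I: "countable I" "disjoint_family_on X I" "\<And>i. i \<in> I \<Longrightarrow> X i \<in> sets lebesgue"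
    and K: "\<And>i. i \<in> I \<Longrightarrow> K i \<in> cubes" "\<And>i. i \<in> I \<Longrightarrow> X i \<subseteq> K i" "\<And>i. i \<in> I \<Longrightarrow> K i \<subseteq> Q"
    "\<And>i. i \<in> I \<Longrightarrow> AE x in lebesgue. x \<in> K i \<longleftrightarrow> x \<in> X i"
    "\<And>i. i \<in> I \<Longrightarrow> nn_average (K i) g \<le> ennreal (2 ^ Suc CARD('n) * M)"
    and half: "2 * measure lebesgue (\<Union>i\<in>I. X i) \<le> measure lebesgue Q"
    and AE: "AE x in lebesgue. x \<in> Q \<longrightarrow> x \<notin> (\<Union>i\<in>I. X i) \<longrightarrow> g x \<le> ennreal (2 * M)"
  proof (rule Calderon_Zygmund_cells[OF Suc.prems _ M gav], goal_cases)
    case (2 I X K)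
    from 2(1)[OF 2(2-)] show ?thesis .
  qed auto
  let ?B = "{x. real (Suc j) * H < \<bar>b x - average Q b\<bar>}"
  have "{x \<in> space lebesgue. real (Suc j) * H < \<bar>b x - average Q b\<bar>} \<in> sets lebesgue" by measurable
  then have [measurable]: "?B \<in> sets lebesgue" by simp
  have Um[measurable]: "(\<Union>i\<in>I. X i) \<in> sets lebesgue" using I by (intro sets.countable_UN') auto
  have UQ: "(\<Union>i\<in>I. X i) \<subseteq> Q" using K by fast
  \<comment> \<open>Levels from the first one on are at least \<open>H\<close>, hence at least
    \<open>2 * M\<close>, and almost no point outside the cells exceeds that.\<close>
  have "(\<integral>\<^sup>+x\<in>Q. ennreal (v x) * indicator ?B x \<partial>lebesgue)
      \<le> (\<integral>\<^sup>+x\<in>(\<Union>i\<in>I. X i). ennreal (v x) * indicator ?B x \<partial>lebesgue)"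
  proof (intro nn_integral_mono_AE, use AE in eventually_elim)
    case (elim x)
    have "H \<le> real (Suc j) * H" using HM M by (simp add: mult_le_cancel_right1)
    then have "\<not> real (Suc j) * H < \<bar>b x - average Q b\<bar>" if "\<bar>b x - average Q b\<bar> \<le> 2 * M"
      using that HM by linarith
    then show ?case using elim M by (auto simp: indicator_def g_def simp del: of_nat_Suc)
  qed
  also have "\<dots> \<le> ennreal (\<beta> ^ j) * (\<integral>\<^sup>+x\<in>(\<Union>i\<in>I. X i). ennreal (v x) \<partial>lebesgue)"
  proof (rule nn_integral_UN_le[OF I])
    fix i assume i: "i \<in> I"
    \<comment> \<open>The level height \<open>H\<close> was taken equal to the upper
      Calderon-Zygmund bound, so this shift of averages costs exactly one level.\<close>
    have av: "\<bar>average (K i) b - average Q b\<bar> \<le> H"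
      using K(5)[OF i] M unfolding g_def H_def by (intro average_minus_const_le[OF bl K(1)[OF i]]) auto
    have "(\<integral>\<^sup>+x\<in>X i. ennreal (v x) * indicator ?B x \<partial>lebesgue)
        \<le> (\<integral>\<^sup>+x\<in>K i. ennreal (v x) * indicator {x. real j * H < \<bar>b x - average (K i) b\<bar>} x \<partial>lebesgue)"
    proof (intro nn_integral_mono)
      fix x
      have "real j * H < \<bar>b x - average (K i) b\<bar>" if "real (Suc j) * H < \<bar>b x - average Q b\<bar>"
        using that av by (simp add: algebra_simps)
      then show "ennreal (v x) * indicator ?B x * indicator (X i) x \<le>
          ennreal (v x) * indicator {x. real j * H < \<bar>b x - average (K i) b\<bar>} x * indicator (K i) x"
        using K(2)[OF i] by (auto simp: indicator_def)
    qed
    also have "\<dots> \<le> ennreal (\<beta> ^ j) * weight_measure v (K i)"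
      unfolding H_def by (rule Suc.IH[OF K(1)[OF i]])
    also have "weight_measure v (K i) = (\<integral>\<^sup>+x\<in>X i. ennreal (v x) \<partial>lebesgue)"
      unfolding weight_measure_def
      using K(4)[OF i] by (intro nn_integral_cong_AE) (auto elim!: eventually_mono simp: indicator_def)
    finally show "(\<integral>\<^sup>+x\<in>X i. ennreal (v x) * indicator ?B x \<partial>lebesgue) \<le> ennreal (\<beta> ^ j) * (\<integral>\<^sup>+x\<in>X i. ennreal
        (v x) \<partial>lebesgue)" .
  qed auto
  also have "(\<integral>\<^sup>+x\<in>(\<Union>i\<in>I. X i). ennreal (v x) \<partial>lebesgue) \<le> ennreal \<beta> * weight_measure v Q"
    using \<beta>(1) Suc.prems Um UQ half unfolding half_bounded_def weight_measure_def[symmetric] by blast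
  also have "ennreal (\<beta> ^ j) * (ennreal \<beta> * weight_measure v Q) = ennreal (\<beta> ^ Suc j) * weight_measure v Q"
    using \<beta> by (simp add: mult_ac ennreal_mult)
  finally show ?case unfolding H_def by (simp add: mult_left_mono)
qed

text \<open>Slice \<open>Q\<close> into layers of height \<open>H\<close>. The exponential grows on
  successive layers by a factor slower than the decay of their v-measure, so the layers sum to a
  geometric series.\<close>

lemma John_Nirenberg:
  fixes b v :: "real ^ 'n \<Rightarrow> real"
  assumes b: "bmo_bound b M" and v: "weight v" and \<beta>: "half_bounded v \<beta>" "0 \<le> \<beta>" "\<beta> < 1"
  shows "\<exists>c C. 0 < c \<and> 0 < C \<and> (\<forall>Q\<in>cubes.
    (\<integral>\<^sup>+x\<in>Q. ennreal (exp (c * \<bar>b x - average Q b\<bar>) * v x) \<partial>lebesgue) \<le> ennreal C * weight_measure v Q)"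
proof -
  have bl: "locally_integrable b" and M: "0 < M" using b by (auto simp: bmo_bound_def)
  have v0: "0 \<le> v x" for x using v by (simp add: weight_def)
  note [measurable] = locally_integrable_measurable[OF bl] weight_measurable[OF v]
  define H where "H = 2 ^ Suc CARD('n) * M"
  have H: "0 < H" using M by (simp add: H_def)
  \<comment> \<open>With this \<open>\<theta>\<close> the decay per layer is at most
    \<open>\<theta> * \<theta>\<close>, while \<open>c\<close> below makes the exponential grow by
    \<open>1 / \<theta>\<close>; a factor \<open>\<theta>\<close> per layer survives. The maximum
    keeps \<open>\<theta>\<close> positive, so that its logarithm is meaningful.\<close>
  define \<theta> where "\<theta> = sqrt (max \<beta> (1/2))"
  have \<theta>: "0 < \<theta>" "\<theta> < 1" "\<beta> \<le> \<theta> * \<theta>" using \<beta> by (auto simp: \<theta>_def)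
  define c where "c = - ln \<theta> / H"
  have c: "0 < c" using \<theta> H by (simp add: c_def divide_neg_pos)
  have ecH: "exp (c * H) = 1 / \<theta>" using \<theta> H by (simp add: c_def exp_minus inverse_eq_divide)
  have summand: "exp (c * H * real (Suc j)) * \<beta> ^ j \<le> (1 / \<theta>) * \<theta> ^ j" for j
  proof -
    have e: "exp (c * H * real (Suc j)) = (1 / \<theta>) ^ Suc j" by (simp only: exp_of_nat2_mult ecH)
    have "\<beta> ^ j \<le> (\<theta> * \<theta>) ^ j" using \<theta> \<beta> by (intro power_mono) auto
    then have "exp (c * H * real (Suc j)) * \<beta> ^ j \<le> (1 / \<theta>) ^ Suc j * (\<theta> * \<theta>) ^ j"
      unfolding e using \<theta> by (intro mult_left_mono) auto
    also have "\<dots> = (1 / \<theta>) * \<theta> ^ j" using \<theta> by (simp add: power_mult_distrib field_simps)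
    finally show ?thesis .
  qed
  define C where "C = 1 + (1 / \<theta>) * (1 / (1 - \<theta>))"
  have C: "0 < C" unfolding C_def using \<theta> by (intro add_pos_nonneg) auto
  show ?thesis
  proof (rule exI[of _ c], rule exI[of _ C], intro conjI ballI)
    fix Q :: "(real ^ 'n) set" assume Q: "Q \<in> cubes"
    note [measurable] = cubes_sets[OF Q]
    define t where "t x = \<bar>b x - average Q b\<bar>" for x
    have [measurable]: "t \<in> borel_measurable lebesgue" unfolding t_def by measurable
    define h where "h j x = ennreal (exp (c * H * real (Suc j))) * (ennreal (v x) * indicator {x. real j * H <
        t x} x * indicator Q x)" for j x
    \<comment> \<open>Points with \<open>t x = 0\<close> lie in none of the layers; the separate
      first term accounts for them.\<close>
    have pt: "ennreal (exp (c * t x) * v x) * indicator Q x \<le> ennreal (v x) * indicator Q x + (\<Sum>j. h j x)" for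
        x
    proof (cases "x \<in> Q \<and> t x \<noteq> 0")
      case False
      then show ?thesis by (auto simp: indicator_def)
    next
      case True
      then have tx: "0 < t x" by (simp add: t_def)
      \<comment> \<open>Subtracting 1 from the ceiling places \<open>t x\<close> strictly above
        \<open>j * H\<close> and at most at \<open>(j + 1) * H\<close>, matching the strict
        inequality in the layers.\<close>
      define j where "j = nat (\<lceil>t x / H\<rceil> - 1)"
      have "0 < t x / H" using tx H by simp
      then have rj: "real j = of_int (\<lceil>t x / H\<rceil> - 1)" by (simp add: j_def)
      have "real j < t x / H" "t x / H \<le> real (Suc j)" unfolding of_nat_Suc rj by linarith+
      then have j: "real j * H < t x" "t x \<le> H * real (Suc j)" using H by (auto simp: field_simps)
      have "exp (c * t x) * v x \<le> exp (c * H * real (Suc j)) * v x"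
        using j(2) c v0[of x] by (intro mult_right_mono) (auto simp: mult.assoc)
      then have "ennreal (exp (c * t x) * v x) * indicator Q x \<le> h j x"
        using True j v0[of x] by (simp add: h_def flip: ennreal_mult)
      also have "h j x \<le> (\<Sum>j. h j x)" using sum_le_suminf[of "\<lambda>j. h j x" "{j}"] by simp
      finally show ?thesis by (simp add: add_increasing)
    qed
    have int: "(\<integral>\<^sup>+x\<in>Q. ennreal (exp (c * t x) * v x) \<partial>lebesgue) \<le> (\<integral>\<^sup>+x. (ennreal (v x) * indicator Q x +
        (\<Sum>j. h j x)) \<partial>lebesgue)"
      using pt by (intro nn_integral_mono)
    have eq: "(\<integral>\<^sup>+x. (ennreal (v x) * indicator Q x + (\<Sum>j. h j x)) \<partial>lebesgue) = weight_measure v Q + (\<Sum>j.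
        \<integral>\<^sup>+x. h j x \<partial>lebesgue)"
    proof -
      have [measurable]: "h j \<in> borel_measurable lebesgue" for j unfolding h_def by measurable
      show ?thesis unfolding weight_measure_def
        by (subst nn_integral_add) (auto simp: nn_integral_suminf)
    qed
    have "(\<Sum>j. \<integral>\<^sup>+x. h j x \<partial>lebesgue) \<le> (\<Sum>j. ennreal ((1 / \<theta>) * \<theta> ^ j) * weight_measure v Q)"
    proof (intro suminf_le)
      fix j
      have "(\<integral>\<^sup>+x. h j x \<partial>lebesgue) = ennreal (exp (c * H * real (Suc j))) * (\<integral>\<^sup>+x\<in>Q. ennreal (v x) *
          indicator {x. real j * H < t x} x \<partial>lebesgue)"
        unfolding h_def by (intro nn_integral_cmult) measurable
      also have "\<dots> \<le> ennreal (exp (c * H * real (Suc j))) * (ennreal (\<beta> ^ j) * weight_measure v Q)"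
        unfolding t_def H_def by (intro mult_left_mono John_Nirenberg_distribution[OF b v \<beta>(1,2) Q]) simp
      also have "\<dots> = ennreal (exp (c * H * real (Suc j)) * \<beta> ^ j) * weight_measure v Q"
        using \<beta> by (subst ennreal_mult) (auto simp: mult.assoc)
      also have "\<dots> \<le> ennreal ((1 / \<theta>) * \<theta> ^ j) * weight_measure v Q"
        by (intro mult_right_mono ennreal_leI summand) simp
      finally show "(\<integral>\<^sup>+x. h j x \<partial>lebesgue) \<le> ennreal ((1 / \<theta>) * \<theta> ^ j) * weight_measure v Q" .
    qed auto
    also have "(\<Sum>j. ennreal ((1 / \<theta>) * \<theta> ^ j) * weight_measure v Q) = (\<Sum>j. ennreal ((1 / \<theta>) * \<theta> ^ j)) *
        weight_measure v Q"
      by simp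
    also have "(\<Sum>j. ennreal ((1 / \<theta>) * \<theta> ^ j)) = ennreal ((1 / \<theta>) * (1 / (1 - \<theta>)))"
      using \<theta> by (intro suminf_ennreal_eq sums_mult geometric_sums) auto
    finally have "(\<integral>\<^sup>+x\<in>Q. ennreal (exp (c * t x) * v x) \<partial>lebesgue)
        \<le> weight_measure v Q + ennreal ((1 / \<theta>) * (1 / (1 - \<theta>))) * weight_measure v Q"
      using int unfolding eq by (meson add_left_mono order_trans)
    also have "\<dots> = ennreal C * weight_measure v Q"
      unfolding C_def using \<theta> by (subst ennreal_plus) (auto simp: distrib_right)
    finally show "(\<integral>\<^sup>+x\<in>Q. ennreal (exp (c * \<bar>b x - average Q b\<bar>) * v x) \<partial>lebesgue) \<le> ennreal C *
        weight_measure v Q"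
      unfolding t_def .
  qed (use c C in auto)
qed

section \<open>Consequences of the two-weight condition\<close>

lemma nn_integral_linear3:
  assumes [measurable]: "f \<in> borel_measurable M" "g \<in> borel_measurable M" "h \<in> borel_measurable M"
  shows "(\<integral>\<^sup>+x. a * f x + b * g x + c * h x \<partial>M) = a * integral\<^sup>N M f + b * integral\<^sup>N M g + c * integral\<^sup>N M
      h"
  by (simp add: nn_integral_add nn_integral_cmult)

text \<open>On either side of the curve y = x^(p-1) a single one of the two powers already dominates
  the product.\<close>

lemma mult_le_powr_add:
  fixes x y p :: real
  assumes p: "1 < p" and x: "0 \<le> x" and y: "0 \<le> y"
  shows "x * y \<le> x powr p + y powr conj_exp p"
proof (cases "y \<le> x powr (p - 1)")
  case True
  have "x * y \<le> x * x powr (p - 1)" using True x by (intro mult_left_mono) auto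
  also have "\<dots> = x powr p" using x by (cases "x = 0") (auto simp: powr_mult_base)
  finally show ?thesis using powr_ge_zero[of y "conj_exp p"] by linarith
next
  case False
  then have y0: "0 < y" using powr_ge_zero[of x "p - 1"] by linarith
  have "(x powr (p - 1)) powr (1 / (p - 1)) \<le> y powr (1 / (p - 1))"
    using False p by (intro powr_mono2) auto
  then have "x \<le> y powr (1 / (p - 1))" using p x by (cases "x = 0") (auto simp: powr_powr)
  then have "x * y \<le> y powr (1 / (p - 1)) * y" using y by (intro mult_right_mono) auto
  also have "\<dots> = y powr (1 / (p - 1) + 1)" using y0 by (simp add: powr_add)
  also have "1 / (p - 1) + 1 = conj_exp p" using p by (simp add: conj_exp_def field_simps)
  finally show ?thesis using powr_ge_zero[of x p] by linarith
qed

text \<open>The pointwise form of the duality between \<open>log_young\<close> and exponential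
  integrability. If \<open>h\<close> is at most a multiple of 1 + log t, the product is controlled
  by the Young function; otherwise \<open>t\<close> itself is at most exponential in
  \<open>h\<close>.\<close>

lemma log_young_exp_bound:
  fixes p c :: real
  assumes p: "1 < p" and c: "0 < c"
  shows "\<exists>K>0. \<forall>h\<ge>0. \<forall>t>0. (h * t) powr conj_exp p \<le> K * (log_young p t + exp (c * h))"
proof -
  define p' where "p' = conj_exp p"
  have p': "0 < p'" using p by (simp add: p'_def conj_exp_def)
  \<comment> \<open>Chosen so that the power p' of exp(2 h / K) is exactly exp(c h).\<close>
  define K where "K = 2 * p' / c"
  have K: "0 < K" using p' c by (simp add: K_def)
  show ?thesis
  proof (intro exI[of _ "K powr p'"] conjI allI impI)
    show "0 < K powr p'" using K by simp
    fix h t :: real assume h: "0 \<le> h" and t: "0 < t"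
    define L where "L = log_plus t"
    have L: "0 \<le> L" by (simp add: L_def log_plus_def)
    have tL: "t \<le> exp L" using t unfolding L_def log_plus_def by (metis exp_le_cancel_iff exp_ln
        max.cobounded1)
    have ly: "0 \<le> log_young p t" by (simp add: log_young_def)
    show "(h * t) powr conj_exp p \<le> K powr p' * (log_young p t + exp (c * h))"
    proof (cases "h \<le> K * (1 + L)")
      case True
      have "(h * t) powr p' \<le> (K * (1 + L) * t) powr p'"
        using True h t p' by (intro powr_mono2 mult_right_mono) auto
      also have "\<dots> = K powr p' * log_young p t"
        using K L t by (simp add: log_young_def powr_mult L_def p'_def)
      also have "\<dots> \<le> K powr p' * (log_young p t + exp (c * h))" by (intro mult_left_mono) auto
      finally show ?thesis by (simp add: p'_def)
    next
      case False
      \<comment> \<open>A large \<open>h\<close> beats the logarithm of \<open>t\<close>: both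
        factors of \<open>h * t\<close> are then bounded through exp(h / K), which explains the 2 in
        \<open>K\<close>.\<close>
      then have "L \<le> h / K" using K by (simp add: field_simps)
      then have "t \<le> exp (h / K)" using tL by (meson exp_le_cancel_iff order_trans)
      moreover have "h \<le> K * exp (h / K)"
        using exp_ge_add_one_self[of "h / K"] K by (simp add: field_simps)
      ultimately have "h * t \<le> (K * exp (h / K)) * exp (h / K)" using h t K by (intro mult_mono) auto
      also have "\<dots> = K * exp (2 * h / K)" by (simp add: mult.assoc flip: exp_add)
      finally have "(h * t) powr p' \<le> (K * exp (2 * h / K)) powr p'" using h t p' by (intro powr_mono2) auto
      also have "\<dots> = K powr p' * exp (2 * h / K) powr p'" by (rule powr_mult)
      also have "exp (2 * h / K) powr p' = exp (p' * (2 * h / K))" by (simp add: powr_def)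
      also have "p' * (2 * h / K) = c * h" using p' c by (simp add: K_def field_simps)
      also have "K powr p' * exp (c * h) \<le> K powr p' * (log_young p t + exp (c * h))" using ly by (intro
          mult_left_mono) auto
      finally show ?thesis by (simp add: p'_def)
    qed
  qed
qed

text \<open>Jensen's inequality up to a factor 2, obtained by averaging w \<le> t + t^(1-r) w^r. It
  turns the bump on w into the plain mass w(Q), which is what the dyadic pieces contain.\<close>

lemma average_le_power_average:
  fixes w :: "real ^ 'n \<Rightarrow> real"
  assumes w: "weight w" and Q: "Q \<in> cubes" and r: "1 < r" and a: "0 < a"
    and aQ: "nn_average Q (\<lambda>x. ennreal (w x)) = ennreal a" and q: "0 < q"
  shows "ennreal ((a / 2) powr (1 / q)) \<le> nn_average Q (\<lambda>x. ennreal (w x powr r)) epowr (1 / (r * q))"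
proof (cases "nn_average Q (\<lambda>x. ennreal (w x powr r)) = \<infinity>")
  case True
  then show ?thesis using r q by (simp add: epowr_def)
next
  case False
  note [measurable] = weight_measurable[OF w] cubes_sets[OF Q]
  have w0: "0 \<le> w x" for x using w by (simp add: weight_def)
  define m where "m = measure lebesgue Q"
  have m: "0 < m" using measure_cubes_pos[OF Q] by (simp add: m_def)
  define B where "B = enn2real (nn_average Q (\<lambda>x. ennreal (w x powr r)))"
  have B: "nn_average Q (\<lambda>x. ennreal (w x powr r)) = ennreal B" "0 \<le> B" using False by (auto simp: B_def
      less_top)
  have bound: "a \<le> t + t powr (1 - r) * B" if t: "0 < t" for t
  proof -
    have pt: "w x \<le> t + t powr (1 - r) * w x powr r" for x
    proof (cases "w x \<le> t")
      case True
      then show ?thesis using t by (simp add: add_increasing2)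
    next
      case False
      then have wx: "t < w x" by simp
      have "w x = t powr (1 - r) * (w x * t powr (r - 1))"
        using t by (simp add: mult.left_commute flip: powr_add)
      also have "\<dots> \<le> t powr (1 - r) * (w x * w x powr (r - 1))"
        using wx t r by (intro mult_left_mono powr_mono2) auto
      also have "w x * w x powr (r - 1) = w x powr r" using wx t by (simp add: powr_mult_base)
      finally show ?thesis using t by simp
    qed
    have "ennreal a * ennreal m = (\<integral>\<^sup>+x\<in>Q. ennreal (w x) \<partial>lebesgue)"
      using nn_average_eq[OF Q, of "\<lambda>x. ennreal (w x)"] by (simp add: aQ m_def)
    also have "\<dots> \<le> (\<integral>\<^sup>+x. ennreal t * indicator Q x + ennreal (t powr (1 - r)) * (ennreal (w x powr r) *
        indicator Q x) \<partial>lebesgue)"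
    proof (intro nn_integral_mono)
      fix x
      have "ennreal (w x) \<le> ennreal t + ennreal (t powr (1 - r)) * ennreal (w x powr r)"
        using pt[of x] t by (simp flip: ennreal_mult ennreal_plus add: ennreal_leI)
      then show "ennreal (w x) * indicator Q x \<le> ennreal t * indicator Q x + ennreal (t powr (1 - r)) *
          (ennreal (w x powr r) * indicator Q x)"
        by (auto simp: indicator_def)
    qed
    also have "\<dots> = ennreal t * ennreal m + ennreal (t powr (1 - r)) * (ennreal B * ennreal m)"
      unfolding B(1)[symmetric] m_def nn_average_eq[OF Q]
      using emeasure_cubes[OF Q] by (subst nn_integral_add) (auto simp: nn_integral_cmult
          nn_integral_cmult_indicator simp del: emeasure_completion)
    also have "\<dots> = ennreal ((t + t powr (1 - r) * B) * m)"
      using t B(2) m by (simp flip: ennreal_mult ennreal_plus add: algebra_simps)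
    finally have "ennreal (a * m) \<le> ennreal ((t + t powr (1 - r) * B) * m)"
      using a m by (simp flip: ennreal_mult)
    then have "a * m \<le> (t + t powr (1 - r) * B) * m" using t B m by (subst (asm) ennreal_le_iff) auto
    then show ?thesis using m by simp
  qed
  \<comment> \<open>With \<open>B = 0\<close> the choice \<open>t = a / 2\<close> would give
    \<open>a \<le> a / 2\<close>.\<close>
  have "B \<noteq> 0" using bound[of "a / 2"] a by auto
  then have B0: "0 < B" using B by simp
  \<comment> \<open>The scale t = B^(1/r) balances the two terms, so that their sum is twice the
    first.\<close>
  have "B powr (1 / r) + (B powr (1 / r)) powr (1 - r) * B = B powr (1 / r) + B powr (1 / r * (1 - r) + 1)"
    using B0 by (simp add: powr_powr powr_add)
  also have "1 / r * (1 - r) + 1 = 1 / r" using r by (simp add: field_simps)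
  finally have "a / 2 \<le> B powr (1 / r)" using bound[of "B powr (1 / r)"] B0 by simp
  then have "(a / 2) powr (1 / q) \<le> (B powr (1 / r)) powr (1 / q)" using a q by (intro powr_mono2) auto
  then show ?thesis unfolding B(1) using B0 r q by (simp add: epowr_pos powr_powr ennreal_leI)
qed

definition two_weight_condition :: "real \<Rightarrow> real \<Rightarrow> real \<Rightarrow> (real ^ 'n \<Rightarrow> real) \<Rightarrow> (real ^ 'n \<Rightarrow> real) \<Rightarrow> bool" where
  "two_weight_condition \<gamma> p q w \<nu> \<longleftrightarrow> (\<exists>r::real. r > 1 \<and> (\<exists>C::real. \<forall>Q\<in>cubes.
           ennreal (measure lebesgue Q powr (\<gamma> / real CARD('n) + 1 / q - 1 / p))
             * nn_average Q (\<lambda>x. ennreal (w x powr r)) epowr (1 / (r * q))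
             * luxemburg_norm (log_young p) Q (\<lambda>x. ennreal (\<nu> x) epowr (- 1 / p))
           \<le> ennreal C))"

text \<open>The Luxemburg norm is an infimum that may not be attained. A strictly larger bound
  produces an actual admissible \<open>l\<close>, positive even if the norm is 0. Writing the
  average of w as w(Q)/|Q| absorbs the power 1/q of |Q|.\<close>

lemma two_weight_admissible:
  fixes w \<nu> :: "real ^ 'n \<Rightarrow> real"
  assumes cond: "two_weight_condition \<gamma> p q w \<nu>" and w: "weight w" and q: "0 < q"
    and pos: "\<And>Q. Q \<in> cubes \<Longrightarrow> 0 < weight_measure w Q"
  shows "\<exists>C>0. \<forall>Q\<in>cubes. \<exists>l>0.
    nn_average Q (\<lambda>x. young_ext (log_young p) (ennreal (\<nu> x) epowr (- 1 / p) / ennreal l)) \<le> 1 \<and>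
    measure lebesgue Q powr (\<gamma> / real CARD('n) - 1 / p) * enn2real (weight_measure w Q) powr (1 / q) * l \<le> C"
proof -
  obtain r C where r: "1 < r" and C: "\<And>Q. Q \<in> cubes \<Longrightarrow>
     ennreal (measure lebesgue Q powr (\<gamma> / real CARD('n) + 1 / q - 1 / p))
             * nn_average Q (\<lambda>x. ennreal (w x powr r)) epowr (1 / (r * q))
             * luxemburg_norm (log_young p) Q (\<lambda>x. ennreal (\<nu> x) epowr (- 1 / p)) \<le> ennreal C"
    using cond unfolding two_weight_condition_def by blast
  \<comment> \<open>The maximum handles a negative \<open>C\<close>, which \<open>ennreal\<close>
    maps to 0; the summand 1 supplies the strict inequality.\<close>
  define C1 where "C1 = max C 0 + 1"
  have "ennreal C = ennreal (max C 0)" by (simp add: max_def ennreal_neg)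
  then have C1: "0 < C1" "ennreal C < ennreal C1"
    by (auto simp: C1_def ennreal_less_iff simp del: ennreal_plus)
  show ?thesis
  proof (rule exI[of _ "2 powr (1 / q) * C1"], intro conjI ballI)
    show "0 < 2 powr (1 / q) * C1" using C1 by simp
    fix Q :: "(real ^ 'n) set" assume Q: "Q \<in> cubes"
    define m where "m = measure lebesgue Q"
    have m: "0 < m" using measure_cubes_pos[OF Q] by (simp add: m_def)
    define W where "W = enn2real (weight_measure w Q)"
    have W: "weight_measure w Q = ennreal W" "0 < W"
      using weight_measure_cube_real[OF w Q] pos[OF Q] weight_measure_finite[OF w cubes_compact[OF Q]]
      by (auto simp: W_def enn2real_positive_iff)
    define a where "a = W / m"
    have a: "0 < a" using m W by (simp add: a_def)
    have aQ: "nn_average Q (\<lambda>x. ennreal (w x)) = ennreal a"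
      unfolding nn_average_def emeasure_cubes[OF Q] a_def
      using W m by (simp add: weight_measure_def m_def divide_ennreal)
    define X where "X = m powr (\<gamma> / real CARD('n) + 1 / q - 1 / p) * (a / 2) powr (1 / q)"
    have X: "0 < X" using m a by (simp add: X_def)
    define \<Lambda> where "\<Lambda> = luxemburg_norm (log_young p) Q (\<lambda>x. ennreal (\<nu> x) epowr (- 1 / p))"
    have "ennreal X * \<Lambda> = ennreal (m powr (\<gamma> / real CARD('n) + 1 / q - 1 / p)) * ennreal ((a / 2) powr (1 /
        q)) * \<Lambda>"
      unfolding X_def by (simp add: ennreal_mult)
    also have "\<dots> \<le> ennreal (m powr (\<gamma> / real CARD('n) + 1 / q - 1 / p))
             * nn_average Q (\<lambda>x. ennreal (w x powr r)) epowr (1 / (r * q)) * \<Lambda>"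
      by (intro mult_right_mono mult_left_mono average_le_power_average[OF w Q r a aQ q]) auto
    also have "\<dots> \<le> ennreal C" using C[OF Q] by (simp add: m_def \<Lambda>_def)
    finally have XL: "ennreal X * \<Lambda> < ennreal C1" using C1(2) by (rule le_less_trans)
    have "\<Lambda> < ennreal (C1 / X)"
    proof (rule ccontr)
      assume "\<not> \<Lambda> < ennreal (C1 / X)"
      then have "ennreal X * ennreal (C1 / X) \<le> ennreal X * \<Lambda>" by (intro mult_left_mono) auto
      then show False using XL X C1 by (simp flip: ennreal_mult)
    qed
    then obtain l where l: "0 < l" "nn_average Q (\<lambda>x. young_ext (log_young p) (ennreal (\<nu> x) epowr (- 1 / p) /
        ennreal l)) \<le> 1"
      "ennreal l < ennreal (C1 / X)"
      unfolding \<Lambda>_def luxemburg_norm_def Inf_less_iff by blast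
    have "l \<le> C1 / X" using l by (simp add: ennreal_less_iff)
    then have Xl: "X * l \<le> C1" using X by (simp add: field_simps)
    have "m powr (\<gamma> / real CARD('n) + 1 / q - 1 / p) = m powr (\<gamma> / real CARD('n) - 1 / p) * m powr (1 / q)"
      by (simp flip: powr_add add: algebra_simps)
    moreover have "(a / 2) powr (1 / q) = W powr (1 / q) / (m powr (1 / q) * 2 powr (1 / q))"
      using W m unfolding a_def by (simp add: powr_divide powr_mult)
    ultimately have "X = m powr (\<gamma> / real CARD('n) - 1 / p) * W powr (1 / q) / 2 powr (1 / q)"
      unfolding X_def using m by simp
    then have "m powr (\<gamma> / real CARD('n) - 1 / p) * W powr (1 / q) * l = 2 powr (1 / q) * (X * l)" by simp
    also have "\<dots> \<le> 2 powr (1 / q) * C1" using Xl by (intro mult_left_mono) auto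
    finally show "\<exists>l>0. nn_average Q (\<lambda>x. young_ext (log_young p) (ennreal (\<nu> x) epowr (- 1 / p) / ennreal l))
        \<le> 1 \<and>
      measure lebesgue Q powr (\<gamma> / real CARD('n) - 1 / p) * enn2real (weight_measure w Q) powr (1 / q) * l \<le> 2
          powr (1 / q) * C1"
      using l unfolding m_def W_def by blast
  qed
qed

lemma young_ext_log_young_measurable [measurable]:
  assumes [measurable]: "f \<in> borel_measurable M"
  shows "(\<lambda>x. young_ext (log_young p) (f x)) \<in> borel_measurable M"
proof -
  have "(\<lambda>t. t powr c * (1 + max (ln t) 0) powr c) \<in> borel_measurable borel" for c :: real
    by measurable
  then have [measurable]: "log_young p \<in> borel_measurable borel"
    by (simp add: log_young_def[abs_def] log_plus_def)
  have "f -` {\<infinity>} \<inter> space M \<in> sets M" by measurable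
  then have [measurable]: "Measurable.pred M (\<lambda>x. f x = \<infinity>)"
    by (simp add: pred_def vimage_def Int_def conj_commute)
  show ?thesis unfolding young_ext_def by measurable
qed

text \<open>Only the constant-free form \<open>x y \<le> x\<^sup>p + y\<^sup>p'\<close> of Young's inequality enters, with the free scale \<open>s\<close>
    playing the role of the \<open>L\<^sup>p\<close> average of \<open>f\<close>.\<close>
lemma two_weight_Hoelder:
  fixes b w \<nu> :: "real ^ 'n \<Rightarrow> real"
  assumes cond: "two_weight_condition \<gamma> p q w \<nu>" and w: "weight w" and \<nu>: "weight \<nu>" and p: "1 < p" and q: "0
      < q"
    and pos: "\<And>Q. Q \<in> cubes \<Longrightarrow> 0 < weight_measure w Q" and b: "bmo_bound b M"
  shows "\<exists>C>0. \<forall>Q\<in>cubes. \<forall>f\<in>borel_measurable lebesgue. \<forall>G\<ge>0.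
    (\<integral>\<^sup>+x\<in>Q. ennreal (\<bar>f x\<bar> powr p * \<nu> x) \<partial>lebesgue) \<le> ennreal G \<longrightarrow>
    ennreal (measure lebesgue Q powr (\<gamma> / real CARD('n) - 1)) * (\<integral>\<^sup>+x\<in>Q. ennreal ((1 + \<bar>b x - average Q b\<bar>) *
        \<bar>f x\<bar>) \<partial>lebesgue)
      \<le> ennreal (C * enn2real (weight_measure w Q) powr (- 1 / q) * G powr (1 / p))"
proof -
  obtain C1 where C1: "0 < C1" and adm: "\<And>Q. Q \<in> cubes \<Longrightarrow> \<exists>l>0.
    nn_average Q (\<lambda>x. young_ext (log_young p) (ennreal (\<nu> x) epowr (- 1 / p) / ennreal l)) \<le> 1 \<and>
    measure lebesgue Q powr (\<gamma> / real CARD('n) - 1 / p) * enn2real (weight_measure w Q) powr (1 / q) * l \<le> C1"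
    using two_weight_admissible[OF cond w q pos] by blast
  obtain c C2 where c: "0 < c" "0 < C2" and JN: "\<And>Q. Q \<in> cubes \<Longrightarrow>
    (\<integral>\<^sup>+x\<in>Q. ennreal (exp (c * \<bar>b x - average Q b\<bar>) * 1) \<partial>lebesgue) \<le> ennreal C2 * weight_measure (\<lambda>_. 1) Q"
    using John_Nirenberg[OF b weight_one half_bounded_one] by auto
  obtain K where K: "0 < K" and Ky: "\<And>h t. 0 \<le> h \<Longrightarrow> 0 < t \<Longrightarrow> (h * t) powr conj_exp p \<le> K * (log_young p t + exp
      (c * h))"
    using log_young_exp_bound[OF p c(1)] by blast
  \<comment> \<open>The three contributions are the energy of f at its own scale, the Luxemburg
    average, and the John--Nirenberg average; \<open>exp c\<close> comes from the 1 in 1 + |b -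
    b_Q|.\<close>
  define C3 where "C3 = 1 + K * (1 + exp c * C2)"
  have C3: "0 < C3" using K c unfolding C3_def by (intro add_pos_nonneg) auto
  have bl: "locally_integrable b" using b by (auto simp: bmo_bound_def)
  note [measurable] = locally_integrable_measurable[OF bl] weight_measurable[OF w] weight_measurable[OF \<nu>]
  have \<nu>0: "0 \<le> \<nu> x" for x using \<nu> by (simp add: weight_def)
  show ?thesis
  proof (intro exI[of _ "C1 * C3"] conjI ballI allI impI)
    show "0 < C1 * C3" using C1 C3 by simp
    fix Q :: "(real ^ 'n) set" and f :: "real ^ 'n \<Rightarrow> real" and G0 :: real
    assume Q: "Q \<in> cubes" and f[measurable]: "f \<in> borel_measurable lebesgue" and G0: "0 \<le> G0"
      and fG0: "(\<integral>\<^sup>+x\<in>Q. ennreal (\<bar>f x\<bar> powr p * \<nu> x) \<partial>lebesgue) \<le> ennreal G0"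
    note [measurable] = cubes_sets[OF Q]
    define m where "m = measure lebesgue Q"
    have m: "0 < m" using measure_cubes_pos[OF Q] by (simp add: m_def)
    define W where "W = enn2real (weight_measure w Q)"
    have W: "0 < W" using pos[OF Q] weight_measure_finite[OF w cubes_compact[OF Q]]
      by (auto simp: W_def enn2real_positive_iff)
    define h where "h x = 1 + \<bar>b x - average Q b\<bar>" for x
    have [measurable]: "h \<in> borel_measurable lebesgue" unfolding h_def by measurable
    have h: "0 \<le> h x" for x by (simp add: h_def)
    obtain l where l: "0 < l" and yl: "nn_average Q (\<lambda>x. young_ext (log_young p) (ennreal (\<nu> x) epowr (- 1 /
        p) / ennreal l)) \<le> 1"
      and lb: "m powr (\<gamma> / real CARD('n) - 1 / p) * W powr (1 / q) * l \<le> C1"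
      using adm[OF Q] unfolding m_def W_def by blast
    define Y where "Y x = young_ext (log_young p) (ennreal (\<nu> x) epowr (- 1 / p) / ennreal l)" for x
    have [measurable]: "Y \<in> borel_measurable lebesgue" unfolding Y_def by measurable
    have Ym: "(\<integral>\<^sup>+x\<in>Q. Y x \<partial>lebesgue) \<le> ennreal m"
      using yl unfolding nn_average_le_iff[OF Q] Y_def m_def by simp
    have em: "(\<integral>\<^sup>+x\<in>Q. ennreal (exp (c * h x)) \<partial>lebesgue) \<le> ennreal (exp c * C2 * m)"
    proof -
      have "(\<integral>\<^sup>+x\<in>Q. ennreal (exp (c * h x)) \<partial>lebesgue) = (\<integral>\<^sup>+x. ennreal (exp c) * (ennreal (exp (c * \<bar>b x -
          average Q b\<bar>) * 1) * indicator Q x) \<partial>lebesgue)"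
        by (intro nn_integral_cong) (auto simp: h_def distrib_left exp_add ennreal_mult indicator_def)
      also have "\<dots> = ennreal (exp c) * (\<integral>\<^sup>+x\<in>Q. ennreal (exp (c * \<bar>b x - average Q b\<bar>) * 1) \<partial>lebesgue)"
        by (intro nn_integral_cmult) measurable
      also have "\<dots> \<le> ennreal (exp c) * (ennreal C2 * weight_measure (\<lambda>_. 1) Q)"
        by (intro mult_left_mono JN[OF Q]) simp
      also have "weight_measure (\<lambda>_. 1) Q = ennreal m"
        using Q unfolding weight_measure_def m_def by (simp add: emeasure_cubes del: emeasure_completion)
      finally show ?thesis using c m by (simp add: mult.assoc flip: ennreal_mult)
    qed
    \<comment> \<open>With s^p = G/m all three integrals become multiples of
      \<open>l * s * m\<close>. This requires \<open>G\<close> to be positive.\<close>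
    have main: "(\<integral>\<^sup>+x\<in>Q. ennreal (h x * \<bar>f x\<bar>) \<partial>lebesgue) \<le> ennreal (l * (G / m) powr (1 / p) * m * C3)"
      if G: "0 < G" and fG: "(\<integral>\<^sup>+x\<in>Q. ennreal (\<bar>f x\<bar> powr p * \<nu> x) \<partial>lebesgue) \<le> ennreal G" for G
    proof -
      define s where "s = (G / m) powr (1 / p)"
      have s: "0 < s" using G m by (simp add: s_def)
      have sp: "s powr p = G / m" using G m p by (simp add: s_def powr_powr)
      have pt: "ennreal (h x * \<bar>f x\<bar>) \<le> ennreal (l * s / s powr p) * ennreal (\<bar>f x\<bar> powr p * \<nu> x)
          + ennreal (l * s * K) * Y x + ennreal (l * s * K) * ennreal (exp (c * h x))" for x
      \<comment> \<open>Where \<nu> vanishes the extended Young value is infinite, so the right side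
        is infinite and nothing is claimed about f.\<close>
      proof (cases "\<nu> x = 0")
        case True
        then have "ennreal (\<nu> x) epowr (- 1 / p) = \<infinity>" using p by (simp add: epowr_def)
        then have "Y x = \<infinity>" using l by (simp add: Y_def young_ext_def ennreal_top_divide)
        then show ?thesis using l s K by (simp add: ennreal_mult_top)
      next
        case False
        then have \<nu>x: "0 < \<nu> x" using \<nu>0[of x] by simp
        define v where "v = \<nu> x powr (- 1 / p)"
        have v: "0 < v" using \<nu>x by (simp add: v_def)
        define y where "y = \<bar>f x\<bar> * \<nu> x powr (1 / p) / s"
        have y: "0 \<le> y" using s by (simp add: y_def)
        have "ennreal (\<nu> x) epowr (- 1 / p) = ennreal v" using \<nu>x p by (simp add: epowr_neg v_def)
        then have Yx: "Y x = ennreal (log_young p (v / l))"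
          using l v by (simp add: Y_def divide_ennreal young_ext_def)
        have ly: "0 \<le> log_young p (v / l)" by (simp add: log_young_def)
        have vv: "\<nu> x powr (1 / p) * v = 1" using \<nu>x by (simp add: v_def flip: powr_add)
        have "h x * \<bar>f x\<bar> = h x * \<bar>f x\<bar> * (\<nu> x powr (1 / p) * v)" unfolding vv by simp
        also have "\<dots> = l * s * (y * (h x * (v / l)))" using l s by (simp add: y_def field_simps)
        also have "\<dots> \<le> l * s * (y powr p + (h x * (v / l)) powr conj_exp p)"
          using l s v y h p by (intro mult_left_mono mult_le_powr_add) auto
        also have "\<dots> \<le> l * s * (y powr p + K * (log_young p (v / l) + exp (c * h x)))"
          using l s v h by (intro mult_left_mono add_left_mono Ky) auto
        also have "y powr p = \<bar>f x\<bar> powr p * \<nu> x / s powr p"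
          using s \<nu>x p by (simp add: y_def powr_divide powr_mult powr_powr)
        also have "l * s * (\<bar>f x\<bar> powr p * \<nu> x / s powr p + K * (log_young p (v / l) + exp (c * h x))) =
           (l * s / s powr p) * (\<bar>f x\<bar> powr p * \<nu> x) + (l * s * K) * log_young p (v / l) + (l * s * K) * exp
               (c * h x)"
          by (simp add: algebra_simps)
        finally have "ennreal (h x * \<bar>f x\<bar>) \<le> ennreal ((l * s / s powr p) * (\<bar>f x\<bar> powr p * \<nu> x) + (l * s * K)
            * log_young p (v / l) + (l * s * K) * exp (c * h x))"
          by (rule ennreal_leI)
        also have "\<dots> = ennreal (l * s / s powr p) * ennreal (\<bar>f x\<bar> powr p * \<nu> x)
          + ennreal (l * s * K) * Y x + ennreal (l * s * K) * ennreal (exp (c * h x))"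
          unfolding Yx using l s K \<nu>x ly by (simp flip: ennreal_mult ennreal_plus)
        finally show ?thesis .
      qed
      have "(\<integral>\<^sup>+x\<in>Q. ennreal (h x * \<bar>f x\<bar>) \<partial>lebesgue) \<le> (\<integral>\<^sup>+x. (ennreal (l * s / s powr p) * (ennreal (\<bar>f x\<bar>
          powr p * \<nu> x) * indicator Q x)
          + ennreal (l * s * K) * (Y x * indicator Q x)) + ennreal (l * s * K) * (ennreal (exp (c * h x)) *
              indicator Q x) \<partial>lebesgue)"
        using pt by (intro nn_integral_mono) (auto simp: indicator_def)
      also have "\<dots> = ennreal (l * s / s powr p) * (\<integral>\<^sup>+x\<in>Q. ennreal (\<bar>f x\<bar> powr p * \<nu> x) \<partial>lebesgue)
          + ennreal (l * s * K) * (\<integral>\<^sup>+x\<in>Q. Y x \<partial>lebesgue) + ennreal (l * s * K) * (\<integral>\<^sup>+x\<in>Q. ennreal (exp (c * h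
              x)) \<partial>lebesgue)"
        by (intro nn_integral_linear3) measurable
      also have "\<dots> \<le> ennreal (l * s / s powr p) * ennreal G + ennreal (l * s * K) * ennreal m + ennreal (l * s
          * K) * ennreal (exp c * C2 * m)"
        by (intro add_mono mult_left_mono fG Ym em) auto
      also have "\<dots> = ennreal (l * s / s powr p * G + l * s * K * m + l * s * K * (exp c * C2 * m))"
        using l s G K m c by (simp flip: ennreal_mult ennreal_plus)
      also have "l * s / s powr p * G + l * s * K * m + l * s * K * (exp c * C2 * m) = l * s * m * C3"
        unfolding sp C3_def using G m by (simp add: field_simps)
      finally show ?thesis by (simp add: s_def)
    qed
    have final: "ennreal (m powr (\<gamma> / real CARD('n) - 1)) * (\<integral>\<^sup>+x\<in>Q. ennreal (h x * \<bar>f x\<bar>) \<partial>lebesgue)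
        \<le> ennreal (C1 * C3 * W powr (- 1 / q) * G powr (1 / p))"
      if G: "0 < G" and fG: "(\<integral>\<^sup>+x\<in>Q. ennreal (\<bar>f x\<bar> powr p * \<nu> x) \<partial>lebesgue) \<le> ennreal G" for G
    proof -
      have "ennreal (m powr (\<gamma> / real CARD('n) - 1)) * (\<integral>\<^sup>+x\<in>Q. ennreal (h x * \<bar>f x\<bar>) \<partial>lebesgue) \<le>
         ennreal (m powr (\<gamma> / real CARD('n) - 1)) * ennreal (l * (G / m) powr (1 / p) * m * C3)"
        by (intro mult_left_mono main[OF G fG]) simp
      also have "\<dots> = ennreal (m powr (\<gamma> / real CARD('n) - 1) * (l * (G / m) powr (1 / p) * m * C3))"
        using l G m C3 by (subst ennreal_mult) auto
      also have "m powr (\<gamma> / real CARD('n) - 1) * (l * (G / m) powr (1 / p) * m * C3) =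
         (m powr (\<gamma> / real CARD('n) - 1) * m powr 1 * m powr (- 1 / p)) * l * C3 * G powr (1 / p)"
        using G m by (simp add: powr_divide powr_minus field_simps)
      also have "m powr (\<gamma> / real CARD('n) - 1) * m powr 1 * m powr (- 1 / p) = m powr (\<gamma> / real CARD('n) - 1
          / p)"
        by (simp only: powr_add[symmetric]) simp
      also have "m powr (\<gamma> / real CARD('n) - 1 / p) * l = (m powr (\<gamma> / real CARD('n) - 1 / p) * W powr (1 / q)
          * l) * W powr (- 1 / q)"
        using W by (simp add: powr_minus field_simps)
      also have "ennreal ((m powr (\<gamma> / real CARD('n) - 1 / p) * W powr (1 / q) * l) * W powr (- 1 / q) * C3 *
          G powr (1 / p))
          \<le> ennreal (C1 * W powr (- 1 / q) * C3 * G powr (1 / p))"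
        using C3 by (intro ennreal_leI mult_right_mono lb) auto
      finally show ?thesis by (simp add: mult_ac)
    qed
    show "ennreal (measure lebesgue Q powr (\<gamma> / real CARD('n) - 1)) * (\<integral>\<^sup>+x\<in>Q. ennreal ((1 + \<bar>b x - average Q
        b\<bar>) * \<bar>f x\<bar>) \<partial>lebesgue)
      \<le> ennreal (C1 * C3 * enn2real (weight_measure w Q) powr (- 1 / q) * G0 powr (1 / p))"
    proof (cases "G0 = 0")
      case False
      then show ?thesis using final[of G0] G0 fG0 by (simp add: m_def W_def h_def)
    next
      case True
      \<comment> \<open>Zero energy leaves no scale \<open>s\<close>. The bound is applied to
        arbitrarily small positive energies, chosen so that its right side is
        \<open>e\<close>.\<close>
      have "ennreal (m powr (\<gamma> / real CARD('n) - 1)) * (\<integral>\<^sup>+x\<in>Q. ennreal (h x * \<bar>f x\<bar>) \<partial>lebesgue) \<le> 0"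
      proof (rule ennreal_le_epsilon)
        fix e :: real assume e: "0 < e"
        define B where "B = C1 * C3 * W powr (- 1 / q)"
        have B: "0 < B" using C1 C3 W by (simp add: B_def)
        have "(\<integral>\<^sup>+x\<in>Q. ennreal (\<bar>f x\<bar> powr p * \<nu> x) \<partial>lebesgue) \<le> ennreal ((e / B) powr p)"
          using fG0 True by (auto intro: order_trans)
        then have "ennreal (m powr (\<gamma> / real CARD('n) - 1)) * (\<integral>\<^sup>+x\<in>Q. ennreal (h x * \<bar>f x\<bar>) \<partial>lebesgue)
            \<le> ennreal (B * ((e / B) powr p) powr (1 / p))"
          unfolding B_def using e B by (intro final) (auto simp: B_def)
        also have "B * ((e / B) powr p) powr (1 / p) = e" using e B p by (simp add: powr_powr)
        finally show "ennreal (m powr (\<gamma> / real CARD('n) - 1)) * (\<integral>\<^sup>+x\<in>Q. ennreal (h x * \<bar>f x\<bar>) \<partial>lebesgue) \<le> 0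
            + ennreal e" by simp
      qed
      then show ?thesis using True by (simp add: m_def h_def)
    qed
  qed
qed

section \<open>Dyadic decomposition of the kernel\<close>

lemma count_space_single_le: "f k \<le> (\<integral>\<^sup>+k. f k \<partial>count_space UNIV)"
proof -
  have "f k = (\<integral>\<^sup>+j. f k * indicator {k} j \<partial>count_space UNIV)"
    by (subst nn_integral_cmult_indicator) auto
  also have "\<dots> \<le> (\<integral>\<^sup>+k. f k \<partial>count_space UNIV)" by (intro nn_integral_mono) (auto simp: indicator_def)
  finally show ?thesis .
qed

text \<open>Sums over all integer scales are written as integrals over
  \<open>count_space UNIV\<close>, so that they can be exchanged with integrals in space.
  Enumerating the integers reduces a bound on them to finite sums.\<close>

lemma nn_integral_int_le:
  fixes f :: "int \<Rightarrow> ennreal"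
  assumes "\<And>S. finite S \<Longrightarrow> sum f S \<le> C"
  shows "(\<integral>\<^sup>+k. f k \<partial>count_space UNIV) \<le> C"
proof -
  have "(\<integral>\<^sup>+k. f k \<partial>count_space UNIV) = (\<integral>\<^sup>+n. f (int_decode n) \<partial>count_space UNIV)"
    by (rule nn_integral_bij_count_space[symmetric]) (rule bij_int_decode)
  also have "\<dots> = (\<Sum>n. f (int_decode n))" by (rule nn_integral_count_space_nat)
  also have "\<dots> \<le> C"
  proof (rule suminf_le_const)
    fix n
    have "(\<Sum>i<n. f (int_decode i)) = sum f (int_decode ` {..<n})"
      by (subst sum.reindex) (auto intro: inj_int_decode)
    then show "(\<Sum>i<n. f (int_decode i)) \<le> C" using assms[of "int_decode ` {..<n}"] by simp
  qed auto
  finally show ?thesis .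
qed

lemma chain_decay:
  fixes u :: "int \<Rightarrow> real"
  assumes "0 \<le> \<beta>" "\<And>k. u k \<le> \<beta> * u (k + 1)"
  shows "u (k - int n) \<le> \<beta> ^ n * u k"
proof (induction n)
  case (Suc n)
  have "u (k - int (Suc n)) \<le> \<beta> * u (k - int n)" using assms(2)[of "k - int (Suc n)"] by simp
  also have "\<dots> \<le> \<beta> * (\<beta> ^ n * u k)" using Suc assms(1) by (intro mult_left_mono)
  finally show ?case by (simp add: mult.assoc)
qed simp

text \<open>Counted downwards from the last selected index, where \<open>u\<close> is at most
  \<open>m\<close>, the values decay at least like powers of \<open>\<beta>\<close>. Finite index
  sets guarantee that this last index exists.\<close>

lemma chain_sum_below:
  fixes u :: "int \<Rightarrow> real"
  assumes \<beta>: "0 < \<beta>" "\<beta> < 1" and u: "\<And>k. 0 < u k" "\<And>k. u k \<le> \<beta> * u (k + 1)"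
    and \<delta>: "0 < \<delta>" and m: "0 < m"
  shows "(\<integral>\<^sup>+k. (if u k \<le> m then ennreal (u k powr \<delta>) else 0) \<partial>count_space UNIV) \<le> ennreal (m powr \<delta> / (1 - \<beta>
      powr \<delta>))"
proof (rule nn_integral_int_le)
  fix S :: "int set" assume S: "finite S"
  define T where "T = {k \<in> S. u k \<le> m}"
  have T: "finite T" using S by (simp add: T_def)
  have b1: "\<beta> powr \<delta> < 1" using \<beta> \<delta> powr_less_mono2[of \<delta> \<beta> 1] by simp
  have eq: "(\<Sum>k\<in>S. if u k \<le> m then ennreal (u k powr \<delta>) else 0) = (\<Sum>k\<in>T. ennreal (u k powr \<delta>))"
    unfolding T_def using S by (intro sum.mono_neutral_cong_right) auto
  show "(\<Sum>k\<in>S. if u k \<le> m then ennreal (u k powr \<delta>) else 0) \<le> ennreal (m powr \<delta> / (1 - \<beta> powr \<delta>))"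
  proof (cases "T = {}")
    case True
    then show ?thesis unfolding eq by simp
  next
    case False
    define k' where "k' = Max T"
    have k': "k' \<in> T" "\<And>k. k \<in> T \<Longrightarrow> k \<le> k'" using T False by (auto simp: k'_def)
    have "u k powr \<delta> \<le> m powr \<delta> * (\<beta> powr \<delta>) ^ nat (k' - k)" if "k \<in> T" for k
    proof -
      have "u k \<le> \<beta> ^ nat (k' - k) * u k'"
        using chain_decay[of \<beta> u k' "nat (k' - k)"] \<beta> u k'(2)[OF that] by simp
      also have "\<dots> \<le> \<beta> ^ nat (k' - k) * m" using k'(1) \<beta> by (intro mult_left_mono) (auto simp: T_def)
      finally have "u k powr \<delta> \<le> (\<beta> ^ nat (k' - k) * m) powr \<delta>" using u(1)[of k] \<delta> by (intro powr_mono2) auto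
      also have "\<dots> = m powr \<delta> * (\<beta> powr \<delta>) ^ nat (k' - k)"
        using \<beta> by (simp add: powr_mult powr_realpow[symmetric] powr_powr mult.commute)
      finally show ?thesis .
    qed
    then have "(\<Sum>k\<in>T. u k powr \<delta>) \<le> (\<Sum>k\<in>T. m powr \<delta> * (\<beta> powr \<delta>) ^ nat (k' - k))" by (intro sum_mono)
    also have "\<dots> = (\<Sum>n\<in>(\<lambda>k. nat (k' - k)) ` T. m powr \<delta> * (\<beta> powr \<delta>) ^ n)"
    proof (subst sum.reindex)
      show "inj_on (\<lambda>k. nat (k' - k)) T"
      proof (rule inj_onI)
        fix i j assume "i \<in> T" "j \<in> T" "nat (k' - i) = nat (k' - j)"
        then show "i = j" using k'(2)[of i] k'(2)[of j] by linarith
      qed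
    qed simp
    also have "\<dots> \<le> (\<Sum>n. m powr \<delta> * (\<beta> powr \<delta>) ^ n)"
      using T b1 by (intro sum_le_suminf summable_mult summable_geometric) auto
    also have "\<dots> = m powr \<delta> / (1 - \<beta> powr \<delta>)"
      using b1 by (subst suminf_mult) (auto simp: suminf_geometric summable_geometric)
    finally have "(\<Sum>k\<in>T. u k powr \<delta>) \<le> m powr \<delta> / (1 - \<beta> powr \<delta>)" .
    then show ?thesis unfolding eq by (subst sum_ennreal) (auto intro: ennreal_leI)
  qed
qed

text \<open>Reversing the scales and taking reciprocals preserves the growth condition and exchanges
  the two sides of \<open>m\<close>.\<close>

lemma chain_sum_above:
  fixes u :: "int \<Rightarrow> real"
  assumes \<beta>: "0 < \<beta>" "\<beta> < 1" and u: "\<And>k. 0 < u k" "\<And>k. u k \<le> \<beta> * u (k + 1)"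
    and \<delta>: "0 < \<delta>" and m: "0 < m"
  shows "(\<integral>\<^sup>+k. (if m \<le> u k then ennreal (u k powr - \<delta>) else 0) \<partial>count_space UNIV) \<le> ennreal (m powr - \<delta> / (1
      - \<beta> powr \<delta>))"
proof -
  define v where "v k = 1 / u (- k)" for k
  have v: "0 < v k" for k using u by (simp add: v_def)
  have v2: "v k \<le> \<beta> * v (k + 1)" for k
  proof -
    have "1 / B \<le> \<beta> * (1 / A)" if "A \<le> \<beta> * B" "0 < A" "0 < B" for A B using that by (simp add: field_simps)
    from this[of "u (- (k + 1))" "u (- k)"] show ?thesis
      using u(2)[of "- (k + 1)"] u(1) unfolding v_def by simp
  qed
  have "(\<integral>\<^sup>+k. (if m \<le> u k then ennreal (u k powr - \<delta>) else 0) \<partial>count_space UNIV)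
      = (\<integral>\<^sup>+k. (if m \<le> u (- k) then ennreal (u (- k) powr - \<delta>) else 0) \<partial>count_space UNIV)"
    by (rule nn_integral_bij_count_space[symmetric]) (rule bij_uminus)
  also have "\<dots> = (\<integral>\<^sup>+k. (if v k \<le> 1 / m then ennreal (v k powr \<delta>) else 0) \<partial>count_space UNIV)"
    using u(1) m by (intro nn_integral_cong) (auto simp: v_def powr_minus powr_divide divide_simps)
  also have "\<dots> \<le> ennreal ((1 / m) powr \<delta> / (1 - \<beta> powr \<delta>))"
    using m chain_sum_below[of \<beta> v \<delta> "1 / m"] \<beta> v v2 \<delta> by simp
  also have "(1 / m) powr \<delta> = m powr - \<delta>" using m by (simp add: powr_minus powr_divide divide_simps)
  finally show ?thesis .
qed

section \<open>Mass, energy and deviation on centred cubes of dyadic half side\<close>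

definition scale_cube :: "int \<Rightarrow> real ^ 'n \<Rightarrow> (real ^ 'n) set" where
  "scale_cube k x = centered_cube x (2 powr real_of_int k)"

definition cube_mass :: "(real ^ 'n \<Rightarrow> real) \<Rightarrow> int \<Rightarrow> real ^ 'n \<Rightarrow> real" where
  "cube_mass w k x = enn2real (weight_measure w (scale_cube k x))"

definition cube_energy :: "real \<Rightarrow> (real ^ 'n \<Rightarrow> real) \<Rightarrow> (real ^ 'n \<Rightarrow> real) \<Rightarrow> int \<Rightarrow> real ^ 'n \<Rightarrow> real" where
  "cube_energy p \<nu> f k x = enn2real (\<integral>\<^sup>+y\<in>scale_cube k x. ennreal (\<bar>f y\<bar> powr p * \<nu> y) \<partial>lebesgue)"

text \<open>The summand 1 makes deviations submultiplicative, 1 + |s + t| \<le> (1 + |s|) (1 + |t|),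
  so that the dependence on x can be taken out of integrals in y.\<close>

definition cube_dev :: "(real ^ 'n \<Rightarrow> real) \<Rightarrow> int \<Rightarrow> real ^ 'n \<Rightarrow> real" where
  "cube_dev b k x = 1 + \<bar>b x - average (scale_cube k x) b\<bar>"

definition dyadic_piece :: "real \<Rightarrow> real \<Rightarrow> (real ^ 'n \<Rightarrow> real) \<Rightarrow> (real ^ 'n \<Rightarrow> real) \<Rightarrow> (real ^ 'n \<Rightarrow> real) \<Rightarrow> (real
    ^ 'n \<Rightarrow> real) \<Rightarrow> int \<Rightarrow> real ^ 'n \<Rightarrow> real" where
  "dyadic_piece p q w \<nu> b f k x = cube_mass w k x powr (- 1 / q) * cube_energy p \<nu> f k x powr (1 / p) *
      cube_dev b k x"

lemma scale_cube_in_cubes [simp]: "scale_cube k x \<in> cubes"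
  by (simp add: scale_cube_def centered_cube_in_cubes)

lemma scale_cube_sets [measurable, simp]: "scale_cube k x \<in> sets lebesgue"
  by (simp add: scale_cube_def)

lemma measure_scale_cube: "measure lebesgue (scale_cube k (x :: real ^ 'n)) = 2 powr ((real_of_int k + 1) *
    real CARD('n))"
proof -
  have "measure lebesgue (scale_cube k x) = (2 powr (real_of_int k + 1)) ^ CARD('n)"
    by (simp add: scale_cube_def measure_centered_cube powr_add mult.commute)
  also have "\<dots> = (2 powr (real_of_int k + 1)) powr real CARD('n)" by (simp add: powr_realpow)
  also have "\<dots> = 2 powr ((real_of_int k + 1) * real CARD('n))" by (simp add: powr_powr)
  finally show ?thesis .
qed

lemma scale_cube_sym: "y \<in> scale_cube k x \<longleftrightarrow> x \<in> scale_cube k y"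
  unfolding scale_cube_def by (rule centered_cube_sym)

lemma scale_cube_self: "x \<in> scale_cube k x"
  unfolding scale_cube_def by (rule centered_cube_self) simp

lemma scale_cube_mono: "j \<le> k \<Longrightarrow> scale_cube j x \<subseteq> scale_cube k x"
  unfolding scale_cube_def by (intro centered_cube_mono) simp

lemma scale_cube_subset_Suc: "y \<in> scale_cube k x \<Longrightarrow> scale_cube k y \<subseteq> scale_cube (k + 1) x"
  unfolding scale_cube_def by (erule centered_cube_subset) (simp add: powr_add)

lemma scale_cube_subset_Suc_le: "y \<in> scale_cube k x \<Longrightarrow> j \<le> k \<Longrightarrow> scale_cube j y \<subseteq> scale_cube (k + 1) x"
  using scale_cube_subset_Suc[of y k x] scale_cube_mono[of j k y] by blast

lemma cube_mass_measurable [measurable]: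
  assumes w: "weight w" shows "cube_mass w k \<in> borel_measurable lebesgue"
proof -
  note [measurable] = weight_measurable[OF w]
  have "(\<lambda>x. \<integral>\<^sup>+y\<in>centered_cube x (2 powr real_of_int k). ennreal (w y) \<partial>lebesgue) \<in> borel_measurable
      lebesgue"
    by (rule borel_measurable_set_nn_integral_centered_cube) measurable
  then show ?thesis unfolding cube_mass_def[abs_def] weight_measure_def scale_cube_def by measurable
qed

lemma cube_energy_measurable [measurable]:
  assumes \<nu>: "weight \<nu>" and [measurable]: "f \<in> borel_measurable lebesgue"
  shows "cube_energy p \<nu> f k \<in> borel_measurable lebesgue"
proof -
  note [measurable] = weight_measurable[OF \<nu>]
  have "(\<lambda>x. \<integral>\<^sup>+y\<in>centered_cube x (2 powr real_of_int k). ennreal (\<bar>f y\<bar> powr p * \<nu> y) \<partial>lebesgue) \<in>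
      borel_measurable lebesgue"
    by (rule borel_measurable_set_nn_integral_centered_cube) measurable
  then show ?thesis unfolding cube_energy_def[abs_def] scale_cube_def by measurable
qed

lemma cube_dev_measurable [measurable]:
  assumes b: "locally_integrable b"
  shows "cube_dev b k \<in> borel_measurable lebesgue"
proof -
  note [measurable] = locally_integrable_measurable[OF b]
  have [measurable]: "(\<lambda>x. set_lebesgue_integral lebesgue (centered_cube x (2 powr real_of_int k)) b) \<in>
      borel_measurable lebesgue"
    by (rule borel_measurable_set_integral_centered_cube) measurable
  have "(\<lambda>x. 1 + \<bar>b x - set_lebesgue_integral lebesgue (centered_cube x (2 powr real_of_int k)) b / (2 powr
      ((real_of_int k + 1) * real CARD('a)))\<bar>) \<in> borel_measurable lebesgue"
    by measurable
  then show ?thesis unfolding cube_dev_def[abs_def] average_def measure_scale_cube by (simp add: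
      scale_cube_def)
qed

lemma cube_dev_ge1: "1 \<le> cube_dev b k x"
  by (simp add: cube_dev_def)

text \<open>A single scale suffices: the smallest one whose cube around x contains y. There |x - y|
  exceeds half of the half side, and the exponent \<gamma> - n is negative.\<close>

lemma riesz_kernel_dyadic_sum:
  fixes x y :: "real ^ 'n"
  assumes \<gamma>: "\<gamma> < real CARD('n)"
  shows "ennreal (1 / norm (x - y) powr (real CARD('n) - \<gamma>)) \<le>
    (\<integral>\<^sup>+k. ennreal (2 powr ((real_of_int k - 1) * (\<gamma> - real CARD('n)))) * indicator (scale_cube k x) y
        \<partial>count_space UNIV)"
proof (cases "x = y")
  case True
  \<comment> \<open>On the diagonal \<open>0 powr _ = 0\<close> and division by 0 give the value
    0.\<close>
  then show ?thesis by simp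
next
  case False
  define s where "s = Max (range (\<lambda>i. \<bar>(x - y) $ i\<bar>))"
  have fin: "finite (range (\<lambda>i. \<bar>(x - y) $ i\<bar>))" by simp
  have s_ge: "\<bar>(x - y) $ i\<bar> \<le> s" for i unfolding s_def using fin by (intro Max_ge) auto
  have "s \<in> range (\<lambda>i. \<bar>(x - y) $ i\<bar>)" unfolding s_def using fin by (intro Max_in) auto
  then obtain i where i: "s = \<bar>(x - y) $ i\<bar>" by blast
  obtain j where "(x - y) $ j \<noteq> 0" using False by (metis vec_eq_iff zero_index right_minus_eq)
  then have s: "0 < s" using s_ge[of j] by linarith
  define k where "k = \<lceil>log 2 s\<rceil>"
  have k: "log 2 s \<le> real_of_int k" "real_of_int k - 1 < log 2 s" unfolding k_def by linarith+
  have "s = 2 powr log 2 s" using s by simp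
  then have sk: "s \<le> 2 powr real_of_int k" "2 powr (real_of_int k - 1) < s"
    using k by (metis powr_le_cancel_iff one_less_numeral_iff semiring_norm(76)) (metis \<open>s = 2 powr log 2 s\<close>
        k(2) powr_less_cancel_iff one_less_numeral_iff semiring_norm(76))
  have "y \<in> scale_cube k x" unfolding scale_cube_def centered_cube_def using s_ge sk(1) by (auto simp:
      abs_minus_commute intro: order_trans)
  moreover have "1 / norm (x - y) powr (real CARD('n) - \<gamma>) \<le> 2 powr ((real_of_int k - 1) * (\<gamma> - real
      CARD('n)))"
  proof -
    have "2 powr (real_of_int k - 1) \<le> norm (x - y)"
      using sk(2) component_le_norm_cart[of "x - y" i] i by simp
    then have "norm (x - y) powr (\<gamma> - real CARD('n)) \<le> (2 powr (real_of_int k - 1)) powr (\<gamma> - real CARD('n))"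
      using \<gamma> by (intro powr_mono2') auto
    also have "\<dots> = 2 powr ((real_of_int k - 1) * (\<gamma> - real CARD('n)))" by (simp add: powr_powr)
    also have "norm (x - y) powr (\<gamma> - real CARD('n)) = 1 / norm (x - y) powr (real CARD('n) - \<gamma>)"
      using powr_minus_divide[of "norm (x - y)" "real CARD('n) - \<gamma>"] by simp
    finally show ?thesis .
  qed
  ultimately have "ennreal (1 / norm (x - y) powr (real CARD('n) - \<gamma>)) \<le> ennreal (2 powr ((real_of_int k - 1)
      * (\<gamma> - real CARD('n)))) * indicator (scale_cube k x) y"
    by (simp add: ennreal_leI)
  also have "\<dots> \<le> (\<integral>\<^sup>+k. ennreal (2 powr ((real_of_int k - 1) * (\<gamma> - real CARD('n)))) * indicator (scale_cube k
      x) y \<partial>count_space UNIV)"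
    by (rule count_space_single_le)
  finally show ?thesis .
qed

text \<open>The factor 1 + |b(x) - b(y)| dominates the kernel of the commutator and that of the
  fractional integral at once, so finiteness yields existence as well as size.\<close>

definition riesz_majorant :: "real \<Rightarrow> (real ^ 'n \<Rightarrow> real) \<Rightarrow> (real ^ 'n \<Rightarrow> real) \<Rightarrow> real ^ 'n \<Rightarrow> ennreal" where
  "riesz_majorant \<gamma> b f x = (\<integral>\<^sup>+y. ennreal ((1 + \<bar>b x - b y\<bar>) * \<bar>f y\<bar> / norm (x - y) powr (real CARD('n) - \<gamma>))
      \<partial>lebesgue)"

lemma Lp_loc_energy:
  assumes "f \<in> Lp_loc p \<nu>"
  shows "(\<integral>\<^sup>+y\<in>scale_cube k x. ennreal (\<bar>f y\<bar> powr p * \<nu> y) \<partial>lebesgue) = ennreal (cube_energy p \<nu> f k x)"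
proof -
  have "compact (scale_cube k x)" by (rule cubes_compact) simp
  then have "(\<integral>\<^sup>+y\<in>scale_cube k x. ennreal (\<bar>f y\<bar> powr p * \<nu> y) \<partial>lebesgue) < \<infinity>"
    using assms unfolding Lp_loc_def by blast
  then show ?thesis by (simp add: cube_energy_def less_top)
qed

text \<open>At each scale the kernel has size comparable to |Q|^(\<gamma>/n - 1), the deviation at x
  factors out, and what remains is the left side of \<open>two_weight_Hoelder\<close> on the cube
  around x.\<close>

lemma riesz_majorant_le_pieces:
  fixes b w \<nu> :: "real ^ 'n \<Rightarrow> real"
  assumes cond: "two_weight_condition \<gamma> p q w \<nu>" and w: "weight w" and \<nu>: "weight \<nu>" and p: "1 < p" and q: "0
      < q"
    and pos: "\<And>Q. Q \<in> cubes \<Longrightarrow> 0 < weight_measure w Q" and b: "bmo_bound b M" and \<gamma>: "\<gamma> < real CARD('n)"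
  shows "\<exists>C>0. \<forall>f\<in>Lp_loc p \<nu>. \<forall>x. riesz_majorant \<gamma> b f x \<le>
     ennreal C * (\<integral>\<^sup>+k. ennreal (dyadic_piece p q w \<nu> b f k x) \<partial>count_space UNIV)"
proof -
  obtain C where C: "0 < C" and H: "\<And>Q f G. Q \<in> cubes \<Longrightarrow> f \<in> borel_measurable lebesgue \<Longrightarrow> 0 \<le> G \<Longrightarrow>
    (\<integral>\<^sup>+x\<in>Q. ennreal (\<bar>f x\<bar> powr p * \<nu> x) \<partial>lebesgue) \<le> ennreal G \<Longrightarrow>
    ennreal (measure lebesgue Q powr (\<gamma> / real CARD('n) - 1)) * (\<integral>\<^sup>+x\<in>Q. ennreal ((1 + \<bar>b x - average Q b\<bar>) *
        \<bar>f x\<bar>) \<partial>lebesgue)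
      \<le> ennreal (C * enn2real (weight_measure w Q) powr (- 1 / q) * G powr (1 / p))"
    using two_weight_Hoelder[OF cond w \<nu> p q pos b] by blast
  have bl: "locally_integrable b" using b by (simp add: bmo_bound_def)
  note [measurable] = locally_integrable_measurable[OF bl]
  \<comment> \<open>The kernel bound has exponent (k-1)(\<gamma>-n), while the power of the cube's
    measure has (k+1)(\<gamma>-n) since the side is twice the half side; \<open>c\<close> is the
    quotient.\<close>
  define c where "c = (2::real) powr (- 2 * (\<gamma> - real CARD('n)))"
  have c: "0 < c" by (simp add: c_def)
  show ?thesis
  proof (intro exI[of _ "c * C"] conjI ballI allI)
    show "0 < c * C" using c C by simp
    fix f x assume f: "f \<in> Lp_loc p \<nu>"
    then have [measurable]: "f \<in> borel_measurable lebesgue" by (simp add: Lp_loc_def)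
    define h where "h y = ennreal ((1 + \<bar>b x - b y\<bar>) * \<bar>f y\<bar>)" for y
    have [measurable]: "h \<in> borel_measurable lebesgue" unfolding h_def by measurable
    define K where "K k = ennreal (2 powr ((real_of_int k - 1) * (\<gamma> - real CARD('n))))" for k
    have "riesz_majorant \<gamma> b f x = (\<integral>\<^sup>+y. h y * ennreal (1 / norm (x - y) powr (real CARD('n) - \<gamma>))
        \<partial>lebesgue)"
      unfolding riesz_majorant_def h_def by (intro nn_integral_cong) (simp flip: ennreal_mult)
    also have "\<dots> \<le> (\<integral>\<^sup>+y. (\<integral>\<^sup>+k. h y * (K k * indicator (scale_cube k x) y) \<partial>count_space UNIV) \<partial>lebesgue)"
      by (intro nn_integral_mono, subst nn_integral_cmult, simp, unfold K_def, intro mult_left_mono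
          riesz_kernel_dyadic_sum[OF \<gamma>]) simp
    also have "\<dots> = (\<integral>\<^sup>+k. (\<integral>\<^sup>+y. h y * (K k * indicator (scale_cube k x) y) \<partial>lebesgue) \<partial>count_space UNIV)"
      by (rule nn_integral_count_space_nn_integral) auto
    also have "\<dots> \<le> (\<integral>\<^sup>+k. ennreal (c * C) * ennreal (dyadic_piece p q w \<nu> b f k x) \<partial>count_space UNIV)"
    proof (intro nn_integral_mono)
      fix k
      define Q where "Q = scale_cube k x"
      have Q: "Q \<in> cubes" by (simp add: Q_def)
      note [measurable] = cubes_sets[OF Q]
      have Kc: "K k = ennreal (c * measure lebesgue Q powr (\<gamma> / real CARD('n) - 1))"
      proof -
        have "measure lebesgue Q powr (\<gamma> / real CARD('n) - 1) = 2 powr ((real_of_int k + 1) * real CARD('n) *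
            (\<gamma> / real CARD('n) - 1))"
          by (simp add: Q_def measure_scale_cube powr_powr)
        also have "(real_of_int k + 1) * real CARD('n) * (\<gamma> / real CARD('n) - 1) = (real_of_int k + 1) * (\<gamma> -
            real CARD('n))"
          by (simp add: field_simps)
        finally have "c * measure lebesgue Q powr (\<gamma> / real CARD('n) - 1) = 2 powr (- 2 * (\<gamma> - real CARD('n))
            + (real_of_int k + 1) * (\<gamma> - real CARD('n)))"
          unfolding c_def by (simp add: powr_add)
        also have "- 2 * (\<gamma> - real CARD('n)) + (real_of_int k + 1) * (\<gamma> - real CARD('n)) = (real_of_int k - 1)
            * (\<gamma> - real CARD('n))"
          by (simp add: algebra_simps)
        finally show ?thesis by (simp add: K_def)
      qed
      have "(\<integral>\<^sup>+y. h y * (K k * indicator (scale_cube k x) y) \<partial>lebesgue) = (\<integral>\<^sup>+y. K k * (h y * indicator Q y)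
          \<partial>lebesgue)"
        by (simp add: Q_def mult_ac)
      also have "\<dots> = K k * (\<integral>\<^sup>+y\<in>Q. h y \<partial>lebesgue)" by (intro nn_integral_cmult) measurable
      also have "(\<integral>\<^sup>+y\<in>Q. h y \<partial>lebesgue) \<le> (\<integral>\<^sup>+y. ennreal (cube_dev b k x) * (ennreal ((1 + \<bar>b y - average Q
          b\<bar>) * \<bar>f y\<bar>) * indicator Q y) \<partial>lebesgue)"
      proof (intro nn_integral_mono)
        fix y
        \<comment> \<open>The triangle inequality through the average over \<open>Q\<close>; the
          added product of deviations completes the factorisation.\<close>
        have "1 + \<bar>b x - b y\<bar> \<le> 1 + (\<bar>b x - average Q b\<bar> + \<bar>b y - average Q b\<bar>) + \<bar>b x - average Q b\<bar> * \<bar>b y -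
            average Q b\<bar>"
          by (simp add: abs_mult[symmetric] add_increasing2)
        also have "\<dots> = cube_dev b k x * (1 + \<bar>b y - average Q b\<bar>)"
          by (simp add: cube_dev_def Q_def algebra_simps)
        finally have "(1 + \<bar>b x - b y\<bar>) * \<bar>f y\<bar> \<le> cube_dev b k x * ((1 + \<bar>b y - average Q b\<bar>) * \<bar>f y\<bar>)"
          by (metis abs_ge_zero mult.assoc mult_right_mono)
        then have "h y \<le> ennreal (cube_dev b k x * ((1 + \<bar>b y - average Q b\<bar>) * \<bar>f y\<bar>))"
          unfolding h_def by (rule ennreal_leI)
        then show "h y * indicator Q y \<le> ennreal (cube_dev b k x) * (ennreal ((1 + \<bar>b y - average Q b\<bar>) * \<bar>f
            y\<bar>) * indicator Q y)"
          using cube_dev_ge1[of b k x] by (auto simp: indicator_def ennreal_mult)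
      qed
      also have "\<dots> = ennreal (cube_dev b k x) * (\<integral>\<^sup>+y\<in>Q. ennreal ((1 + \<bar>b y - average Q b\<bar>) * \<bar>f y\<bar>)
          \<partial>lebesgue)"
        by (intro nn_integral_cmult) measurable
      finally have "(\<integral>\<^sup>+y. h y * (K k * indicator (scale_cube k x) y) \<partial>lebesgue) \<le>
          K k * (ennreal (cube_dev b k x) * (\<integral>\<^sup>+y\<in>Q. ennreal ((1 + \<bar>b y - average Q b\<bar>) * \<bar>f y\<bar>) \<partial>lebesgue))"
        by (simp add: mult_left_mono)
      also have "\<dots> = ennreal (c * cube_dev b k x) * (ennreal (measure lebesgue Q powr (\<gamma> / real CARD('n) - 1))
          * (\<integral>\<^sup>+y\<in>Q. ennreal ((1 + \<bar>b y - average Q b\<bar>) * \<bar>f y\<bar>) \<partial>lebesgue))"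
        unfolding Kc using c cube_dev_ge1[of b k x] by (simp add: ennreal_mult mult_ac)
      also have "\<dots> \<le> ennreal (c * cube_dev b k x) * ennreal (C * enn2real (weight_measure w Q) powr (- 1 / q)
          * cube_energy p \<nu> f k x powr (1 / p))"
        using Lp_loc_energy[OF f, of k x] by (intro mult_left_mono H[OF Q]) (auto simp: Q_def cube_energy_def)
      also have "\<dots> = ennreal (c * C) * ennreal (dyadic_piece p q w \<nu> b f k x)"
        using c C cube_dev_ge1[of b k x] by (simp add: dyadic_piece_def cube_mass_def Q_def mult_ac flip:
            ennreal_mult)
      finally show "(\<integral>\<^sup>+y. h y * (K k * indicator (scale_cube k x) y) \<partial>lebesgue) \<le> ennreal (c * C) * ennreal
          (dyadic_piece p q w \<nu> b f k x)" .
    qed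
    also have "\<dots> = ennreal (c * C) * (\<integral>\<^sup>+k. ennreal (dyadic_piece p q w \<nu> b f k x) \<partial>count_space UNIV)"
      by (intro nn_integral_cmult) auto
    finally show "riesz_majorant \<gamma> b f x \<le> ennreal (c * C) * (\<integral>\<^sup>+k. ennreal (dyadic_piece p q w \<nu> b f k x)
        \<partial>count_space UNIV)" .
  qed
qed

section \<open>Local estimates at one scale\<close>

text \<open>Tonelli's theorem together with the symmetry of membership in centred cubes.\<close>

lemma nn_integral_cube_swap:
  fixes A B :: "real ^ 'n \<Rightarrow> ennreal"
  assumes [measurable]: "A \<in> borel_measurable lebesgue" "B \<in> borel_measurable lebesgue"
  shows "(\<integral>\<^sup>+x. A x * (\<integral>\<^sup>+y\<in>scale_cube k x. B y \<partial>lebesgue) \<partial>lebesgue) = (\<integral>\<^sup>+y. B y * (\<integral>\<^sup>+x\<in>scale_cube k y. A x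
      \<partial>lebesgue) \<partial>lebesgue)"
proof -
  interpret pair_sigma_finite "lebesgue :: (real ^ 'n) measure" "lebesgue :: (real ^ 'n) measure"
    by (rule pair_sigma_finite_lebesgue)
  have [measurable]: "(\<lambda>z. A (fst z) * (B (snd z) * indicator (scale_cube k (fst z)) (snd z))) \<in>
      borel_measurable (lebesgue \<Otimes>\<^sub>M lebesgue)"
    unfolding scale_cube_def by (simp add: indicator_def of_bool_def) measurable
  have "(\<integral>\<^sup>+x. A x * (\<integral>\<^sup>+y\<in>scale_cube k x. B y \<partial>lebesgue) \<partial>lebesgue) = (\<integral>\<^sup>+x. (\<integral>\<^sup>+y. A x * (B y * indicator
      (scale_cube k x) y) \<partial>lebesgue) \<partial>lebesgue)"
    by (intro nn_integral_cong, subst nn_integral_cmult) auto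
  also have "\<dots> = (\<integral>\<^sup>+y. (\<integral>\<^sup>+x. A x * (B y * indicator (scale_cube k x) y) \<partial>lebesgue) \<partial>lebesgue)"
    by (rule Fubini'[symmetric]) (simp add: case_prod_beta')
  also have "\<dots> = (\<integral>\<^sup>+y. (\<integral>\<^sup>+x. B y * (A x * indicator (scale_cube k y) x) \<partial>lebesgue) \<partial>lebesgue)"
    by (intro nn_integral_cong) (auto simp: indicator_def scale_cube_sym mult_ac)
  also have "\<dots> = (\<integral>\<^sup>+y. B y * (\<integral>\<^sup>+x\<in>scale_cube k y. A x \<partial>lebesgue) \<partial>lebesgue)"
    by (intro nn_integral_cong, subst nn_integral_cmult) auto
  finally show ?thesis .
qed

section \<open>Doubling and reverse doubling of cube masses\<close>

lemma A_infinity_pos: "w \<in> A_infinity \<Longrightarrow> Q \<in> cubes \<Longrightarrow> 0 < weight_measure w Q"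
  using A_infinity_large_subset[of w 1] by auto

lemma cube_mass_eq: "weight w \<Longrightarrow> weight_measure w (scale_cube k x) = ennreal (cube_mass w k x)"
  unfolding cube_mass_def by (rule weight_measure_cube_real) auto

lemma cube_mass_pos:
  assumes "w \<in> A_infinity" shows "0 < cube_mass w k x"
  using A_infinity_pos[OF assms, of "scale_cube k x"] cube_mass_eq[OF A_infinity_weight[OF assms], of k x]
  by (simp add: ennreal_less_zero_iff)

lemma cube_mass_mono_set:
  assumes "weight w" "scale_cube j x \<subseteq> scale_cube k y" shows "cube_mass w j x \<le> cube_mass w k y"
  using weight_measure_mono[OF assms(2), of w] unfolding cube_mass_eq[OF assms(1)]
  by (simp add: cube_mass_def)

lemma cube_mass_mono: "weight w \<Longrightarrow> j \<le> k \<Longrightarrow> cube_mass w j x \<le> cube_mass w k x"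
  by (intro cube_mass_mono_set scale_cube_mono)

lemma cube_mass_doubling:
  fixes w :: "real ^ 'n \<Rightarrow> real"
  assumes w: "w \<in> A_infinity"
  shows "\<exists>D\<ge>1. \<forall>k x y. y \<in> scale_cube k x \<longrightarrow> cube_mass w (k + 1) x \<le> D * cube_mass w k y"
proof -
  obtain D where D: "1 \<le> D" and dbl: "\<And>x y r s. 0 < r \<Longrightarrow> s \<le> 4 * r \<Longrightarrow> centered_cube y r \<subseteq> centered_cube x s \<Longrightarrow>
      weight_measure w (centered_cube x s) \<le> ennreal D * weight_measure w (centered_cube y r)"
    using A_infinity_doubling[OF w] by blast
  have "cube_mass w (k + 1) x \<le> D * cube_mass w k y" if "y \<in> scale_cube k x" for k x y
  proof -
    have "weight_measure w (scale_cube (k + 1) x) \<le> ennreal D * weight_measure w (scale_cube k y)"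
      unfolding scale_cube_def using scale_cube_subset_Suc[OF that] unfolding scale_cube_def
      by (intro dbl) (auto simp: powr_add)
    then show ?thesis unfolding cube_mass_eq[OF A_infinity_weight[OF w]] using D
      by (simp add: cube_mass_def flip: ennreal_mult)
  qed
  then show ?thesis using D by blast
qed

text \<open>In any dimension the smaller cube occupies at most half of the larger, so
  \<open>half_bounded\<close> applies. This is the growth hypothesis of the chain sums.\<close>

lemma cube_mass_reverse_doubling:
  fixes w :: "real ^ 'n \<Rightarrow> real"
  assumes w: "w \<in> A_infinity"
  shows "\<exists>\<beta>. 0 < \<beta> \<and> \<beta> < 1 \<and> (\<forall>k x. cube_mass w k x \<le> \<beta> * cube_mass w (k + 1) x)"
proof -
  obtain \<beta> where \<beta>: "0 < \<beta>" "\<beta> < 1" and hb: "half_bounded w \<beta>" using A_infinity_half_bounded[OF w] by blast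
  have "cube_mass w k x \<le> \<beta> * cube_mass w (k + 1) x" for k x
  proof -
    have "2 * measure lebesgue (scale_cube k x) \<le> measure lebesgue (scale_cube (k + 1) x)"
    proof -
      have "2 * measure lebesgue (scale_cube k x) = 2 powr (1 + (real_of_int k + 1) * real CARD('n))"
        by (simp add: measure_scale_cube powr_add)
      also have "\<dots> \<le> 2 powr ((real_of_int (k + 1) + 1) * real CARD('n))"
        using zero_less_card_finite[where 'a = 'n] by (intro powr_mono) (auto simp: algebra_simps)
      finally show ?thesis by (simp add: measure_scale_cube)
    qed
    then have "weight_measure w (scale_cube k x) \<le> ennreal \<beta> * weight_measure w (scale_cube (k + 1) x)"
      using hb scale_cube_mono[of k "k + 1" x] unfolding half_bounded_def by simp
    then show ?thesis unfolding cube_mass_eq[OF A_infinity_weight[OF w]] using \<beta>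
      by (simp add: cube_mass_def flip: ennreal_mult)
  qed
  then show ?thesis using \<beta> by blast
qed

section \<open>Change of averages between neighbouring cubes, and powers of the deviation\<close>

lemma average_subcube_le:
  fixes b :: "real ^ 'n \<Rightarrow> real"
  assumes b: "bmo_bound b M" and sub: "scale_cube k z \<subseteq> scale_cube (k + 1) x"
  shows "\<bar>average (scale_cube k z) b - average (scale_cube (k + 1) x) b\<bar> \<le> 2 ^ CARD('n) * M"
proof -
  have bl: "locally_integrable b" and M: "0 < M" using b by (auto simp: bmo_bound_def)
  define R where "R = scale_cube (k + 1) x"
  have R: "R \<in> cubes" by (simp add: R_def)
  have "nn_average (scale_cube k z) (\<lambda>x. ennreal \<bar>b x - average R b\<bar>) \<le> ennreal (2 ^ CARD('n) * M)"
  proof (subst nn_average_le_iff)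
    have "(\<integral>\<^sup>+x\<in>scale_cube k z. ennreal \<bar>b x - average R b\<bar> \<partial>lebesgue) \<le> (\<integral>\<^sup>+x\<in>R. ennreal \<bar>b x - average R b\<bar>
        \<partial>lebesgue)"
      using sub by (intro nn_integral_mono) (auto simp: indicator_def R_def)
    also have "\<dots> \<le> ennreal M * ennreal (measure lebesgue R)"
      using b R unfolding bmo_bound_def nn_average_le_iff[OF R, symmetric] by blast
    also have "measure lebesgue R = 2 ^ CARD('n) * measure lebesgue (scale_cube k z)"
    proof -
      have "(real_of_int (k + 1) + 1) * real CARD('n) = real CARD('n) + (real_of_int k + 1) * real CARD('n)"
        by (simp add: algebra_simps)
      then have "measure lebesgue R = 2 powr real CARD('n) * measure lebesgue (scale_cube k z)"
        unfolding R_def measure_scale_cube by (simp only: powr_add)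
      then show ?thesis by (simp add: powr_realpow)
    qed
    also have "ennreal M * ennreal (2 ^ CARD('n) * measure lebesgue (scale_cube k z)) = ennreal (2 ^ CARD('n)
        * M) * ennreal (measure lebesgue (scale_cube k z))"
      using M by (simp add: mult_ac flip: ennreal_mult)
    finally show "(\<integral>\<^sup>+x\<in>scale_cube k z. ennreal \<bar>b x - average R b\<bar> \<partial>lebesgue) \<le> ennreal (2 ^ CARD('n) * M) *
        ennreal (measure lebesgue (scale_cube k z))" .
  qed simp
  then show ?thesis unfolding R_def using M by (intro average_minus_const_le[OF bl]) auto
qed

text \<open>The cubes around x and y both lie in the doubled cube around y, so their averages differ
  by a bounded amount. This replaces an average that moves with x by a fixed one.\<close>

lemma cube_dev_le:
  fixes b :: "real ^ 'n \<Rightarrow> real"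
  assumes b: "bmo_bound b M" and y: "x \<in> scale_cube k y"
  shows "cube_dev b k x \<le> (1 + 2 * (2 ^ CARD('n) * M)) * (1 + \<bar>b x - average (scale_cube k y) b\<bar>)"
proof -
  have M: "0 < M" using b by (auto simp: bmo_bound_def)
  have "\<bar>average (scale_cube k x) b - average (scale_cube (k + 1) y) b\<bar> \<le> 2 ^ CARD('n) * M"
    by (rule average_subcube_le[OF b scale_cube_subset_Suc[OF y]])
  moreover have "\<bar>average (scale_cube k y) b - average (scale_cube (k + 1) y) b\<bar> \<le> 2 ^ CARD('n) * M"
    by (rule average_subcube_le[OF b scale_cube_mono]) simp
  ultimately have "cube_dev b k x \<le> 1 + \<bar>b x - average (scale_cube k y) b\<bar> + 2 * (2 ^ CARD('n) * M)"
    unfolding cube_dev_def by linarith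
  moreover have "0 \<le> 2 * (2 ^ CARD('n) * M) * \<bar>b x - average (scale_cube k y) b\<bar>" using M by simp
  ultimately show ?thesis by (simp add: algebra_simps)
qed

lemma weighted_deviation_power:
  fixes b v :: "real ^ 'n \<Rightarrow> real"
  assumes b: "bmo_bound b M" and v: "weight v" and \<beta>: "half_bounded v \<beta>" "0 \<le> \<beta>" "\<beta> < 1" and s: "0 < s"
  shows "\<exists>C>0. \<forall>Q\<in>cubes. (\<integral>\<^sup>+x\<in>Q. ennreal ((1 + \<bar>b x - average Q b\<bar>) powr s * v x) \<partial>lebesgue) \<le> ennreal C *
      weight_measure v Q"
proof -
  have bl: "locally_integrable b" using b by (auto simp: bmo_bound_def)
  have v0: "0 \<le> v x" for x using v by (simp add: weight_def)
  note [measurable] = locally_integrable_measurable[OF bl] weight_measurable[OF v]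
  obtain c C where c: "0 < c" "0 < C" and JN: "\<And>Q. Q \<in> cubes \<Longrightarrow>
    (\<integral>\<^sup>+x\<in>Q. ennreal (exp (c * \<bar>b x - average Q b\<bar>) * v x) \<partial>lebesgue) \<le> ennreal C * weight_measure v Q"
    using John_Nirenberg[OF b v \<beta>] by blast
  define K where "K = (1 + s / c) powr s"
  have "0 < 1 + s / c" using s c by (intro add_pos_pos) auto
  then have K: "0 < K" by (simp add: K_def)
  have pow: "(1 + t) powr s \<le> K * exp (c * t)" if t: "0 \<le> t" for t
  proof -
    \<comment> \<open>The added terms complete a product whose second factor is at most exp(c t /
      s); the power \<open>s\<close> then produces exactly exp(c t).\<close>
    have "1 + t \<le> 1 + t + (s / c + c * t / s)" using s c t by simp
    also have "\<dots> = (1 + s / c) * (1 + c * t / s)" using s c by (simp add: field_simps)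
    also have "\<dots> \<le> (1 + s / c) * exp (c * t / s)" using s c exp_ge_add_one_self[of "c * t / s"] by (intro
        mult_left_mono) auto
    finally have "(1 + t) powr s \<le> ((1 + s / c) * exp (c * t / s)) powr s" using t s by (intro powr_mono2)
        auto
    also have "\<dots> = K * exp (c * t / s) powr s" unfolding K_def by (rule powr_mult)
    also have "exp (c * t / s) powr s = exp (c * t)" using s by (simp add: powr_def)
    finally show ?thesis .
  qed
  show ?thesis
  proof (intro exI[of _ "K * C"] conjI ballI)
    show "0 < K * C" using K c by simp
    fix Q :: "(real ^ 'n) set" assume Q: "Q \<in> cubes"
    note [measurable] = cubes_sets[OF Q]
    have "(\<integral>\<^sup>+x\<in>Q. ennreal ((1 + \<bar>b x - average Q b\<bar>) powr s * v x) \<partial>lebesgue)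
       \<le> (\<integral>\<^sup>+x. ennreal K * (ennreal (exp (c * \<bar>b x - average Q b\<bar>) * v x) * indicator Q x) \<partial>lebesgue)"
    proof (intro nn_integral_mono)
      fix x
      have "(1 + \<bar>b x - average Q b\<bar>) powr s * v x \<le> K * exp (c * \<bar>b x - average Q b\<bar>) * v x"
        using pow[of "\<bar>b x - average Q b\<bar>"] v0[of x] by (intro mult_right_mono) auto
      then have "ennreal ((1 + \<bar>b x - average Q b\<bar>) powr s * v x) \<le> ennreal (K * (exp (c * \<bar>b x - average Q
          b\<bar>) * v x))"
        by (intro ennreal_leI) (simp add: mult.assoc)
      then show "ennreal ((1 + \<bar>b x - average Q b\<bar>) powr s * v x) * indicator Q x \<le> ennreal K * (ennreal (exp
          (c * \<bar>b x - average Q b\<bar>) * v x) * indicator Q x)"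
        using K v0[of x] by (auto simp: indicator_def ennreal_mult)
    qed
    also have "\<dots> = ennreal K * (\<integral>\<^sup>+x\<in>Q. ennreal (exp (c * \<bar>b x - average Q b\<bar>) * v x) \<partial>lebesgue)"
      by (intro nn_integral_cmult) measurable
    also have "\<dots> \<le> ennreal K * (ennreal C * weight_measure v Q)" by (intro mult_left_mono JN[OF Q]) simp
    also have "\<dots> = ennreal (K * C) * weight_measure v Q" using K c by (simp add: mult.assoc ennreal_mult)
    finally show "(\<integral>\<^sup>+x\<in>Q. ennreal ((1 + \<bar>b x - average Q b\<bar>) powr s * v x) \<partial>lebesgue) \<le> ennreal (K * C) *
        weight_measure v Q" .
  qed
qed

lemma powr_comparable:
  fixes u v D e :: real
  assumes "0 < u" "0 < v" "1 \<le> D" "u \<le> D * v" "v \<le> D * u"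
  shows "u powr e \<le> D powr \<bar>e\<bar> * v powr e"
proof (cases "0 \<le> e")
  case True
  have "u powr e \<le> (D * v) powr e" using assms True by (intro powr_mono2) auto
  then show ?thesis using True by (simp add: powr_mult)
next
  case False
  have "v / D \<le> u" using assms by (simp add: field_simps)
  then have "u powr e \<le> (v / D) powr e" using assms False by (intro powr_mono2') auto
  also have "\<dots> = v powr e / D powr e" using assms by (simp add: powr_divide)
  also have "\<dots> = D powr (- e) * v powr e" using assms by (simp add: powr_minus divide_simps)
  finally show ?thesis using False by simp
qed

text \<open>For x in the cube around y, doubling freezes the mass at y and
  \<open>cube_dev_le\<close> freezes the average. Only a power of a deviation from a fixed average
  is left, and it is integrable against w.\<close>

lemma local_integral_bound:
  fixes w b :: "real ^ 'n \<Rightarrow> real"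
  assumes w: "w \<in> A_infinity" and b: "bmo_bound b M" and s: "0 < s"
  shows "\<exists>C>0. \<forall>k y. (\<integral>\<^sup>+x\<in>scale_cube k y. ennreal (cube_mass w k x powr - e * cube_dev b k x powr s * w x)
      \<partial>lebesgue)
     \<le> ennreal (C * cube_mass w k y powr (1 - e))"
proof -
  have wt: "weight w" by (rule A_infinity_weight[OF w])
  have w0: "0 \<le> w x" for x using wt by (simp add: weight_def)
  have bl: "locally_integrable b" and M: "0 < M" using b by (auto simp: bmo_bound_def)
  note [measurable] = locally_integrable_measurable[OF bl] weight_measurable[OF wt] cube_mass_measurable[OF
      wt] cube_dev_measurable[OF bl]
  obtain D where D: "1 \<le> D" and dbl: "\<And>k x y. y \<in> scale_cube k x \<Longrightarrow> cube_mass w (k + 1) x \<le> D * cube_mass w k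
      y"
    using cube_mass_doubling[OF w] by blast
  obtain \<beta> where \<beta>: "0 < \<beta>" "\<beta> < 1" "half_bounded w \<beta>" using A_infinity_half_bounded[OF w] by blast
  obtain C where C: "0 < C" and pw: "\<And>Q. Q \<in> cubes \<Longrightarrow> (\<integral>\<^sup>+x\<in>Q. ennreal ((1 + \<bar>b x - average Q b\<bar>) powr s * w x)
      \<partial>lebesgue) \<le> ennreal C * weight_measure w Q"
    using weighted_deviation_power[OF b wt \<beta>(3) _ \<beta>(2) s] \<beta>(1) by auto
  define L where "L = 1 + 2 * (2 ^ CARD('n) * M)"
  have L: "0 < L" using M by (simp add: L_def add_pos_pos)
  define B where "B = D powr \<bar>e\<bar> * L powr s"
  have B: "0 < B" using D L by (simp add: B_def)
  show ?thesis
  proof (intro exI[of _ "B * C"] conjI allI)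
    show "0 < B * C" using B C by simp
    fix k and y :: "real ^ 'n"
    define Q where "Q = scale_cube k y"
    have Q: "Q \<in> cubes" by (simp add: Q_def)
    note [measurable] = cubes_sets[OF Q]
    define U where "U = cube_mass w k y"
    have U: "0 < U" unfolding U_def by (rule cube_mass_pos[OF w])
    have "(\<integral>\<^sup>+x\<in>Q. ennreal (cube_mass w k x powr - e * cube_dev b k x powr s * w x) \<partial>lebesgue)
      \<le> (\<integral>\<^sup>+x. ennreal (B * U powr - e) * (ennreal ((1 + \<bar>b x - average Q b\<bar>) powr s * w x) * indicator Q x)
          \<partial>lebesgue)"
    proof (intro nn_integral_mono)
      fix x
      have "ennreal (cube_mass w k x powr - e * cube_dev b k x powr s * w x) \<le> ennreal (B * U powr - e * ((1 +
          \<bar>b x - average Q b\<bar>) powr s * w x))" if x: "x \<in> Q"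
      proof (intro ennreal_leI)
        have xy: "x \<in> scale_cube k y" "y \<in> scale_cube k x" using x scale_cube_sym unfolding Q_def by blast+
        have "cube_mass w k x \<le> D * U" "U \<le> D * cube_mass w k x"
          using dbl[OF xy(1)] dbl[OF xy(2)] cube_mass_mono[OF wt, of k "k + 1" x] cube_mass_mono[OF wt, of k
              "k + 1" y]
          unfolding U_def by linarith+
        then have "cube_mass w k x powr - e \<le> D powr \<bar>- e\<bar> * U powr - e"
          by (intro powr_comparable cube_mass_pos[OF w] U D)
        moreover have "cube_dev b k x powr s \<le> (L * (1 + \<bar>b x - average Q b\<bar>)) powr s"
          unfolding L_def Q_def using s cube_dev_ge1[of b k x] by (intro powr_mono2 cube_dev_le[OF b xy(1)])
              auto
        ultimately have "cube_mass w k x powr - e * cube_dev b k x powr s * w x \<le> (D powr \<bar>- e\<bar> * U powr - e)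
            * (L * (1 + \<bar>b x - average Q b\<bar>)) powr s * w x"
          using w0[of x] by (intro mult_right_mono mult_mono) auto
        also have "\<dots> = B * U powr - e * ((1 + \<bar>b x - average Q b\<bar>) powr s * w x)"
          by (simp add: B_def powr_mult mult_ac)
        finally show "cube_mass w k x powr - e * cube_dev b k x powr s * w x \<le> B * U powr - e * ((1 + \<bar>b x -
            average Q b\<bar>) powr s * w x)" .
      qed
      then show "ennreal (cube_mass w k x powr - e * cube_dev b k x powr s * w x) * indicator Q x \<le> ennreal (B
          * U powr - e) * (ennreal ((1 + \<bar>b x - average Q b\<bar>) powr s * w x) * indicator Q x)"
        using B w0[of x] by (auto simp: indicator_def ennreal_mult)
    qed
    also have "\<dots> = ennreal (B * U powr - e) * (\<integral>\<^sup>+x\<in>Q. ennreal ((1 + \<bar>b x - average Q b\<bar>) powr s * w x)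
        \<partial>lebesgue)"
      by (intro nn_integral_cmult) measurable
    also have "\<dots> \<le> ennreal (B * U powr - e) * (ennreal C * ennreal U)"
      using pw[OF Q] unfolding Q_def cube_mass_eq[OF wt] U_def by (intro mult_left_mono) auto
    also have "\<dots> = ennreal (B * C * (U powr - e * U powr 1))"
      using B C U by (simp add: mult_ac flip: ennreal_mult)
    also have "U powr - e * U powr 1 = U powr (1 - e)" by (simp only: powr_add[symmetric]) simp
    finally show "(\<integral>\<^sup>+x\<in>scale_cube k y. ennreal (cube_mass w k x powr - e * cube_dev b k x powr s * w x)
        \<partial>lebesgue)
     \<le> ennreal (B * C * cube_mass w k y powr (1 - e))" unfolding Q_def U_def .
  qed
qed

text \<open>The side of \<open>m\<close> on which \<open>u\<^sub>k powr (1 - e)\<close> is summable over \<open>k\<close>.\<close>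
definition mass_selected :: "real \<Rightarrow> real \<Rightarrow> real \<Rightarrow> bool" where
  "mass_selected e m u \<longleftrightarrow> (if e < 1 then u \<le> m else m \<le> u)"

text \<open>The integrand to which Chebyshev's inequality leads at one scale. It is linear in the
  energy, so the integrations can be exchanged; the restriction to scales up to \<open>k0\<close>
  keeps all cubes inside one doubled cube.\<close>

definition selected_piece ::
    "real \<Rightarrow> (real ^ 'n \<Rightarrow> real) \<Rightarrow> (real ^ 'n \<Rightarrow> real) \<Rightarrow> (real ^ 'n \<Rightarrow> real) \<Rightarrow> (real ^ 'n \<Rightarrow> real)
      \<Rightarrow> real \<Rightarrow> real \<Rightarrow> real \<Rightarrow> int \<Rightarrow> int \<Rightarrow> real ^ 'n \<Rightarrow> ennreal" where
  "selected_piece p w \<nu> b f e s m k0 k x =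
     (if k \<le> k0 \<and> mass_selected e m (cube_mass w k x)
      then ennreal (cube_mass w k x powr - e * cube_dev b k x powr s * w x) * ennreal (cube_energy p \<nu> f k x)
          else 0)"

lemma selected_piece_measurable [measurable]:
  assumes w: "weight w" and \<nu>: "weight \<nu>" and b: "locally_integrable b" and [measurable]: "f \<in>
      borel_measurable lebesgue"
  shows "selected_piece p w \<nu> b f e s m k0 k \<in> borel_measurable lebesgue"
proof -
  note [measurable] = weight_measurable[OF w] cube_mass_measurable[OF w] cube_dev_measurable[OF b]
      cube_energy_measurable[OF \<nu>]
  show ?thesis unfolding selected_piece_def[abs_def] mass_selected_def by measurable
qed

text \<open>Write the energy as an integral in y and exchange the order. The inner integral in x
  gives the mass at y to the power 1 - e, the selection makes its sum over scales geometric, and the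
  y-integral left over is the energy of the doubled cube.\<close>

lemma local_pieces_bound:
  fixes w b \<nu> :: "real ^ 'n \<Rightarrow> real"
  assumes w: "w \<in> A_infinity" and \<nu>: "weight \<nu>" and b: "bmo_bound b M" and s: "0 < s" and e: "e \<noteq> 1"
  shows "\<exists>C>0. \<forall>f\<in>Lp_loc p \<nu>. \<forall>k0 x0. \<forall>m>0.
    (\<integral>\<^sup>+k. (\<integral>\<^sup>+x\<in>scale_cube k0 x0. selected_piece p w \<nu> b f e s m k0 k x \<partial>lebesgue) \<partial>count_space UNIV)
     \<le> ennreal (C * m powr (1 - e) * cube_energy p \<nu> f (k0 + 1) x0)"
proof -
  have wt: "weight w" by (rule A_infinity_weight[OF w])
  have w0: "0 \<le> w x" for x using wt by (simp add: weight_def)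
  have bl: "locally_integrable b" and M: "0 < M" using b by (auto simp: bmo_bound_def)
  note [measurable] = locally_integrable_measurable[OF bl] weight_measurable[OF wt] weight_measurable[OF \<nu>]
      cube_mass_measurable[OF wt] cube_dev_measurable[OF bl]
  obtain D where D: "1 \<le> D" and dbl: "\<And>k x y. y \<in> scale_cube k x \<Longrightarrow> cube_mass w (k + 1) x \<le> D * cube_mass w k
      y"
    using cube_mass_doubling[OF w] by blast
  obtain \<beta> where \<beta>: "0 < \<beta>" "\<beta> < 1" and rev: "\<And>k x. cube_mass w k x \<le> \<beta> * cube_mass w (k + 1) x"
    using cube_mass_reverse_doubling[OF w] by blast
  note mpos = cube_mass_pos[OF w]
  obtain C where C: "0 < C" and loc: "\<And>k y. (\<integral>\<^sup>+x\<in>scale_cube k y. ennreal (cube_mass w k x powr - e * cube_dev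
      b k x powr s * w x) \<partial>lebesgue)
     \<le> ennreal (C * cube_mass w k y powr (1 - e))"
    using local_integral_bound[OF w b s] by blast
  define \<delta> where "\<delta> = \<bar>1 - e\<bar>"
  have \<delta>: "0 < \<delta>" using e by (simp add: \<delta>_def)
  have b1: "\<beta> powr \<delta> < 1" using \<beta> \<delta> powr_less_mono2[of \<delta> \<beta> 1] by simp
  \<comment> \<open>The selection is made by the mass at x but the sum is taken with the mass at y;
    the threshold is loosened by the doubling constant, upwards or downwards according to the
    side.\<close>
  define m' where "m' m = (if e < 1 then D * m else m / D)" for m
  define R where "R m k y = (if mass_selected e (m' m) (cube_mass w k y) then ennreal (cube_mass w k y powr (1
      - e)) else 0)" for m k y
  define A where "A = D powr \<delta> / (1 - \<beta> powr \<delta>)"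
  have A: "0 < A" using D b1 by (simp add: A_def)
  have chain: "(\<integral>\<^sup>+k. R m k y \<partial>count_space UNIV) \<le> ennreal (A * m powr (1 - e))"
    if m: "0 < m" for m y
  proof (cases "e < 1")
    case True
    then have e1: "\<delta> = 1 - e" by (simp add: \<delta>_def)
    have "(\<integral>\<^sup>+k. (if cube_mass w k y \<le> D * m then ennreal (cube_mass w k y powr (1 - e)) else 0) \<partial>count_space
        UNIV) \<le> ennreal ((D * m) powr (1 - e) / (1 - \<beta> powr (1 - e)))"
      using D m by (intro chain_sum_below \<beta> mpos rev \<delta>[unfolded e1]) auto
    then show ?thesis using True by (simp add: R_def mass_selected_def m'_def A_def \<delta>_def powr_mult)
  next
    case False
    have "(\<integral>\<^sup>+k. (if m / D \<le> cube_mass w k y then ennreal (cube_mass w k y powr - \<delta>) else 0) \<partial>count_space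
        UNIV) \<le> ennreal ((m / D) powr - \<delta> / (1 - \<beta> powr \<delta>))"
      using D m by (intro chain_sum_above \<beta> mpos rev \<delta>) auto
    note bound = this
    have neg: "- \<delta> = 1 - e" using False by (simp add: \<delta>_def)
    have "(m / D) powr - \<delta> = D powr \<delta> * m powr - \<delta>" using D m by (simp add: powr_divide powr_minus
        divide_simps)
    then show ?thesis using False bound[unfolded neg] unfolding neg by (simp add: R_def mass_selected_def
        m'_def A_def)
  qed
  show ?thesis
  proof (intro exI[of _ "C * A"] conjI ballI allI impI)
    show "0 < C * A" using C A by simp
    fix f k0 and x0 :: "real ^ 'n" and m :: real assume f: "f \<in> Lp_loc p \<nu>" and m: "0 < m"
    have fm[measurable]: "f \<in> borel_measurable lebesgue" using f by (simp add: Lp_loc_def)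
    define Z where "Z = scale_cube k0 x0"
    define Z' where "Z' = scale_cube (k0 + 1) x0"
    have [measurable]: "Z \<in> sets lebesgue" "Z' \<in> sets lebesgue" by (auto simp: Z_def Z'_def)
    define E where "E y = ennreal (\<bar>f y\<bar> powr p * \<nu> y) * indicator Z' y" for y
    have [measurable]: "E \<in> borel_measurable lebesgue" unfolding E_def by measurable
    define \<Phi> where "\<Phi> k x = ennreal (cube_mass w k x powr - e * cube_dev b k x powr s * w x)" for k x
    have [measurable]: "\<Phi> k \<in> borel_measurable lebesgue" for k unfolding \<Phi>_def by measurable
    have [measurable]: "Measurable.pred lebesgue (\<lambda>x. mass_selected e m (cube_mass w k x))" for k m
      unfolding mass_selected_def by measurable
    have [measurable]: "R m k \<in> borel_measurable lebesgue" for m k unfolding R_def by measurable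
    have step: "(\<integral>\<^sup>+x\<in>Z. (if k \<le> k0 \<and> mass_selected e m (cube_mass w k x) then \<Phi> k x * ennreal (cube_energy p
        \<nu> f k x) else 0) \<partial>lebesgue)
      \<le> (\<integral>\<^sup>+y. E y * (ennreal C * R m k y) \<partial>lebesgue)" for k
    proof (cases "k \<le> k0")
      case False
      then show ?thesis by simp
    next
      case True
      define G where "G x = (if mass_selected e m (cube_mass w k x) then \<Phi> k x else 0) * indicator Z x" for x
      have [measurable]: "G \<in> borel_measurable lebesgue" unfolding G_def by measurable
      have "(\<integral>\<^sup>+x\<in>Z. (if k \<le> k0 \<and> mass_selected e m (cube_mass w k x) then \<Phi> k x * ennreal (cube_energy p \<nu> f
          k x) else 0) \<partial>lebesgue)
         = (\<integral>\<^sup>+x. G x * (\<integral>\<^sup>+y\<in>scale_cube k x. E y \<partial>lebesgue) \<partial>lebesgue)"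
      proof (intro nn_integral_cong)
        fix x
        have "ennreal (cube_energy p \<nu> f k x) = (\<integral>\<^sup>+y\<in>scale_cube k x. E y \<partial>lebesgue)" if x: "x \<in> Z"
        proof -
          \<comment> \<open>Truncating f to the doubled cube does not change these energies, which
            makes the localised \<open>E\<close> independent of x and k.\<close>
          have "scale_cube k x \<subseteq> Z'" unfolding Z'_def using x True unfolding Z_def by (intro
              scale_cube_subset_Suc_le)
          then show ?thesis unfolding Lp_loc_energy[OF f, symmetric] E_def
            by (intro nn_integral_cong) (auto simp: indicator_def)
        qed
        then show "(if k \<le> k0 \<and> mass_selected e m (cube_mass w k x) then \<Phi> k x * ennreal (cube_energy p \<nu> f k
            x) else 0) * indicator Z x
          = G x * (\<integral>\<^sup>+y\<in>scale_cube k x. E y \<partial>lebesgue)"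
          using True by (auto simp: G_def indicator_def)
      qed
      also have "\<dots> = (\<integral>\<^sup>+y. E y * (\<integral>\<^sup>+x\<in>scale_cube k y. G x \<partial>lebesgue) \<partial>lebesgue)"
        by (rule nn_integral_cube_swap) measurable
      also have "\<dots> \<le> (\<integral>\<^sup>+y. E y * (ennreal C * R m k y) \<partial>lebesgue)"
      proof (intro nn_integral_mono mult_left_mono)
        fix y
        have sel: "mass_selected e (m' m) (cube_mass w k y)" if x: "x \<in> scale_cube k y" "mass_selected e m
            (cube_mass w k x)" for x
        proof -
          have x': "y \<in> scale_cube k x" using x scale_cube_sym by blast
          have "cube_mass w k x \<le> D * cube_mass w k y" "cube_mass w k y \<le> D * cube_mass w k x"
            using dbl[OF x(1)] dbl[OF x'] cube_mass_mono[OF wt, of k "k + 1" x] cube_mass_mono[OF wt, of k "k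
                + 1" y]
            by linarith+
          then show ?thesis using x(2) D unfolding mass_selected_def m'_def
            by (auto simp: divide_le_eq mult.commute split: if_splits intro: order_trans mult_left_mono)
        qed
        show "(\<integral>\<^sup>+x\<in>scale_cube k y. G x \<partial>lebesgue) \<le> ennreal C * R m k y"
        proof (cases "mass_selected e (m' m) (cube_mass w k y)")
          case True
          have "(\<integral>\<^sup>+x\<in>scale_cube k y. G x \<partial>lebesgue) \<le> (\<integral>\<^sup>+x\<in>scale_cube k y. \<Phi> k x \<partial>lebesgue)"
            by (intro nn_integral_mono) (auto simp: G_def indicator_def)
          also have "\<dots> \<le> ennreal (C * cube_mass w k y powr (1 - e))" unfolding \<Phi>_def by (rule loc)
          finally show ?thesis using True C by (simp add: R_def ennreal_mult)
        next
          case False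
          have "(\<integral>\<^sup>+x\<in>scale_cube k y. G x \<partial>lebesgue) = (\<integral>\<^sup>+x. 0 \<partial>(lebesgue :: (real ^ 'n) measure))"
            using sel False by (intro nn_integral_cong) (auto simp: G_def indicator_def)
          then show ?thesis by simp
        qed
      qed simp
      finally show ?thesis .
    qed
    have "(\<integral>\<^sup>+k. (\<integral>\<^sup>+x\<in>Z. (if k \<le> k0 \<and> mass_selected e m (cube_mass w k x) then \<Phi> k x * ennreal (cube_energy p
        \<nu> f k x) else 0) \<partial>lebesgue) \<partial>count_space UNIV)
      \<le> (\<integral>\<^sup>+k. (\<integral>\<^sup>+y. E y * (ennreal C * R m k y) \<partial>lebesgue) \<partial>count_space UNIV)"
      by (intro nn_integral_mono step)
    also have "\<dots> = (\<integral>\<^sup>+y. (\<integral>\<^sup>+k. E y * (ennreal C * R m k y) \<partial>count_space UNIV) \<partial>lebesgue)"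
      by (rule nn_integral_count_space_nn_integral[symmetric]) auto
    also have "\<dots> = (\<integral>\<^sup>+y. E y * (ennreal C * (\<integral>\<^sup>+k. R m k y \<partial>count_space UNIV)) \<partial>lebesgue)"
      by (simp add: nn_integral_cmult)
    also have "\<dots> \<le> (\<integral>\<^sup>+y. E y * (ennreal C * ennreal (A * m powr (1 - e))) \<partial>lebesgue)"
      by (intro nn_integral_mono mult_left_mono chain m) auto
    also have "\<dots> = (\<integral>\<^sup>+y. E y \<partial>lebesgue) * (ennreal C * ennreal (A * m powr (1 - e)))"
      by (intro nn_integral_multc) measurable
    also have "(\<integral>\<^sup>+y. E y \<partial>lebesgue) = ennreal (cube_energy p \<nu> f (k0 + 1) x0)"
      unfolding E_def Z'_def by (rule Lp_loc_energy[OF f])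
    also have "ennreal (cube_energy p \<nu> f (k0 + 1) x0) * (ennreal C * ennreal (A * m powr (1 - e))) = ennreal
        (C * A * m powr (1 - e) * cube_energy p \<nu> f (k0 + 1) x0)"
      using C A by (simp add: cube_energy_def mult_ac flip: ennreal_mult)
    finally show "(\<integral>\<^sup>+k. (\<integral>\<^sup>+x\<in>scale_cube k0 x0. selected_piece p w \<nu> b f e s m k0 k x \<partial>lebesgue) \<partial>count_space
        UNIV)
     \<le> ennreal (C * A * m powr (1 - e) * cube_energy p \<nu> f (k0 + 1) x0)" unfolding Z_def \<Phi>_def
         selected_piece_def .
  qed
qed

section \<open>The weak-type estimate\<close>

text \<open>The weights decay geometrically away from the scale at which the mass passes
  \<open>m\<close>, so their sum is bounded independently of \<open>m\<close> and of the
  point.\<close>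

lemma threshold_sum:
  fixes u :: "int \<Rightarrow> real"
  assumes \<beta>: "0 < \<beta>" "\<beta> < 1" and u: "\<And>k. 0 < u k" "\<And>k. u k \<le> \<beta> * u (k + 1)"
    and \<epsilon>: "0 < \<epsilon>" and m: "0 < m"
  shows "(\<integral>\<^sup>+k. ennreal (if u k \<le> m then (u k / m) powr \<epsilon> else (m / u k) powr \<epsilon>) \<partial>count_space UNIV) \<le> ennreal
      (2 / (1 - \<beta> powr \<epsilon>))"
proof -
  have b1: "\<beta> powr \<epsilon> < 1" using \<beta> \<epsilon> powr_less_mono2[of \<epsilon> \<beta> 1] by simp
  \<comment> \<open>The term \<open>0 * 0\<close> brings the sum into the three-term shape of
    \<open>nn_integral_linear3\<close>.\<close>
  have "(\<integral>\<^sup>+k. ennreal (if u k \<le> m then (u k / m) powr \<epsilon> else (m / u k) powr \<epsilon>) \<partial>count_space UNIV)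
    \<le> (\<integral>\<^sup>+k. ennreal (m powr - \<epsilon>) * (if u k \<le> m then ennreal (u k powr \<epsilon>) else 0) + ennreal (m powr \<epsilon>) * (if m
        \<le> u k then ennreal (u k powr - \<epsilon>) else 0) + 0 * 0 \<partial>count_space UNIV)"
  proof (intro nn_integral_mono)
    fix k
    have "(u k / m) powr \<epsilon> = m powr - \<epsilon> * u k powr \<epsilon>" "(m / u k) powr \<epsilon> = m powr \<epsilon> * u k powr - \<epsilon>"
      using u(1)[of k] m by (simp_all add: powr_divide powr_minus divide_simps)
    then show "ennreal (if u k \<le> m then (u k / m) powr \<epsilon> else (m / u k) powr \<epsilon>) \<le>
      ennreal (m powr - \<epsilon>) * (if u k \<le> m then ennreal (u k powr \<epsilon>) else 0) + ennreal (m powr \<epsilon>) * (if m \<le> u k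
          then ennreal (u k powr - \<epsilon>) else 0) + 0 * 0"
      by (auto simp: ennreal_mult)
  qed
  also have "\<dots> = ennreal (m powr - \<epsilon>) * (\<integral>\<^sup>+k. (if u k \<le> m then ennreal (u k powr \<epsilon>) else 0) \<partial>count_space
      UNIV)
     + ennreal (m powr \<epsilon>) * (\<integral>\<^sup>+k. (if m \<le> u k then ennreal (u k powr - \<epsilon>) else 0) \<partial>count_space UNIV) + 0 *
         (\<integral>\<^sup>+k. 0 \<partial>count_space (UNIV :: int set))"
    by (rule nn_integral_linear3) auto
  also have "\<dots> \<le> ennreal (m powr - \<epsilon>) * ennreal (m powr \<epsilon> / (1 - \<beta> powr \<epsilon>)) + ennreal (m powr \<epsilon>) * ennreal (m
      powr - \<epsilon> / (1 - \<beta> powr \<epsilon>)) + 0"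
    by (intro add_mono mult_left_mono chain_sum_below chain_sum_above assms) auto
  also have "\<dots> = ennreal (m powr - \<epsilon> * (m powr \<epsilon> / (1 - \<beta> powr \<epsilon>)) + m powr \<epsilon> * (m powr - \<epsilon> / (1 - \<beta> powr
      \<epsilon>)))"
    using b1 by (simp flip: ennreal_mult ennreal_plus)
  also have "m powr - \<epsilon> * (m powr \<epsilon> / (1 - \<beta> powr \<epsilon>)) + m powr \<epsilon> * (m powr - \<epsilon> / (1 - \<beta> powr \<epsilon>)) = 2 / (1 - \<beta>
      powr \<epsilon>)"
    using m by (simp add: powr_minus divide_simps)
  finally show ?thesis .
qed

definition dyadic_majorant :: "real \<Rightarrow> real \<Rightarrow> (real ^ 'n \<Rightarrow> real) \<Rightarrow> (real ^ 'n \<Rightarrow> real) \<Rightarrow> (real ^ 'n \<Rightarrow> real) \<Rightarrow>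
    (real ^ 'n \<Rightarrow> real) \<Rightarrow> real ^ 'n \<Rightarrow> ennreal" where
  "dyadic_majorant p q w \<nu> b f x = (\<integral>\<^sup>+k. ennreal (dyadic_piece p q w \<nu> b f k x) \<partial>count_space UNIV)"

lemma dyadic_majorant_measurable:
  assumes w: "weight w" and \<nu>: "weight \<nu>" and b: "locally_integrable b" and [measurable]: "f \<in>
      borel_measurable lebesgue"
  shows "dyadic_majorant p q w \<nu> b f \<in> borel_measurable lebesgue"
proof -
  note [measurable] = cube_mass_measurable[OF w] cube_dev_measurable[OF b] cube_energy_measurable[OF \<nu>]
  have [measurable]: "dyadic_piece p q w \<nu> b f k \<in> borel_measurable lebesgue" for k
    unfolding dyadic_piece_def[abs_def] by measurable
  have "dyadic_majorant p q w \<nu> b f = (\<lambda>x. \<Sum>n. ennreal (dyadic_piece p q w \<nu> b f (int_decode n) x))"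
    unfolding dyadic_majorant_def nn_integral_count_space_nat[symmetric]
    by (intro ext nn_integral_bij_count_space[symmetric]) (rule bij_int_decode)
  also have "\<dots> \<in> borel_measurable lebesgue" by measurable
  finally show ?thesis .
qed

lemma cube_energy_mono_set:
  assumes f: "f \<in> Lp_loc p \<nu>" and "scale_cube j x \<subseteq> scale_cube k y"
  shows "cube_energy p \<nu> f j x \<le> cube_energy p \<nu> f k y"
proof -
  have "ennreal (cube_energy p \<nu> f j x) \<le> ennreal (cube_energy p \<nu> f k y)"
    unfolding Lp_loc_energy[OF f, symmetric] using assms(2) by (intro nn_integral_mono) (auto simp:
        indicator_def)
  then show ?thesis by (simp add: cube_energy_def)
qed

lemma cube_energy_nonneg [simp]: "0 \<le> cube_energy p \<nu> f k x"
  by (simp add: cube_energy_def)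

text \<open>Pigeonhole principle: if no piece exceeded its share of \<open>\<sigma>\<close>, the
  shares would add up to at most \<open>\<sigma>\<close>.\<close>

lemma dyadic_majorant_threshold:
  fixes w :: "real ^ 'n \<Rightarrow> real"
  assumes \<beta>: "0 < \<beta>" "\<beta> < 1" and rev: "\<And>k x. cube_mass w k x \<le> \<beta> * cube_mass w (k + 1) x" and pos: "\<And>k x. 0 <
      cube_mass w k x"
    and \<epsilon>: "0 < \<epsilon>" and m: "0 < m" and \<sigma>: "0 < \<sigma>" and T: "ennreal \<sigma> < dyadic_majorant p q w \<nu> b f x"
  shows "\<exists>k. \<sigma> / (2 / (1 - \<beta> powr \<epsilon>)) * (if cube_mass w k x \<le> m then (cube_mass w k x / m) powr \<epsilon> else (m /
      cube_mass w k x) powr \<epsilon>)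
     < dyadic_piece p q w \<nu> b f k x"
proof (rule ccontr)
  have b1: "\<beta> powr \<epsilon> < 1" using \<beta> \<epsilon> powr_less_mono2[of \<epsilon> \<beta> 1] by simp
  define A where "A = 2 / (1 - \<beta> powr \<epsilon>)"
  have A: "0 < A" using b1 by (simp add: A_def)
  define \<tau> where "\<tau> k = (if cube_mass w k x \<le> m then (cube_mass w k x / m) powr \<epsilon> else (m / cube_mass w k x)
      powr \<epsilon>)" for k
  have \<tau>0: "0 \<le> \<tau> k" for k by (simp add: \<tau>_def)
  assume "\<not> ?thesis"
  then have le: "dyadic_piece p q w \<nu> b f k x \<le> \<sigma> / A * \<tau> k" for k unfolding A_def \<tau>_def by (meson not_less)
  have "dyadic_majorant p q w \<nu> b f x \<le> (\<integral>\<^sup>+k. ennreal (\<sigma> / A) * ennreal (\<tau> k) \<partial>count_space UNIV)"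
    unfolding dyadic_majorant_def
  proof (intro nn_integral_mono)
    fix k
    have "ennreal (dyadic_piece p q w \<nu> b f k x) \<le> ennreal (\<sigma> / A * \<tau> k)" by (rule ennreal_leI[OF le])
    then show "ennreal (dyadic_piece p q w \<nu> b f k x) \<le> ennreal (\<sigma> / A) * ennreal (\<tau> k)"
      using \<sigma> A \<tau>0 by (subst ennreal_mult[symmetric]) auto
  qed
  also have "\<dots> = ennreal (\<sigma> / A) * (\<integral>\<^sup>+k. ennreal (\<tau> k) \<partial>count_space UNIV)" by (intro nn_integral_cmult) auto
  also have "\<dots> \<le> ennreal (\<sigma> / A) * ennreal A"
    unfolding \<tau>_def A_def by (intro mult_left_mono threshold_sum \<beta> pos rev \<epsilon> m) auto
  also have "\<dots> = ennreal \<sigma>" using \<sigma> A by (simp flip: ennreal_mult)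
  finally show False using T by simp
qed

text \<open>Chebyshev's inequality before integration: the quotient of a piece by its threshold is
  at least 1, hence so is its power \<open>r\<close>. The sign of \<open>e\<close> is free, so that
  both sides of \<open>m\<close> are covered.\<close>

lemma threshold_power:
  fixes u m \<sigma> A r g d e q :: real
  assumes pos: "0 < u" "0 < m" "0 < \<sigma>" "0 < A" "0 < r"
    and le: "\<sigma> / A * (m / u) powr e \<le> u powr (- 1 / q) * g * d"
  shows "1 \<le> (A / \<sigma>) powr r * m powr - (e * r) * (u powr (e * r - r / q) * d powr r * g powr r)"
proof -
  define y where "y = u powr (- 1 / q) * g * d"
  have inv: "(m / u) powr e * (u / m) powr e = 1" using pos by (simp flip: powr_mult)
  have "(\<sigma> / A * (m / u) powr e) * ((A / \<sigma>) * (u / m) powr e) \<le> y * ((A / \<sigma>) * (u / m) powr e)"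
    using le pos unfolding y_def by (intro mult_right_mono) auto
  moreover have "(\<sigma> / A * (m / u) powr e) * ((A / \<sigma>) * (u / m) powr e) = (m / u) powr e * (u / m) powr e"
    using pos(3,4) by simp
  ultimately have "1 powr r \<le> (y * ((A / \<sigma>) * (u / m) powr e)) powr r"
    using pos(5) inv by (intro powr_mono2) auto
  also have "\<dots> = (A / \<sigma>) powr r * m powr - (e * r) * ((u powr (e * r) * u powr (- r / q)) * d powr r * g powr
      r)"
    using pos by (simp add: y_def powr_mult powr_powr powr_divide powr_minus divide_simps)
  also have "u powr (e * r) * u powr (- r / q) = u powr (e * r - r / q)" by (simp flip: powr_add)
  finally show ?thesis by simp
qed

lemma ennreal_le_scaled:
  fixes c X v :: real
  assumes "1 \<le> c * X" "0 \<le> v" "0 < c"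
  shows "ennreal v \<le> ennreal c * ennreal (X * v)"
proof -
  have "v \<le> c * X * v" using assms by (simp add: mult_le_cancel_right1)
  then have "ennreal v \<le> ennreal (c * (X * v))" by (intro ennreal_leI) (simp add: mult.assoc)
  then show ?thesis using assms(3) by (simp add: ennreal_mult')
qed

lemma weak_type_estimate:
  fixes w b \<nu> :: "real ^ 'n \<Rightarrow> real"
  assumes w: "w \<in> A_infinity" and \<nu>: "weight \<nu>" and b: "bmo_bound b M"
    and p: "1 < p" and pq: "p < q" and \<kappa>: "0 < \<kappa>" "\<kappa> < p / q"
  shows "\<exists>C>0. \<forall>f\<in>Lp_loc p \<nu>. \<forall>N>0. (\<forall>k x. cube_energy p \<nu> f k x \<le> N powr p * cube_mass w k x powr \<kappa>) \<longrightarrow>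
    (\<forall>k0 x0 \<sigma>. 0 < \<sigma> \<longrightarrow> weight_measure w {x \<in> scale_cube k0 x0. ennreal \<sigma> < dyadic_majorant p q w \<nu> b f x}
       \<le> ennreal (C * (N * cube_mass w k0 x0 powr (\<kappa> / p) / \<sigma>) powr q))"
proof -
  have wt: "weight w" by (rule A_infinity_weight[OF w])
  have w0: "0 \<le> w x" for x using wt by (simp add: weight_def)
  have bl: "locally_integrable b" using b by (auto simp: bmo_bound_def)
  note [measurable] = weight_measurable[OF wt] cube_mass_measurable[OF wt] cube_dev_measurable[OF bl]
      cube_energy_measurable[OF \<nu>]
  note pos = cube_mass_pos[OF w]
  obtain D where D: "1 \<le> D" and dbl: "\<And>k x y. y \<in> scale_cube k x \<Longrightarrow> cube_mass w (k + 1) x \<le> D * cube_mass w k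
      y"
    using cube_mass_doubling[OF w] by blast
  obtain \<beta> where \<beta>: "0 < \<beta>" "\<beta> < 1" and rev: "\<And>k x. cube_mass w k x \<le> \<beta> * cube_mass w (k + 1) x"
    using cube_mass_reverse_doubling[OF w] by blast
  have p0: "0 < p" and q0: "0 < q" using p pq by auto
  \<comment> \<open>\<open>\<eta>\<close> is the decay in the mass once the Morrey bound has been
    inserted, \<open>1 / p - 1 / q\<close> the gain available when the mass is small. The loss
    \<open>\<epsilon>\<close> from the thresholds must stay below both.\<close>
  define \<eta> where "\<eta> = 1 / q - \<kappa> / p"
  have \<eta>: "0 < \<eta>" using \<kappa> p0 q0 by (simp add: \<eta>_def field_simps)
  have pq': "0 < 1 / p - 1 / q" using p0 pq by (simp add: field_simps)
  define \<epsilon> where "\<epsilon> = min \<eta> (1 / p - 1 / q) / 2"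
  have \<epsilon>: "0 < \<epsilon>" "\<epsilon> < \<eta>" "\<epsilon> < 1 / p - 1 / q" using \<eta> pq' by (auto simp: \<epsilon>_def)
  \<comment> \<open>At least \<open>p\<close>, so that surplus energy factors carry a nonnegative
    exponent, and large enough that the decay on big cubes is at least 2, beyond the 1 lost by
    integrating against w.\<close>
  define s where "s = max p (2 / (\<eta> - \<epsilon>))"
  have s: "0 < s" "p \<le> s" "2 \<le> s * (\<eta> - \<epsilon>)"
  proof -
    show "p \<le> s" "0 < s" using p0 by (auto simp: s_def)
    have "2 / (\<eta> - \<epsilon>) \<le> s" by (simp add: s_def)
    then show "2 \<le> s * (\<eta> - \<epsilon>)" using \<epsilon> by (simp add: field_simps)
  qed
  define A where "A = 2 / (1 - \<beta> powr \<epsilon>)"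
  have "\<beta> powr \<epsilon> < 1" using \<beta> \<epsilon> powr_less_mono2[of \<epsilon> \<beta> 1] by simp
  then have A: "0 < A" by (simp add: A_def)
  \<comment> \<open>\<open>e1\<close>, \<open>e2\<close> and \<open>e3\<close> are the exponents of
    the inverse mass for small masses, for large masses at scales up to \<open>k0\<close>, and for
    larger cubes after the Morrey bound. Summability needs the first below 1 and the others above
    1.\<close>
  define e1 where "e1 = p / q + \<epsilon> * p"
  have e1: "e1 < 1" using \<epsilon>(3) p0 q0 unfolding e1_def by (simp add: field_simps)
  define e2 where "e2 = s / q - \<epsilon> * s"
  define e3 where "e3 = s * (\<eta> - \<epsilon>)"
  have e3: "2 \<le> e3" using s by (simp add: e3_def)
  have "e3 \<le> e2" using s \<kappa> p0 unfolding e3_def e2_def \<eta>_def by (simp add: algebra_simps)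
  then have e2: "1 < e2" using e3 by simp
  define B3 where "B3 = 1 / (1 - \<beta> powr (e3 - 1))"
  have "\<beta> powr (e3 - 1) < 1" using \<beta> e3 powr_less_mono2[of "e3 - 1" \<beta> 1] by simp
  then have B3: "0 < B3" by (simp add: B3_def)
  obtain C1 where C1: "0 < C1" and L1: "\<And>f k0 x0 m. f \<in> Lp_loc p \<nu> \<Longrightarrow> 0 < m \<Longrightarrow>
    (\<integral>\<^sup>+k. (\<integral>\<^sup>+x\<in>scale_cube k0 x0. selected_piece p w \<nu> b f e1 p m k0 k x \<partial>lebesgue) \<partial>count_space UNIV)
     \<le> ennreal (C1 * m powr (1 - e1) * cube_energy p \<nu> f (k0 + 1) x0)"
    using local_pieces_bound[OF w \<nu> b p0 less_imp_neq[OF e1], where p = p] by blast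
  obtain C2 where C2: "0 < C2" and L2: "\<And>f k0 x0 m. f \<in> Lp_loc p \<nu> \<Longrightarrow> 0 < m \<Longrightarrow>
    (\<integral>\<^sup>+k. (\<integral>\<^sup>+x\<in>scale_cube k0 x0. selected_piece p w \<nu> b f e2 s m k0 k x \<partial>lebesgue) \<partial>count_space UNIV)
     \<le> ennreal (C2 * m powr (1 - e2) * cube_energy p \<nu> f (k0 + 1) x0)"
    using local_pieces_bound[OF w \<nu> b s(1) less_imp_neq[OF e2, symmetric], where p = p] by blast
  obtain C3 where C3: "0 < C3" and L3: "\<And>k y. (\<integral>\<^sup>+x\<in>scale_cube k y. ennreal (cube_mass w k x powr - e3 *
      cube_dev b k x powr s * w x) \<partial>lebesgue)
     \<le> ennreal (C3 * cube_mass w k y powr (1 - e3))"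
    using local_integral_bound[OF w b s(1), of e3] by blast
  \<comment> \<open>The 1 covers the case in which the mass of the cube is at most \<open>m\<close>;
    the other summands belong to the three families of scales.\<close>
  define C where "C = 1 + C1 * A powr p * D powr \<kappa> + C2 * A powr s * D powr (\<kappa> * s / p) + C3 * A powr s * B3"
  have Cparts: "0 < C1 * A powr p * D powr \<kappa>" "0 < C2 * A powr s * D powr (\<kappa> * s / p)" "0 < C3 * A powr s *
      B3"
    using C1 C2 C3 A D B3 by auto
  then have C: "1 < C" by (simp add: C_def)
  show ?thesis
  proof (rule exI[of _ C], intro conjI ballI allI impI)
    show "0 < C" using C by simp
    fix f N k0 and x0 :: "real ^ 'n" and \<sigma> :: real
    assume f: "f \<in> Lp_loc p \<nu>" and N: "0 < N" and en: "\<forall>k x. cube_energy p \<nu> f k x \<le> N powr p * cube_mass w k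
        x powr \<kappa>"
      and \<sigma>: "0 < \<sigma>"
    have fm[measurable]: "f \<in> borel_measurable lebesgue" using f by (simp add: Lp_loc_def)
    define Z where "Z = scale_cube k0 x0"
    have Zm[measurable]: "Z \<in> sets lebesgue" by (simp add: Z_def)
    define U where "U = cube_mass w k0 x0"
    have U: "0 < U" unfolding U_def by (rule pos)
    define t where "t = N * U powr (\<kappa> / p) / \<sigma>"
    have t: "0 < t" using N U \<sigma> by (simp add: t_def)
    define m where "m = t powr q"
    have m: "0 < m" using t by (simp add: m_def)
    have tm: "t = m powr (1 / q)" using t q0 by (simp add: m_def powr_powr)
    define S where "S = {x \<in> Z. ennreal \<sigma> < dyadic_majorant p q w \<nu> b f x}"
    have [measurable]: "dyadic_majorant p q w \<nu> b f \<in> borel_measurable lebesgue"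
      by (rule dyadic_majorant_measurable[OF wt \<nu> bl fm])
    have "weight_measure w S \<le> ennreal (C * m)"
    \<comment> \<open>Since \<open>m\<close> is the desired bound, a cube of mass at most
      \<open>m\<close> satisfies the estimate by inclusion.\<close>
    proof (cases "U \<le> m")
      case True
      have "weight_measure w S \<le> weight_measure w Z" by (rule weight_measure_mono) (auto simp: S_def)
      also have "\<dots> = ennreal U" unfolding Z_def U_def by (rule cube_mass_eq[OF wt])
      also have "U \<le> C * m" using True C m by (simp add: order_trans[OF _ mult_right_mono[of 1 C m,
          simplified]])
      finally show ?thesis by (simp add: ennreal_leI order_trans)
    next
      case False
      then have mU: "m < U" by simp
      define EZ where "EZ = cube_energy p \<nu> f (k0 + 1) x0"
      \<comment> \<open>The Morrey bound on the doubled cube with \<open>N\<close> expressed through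
        \<open>t\<close> and \<open>\<sigma>\<close>: the powers of \<open>U\<close> cancel.\<close>
      define EB where "EB = D powr \<kappa> * \<sigma> powr p * t powr p"
      have EB: "0 < EB" using D \<sigma> t by (simp add: EB_def)
      have EZ: "EZ \<le> EB"
      proof -
        have "EZ \<le> N powr p * cube_mass w (k0 + 1) x0 powr \<kappa>" unfolding EZ_def using en by blast
        also have "\<dots> \<le> N powr p * (D * U) powr \<kappa>"
          using dbl[OF scale_cube_self, of k0 x0] pos[of "k0 + 1" x0] \<kappa> unfolding U_def
          by (intro mult_left_mono powr_mono2) auto
        also have "N = t * \<sigma> * U powr (- \<kappa> / p)" using U \<sigma> by (simp add: t_def powr_minus divide_simps)
        also have "(t * \<sigma> * U powr (- \<kappa> / p)) powr p * (D * U) powr \<kappa> = EB"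
        proof -
          have e: "(t * \<sigma> * U powr (- \<kappa> / p)) powr p = t powr p * \<sigma> powr p * U powr - \<kappa>"
            using p0 by (simp add: powr_mult powr_powr)
          have "(t * \<sigma> * U powr (- \<kappa> / p)) powr p * (D * U) powr \<kappa> = EB * (U powr - \<kappa> * U powr \<kappa>)"
            by (subst e, subst powr_mult) (simp only: EB_def mult_ac)
          also have "U powr - \<kappa> * U powr \<kappa> = 1" using U by (simp flip: powr_add)
          finally show ?thesis by simp
        qed
        finally show ?thesis .
      qed
      \<comment> \<open>The constants of \<open>threshold_power\<close>. The sign of the power of
        \<open>m\<close> in \<open>c1\<close> is opposite because the threshold below
        \<open>m\<close> corresponds to the exponent \<open>- \<epsilon>\<close>; \<open>c2\<close>
        contains the surplus energy and \<open>c3\<close> the Morrey constant.\<close>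
      define c1 where "c1 = (A / \<sigma>) powr p * m powr (\<epsilon> * p)"
      define c2 where "c2 = (A / \<sigma>) powr s * m powr - (\<epsilon> * s) * EB powr (s / p - 1)"
      define c3 where "c3 = (A * N / \<sigma>) powr s * m powr - (\<epsilon> * s)"
      have c: "0 < c1" "0 < c2" "0 < c3" using A \<sigma> m EB N by (auto simp: c1_def c2_def c3_def)
      define F1 where "F1 = selected_piece p w \<nu> b f e1 p m k0"
      define F2 where "F2 = selected_piece p w \<nu> b f e2 s m k0"
      define F3 where "F3 k x = (if k0 < k then ennreal (cube_mass w k x powr - e3 * cube_dev b k x powr s * w
          x) else 0)" for k x
      have [measurable]: "F1 k \<in> borel_measurable lebesgue" "F2 k \<in> borel_measurable lebesgue" for k
        unfolding F1_def F2_def by (rule selected_piece_measurable[OF wt \<nu> bl fm])+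
      have [measurable]: "F3 k \<in> borel_measurable lebesgue" for k unfolding F3_def by measurable
      have point: "ennreal (w x) * indicator S x \<le>
          (\<integral>\<^sup>+k. ennreal c1 * (F1 k x * indicator Z x) + ennreal c2 * (F2 k x * indicator Z x) + ennreal c3 *
              (F3 k x * indicator Z x) \<partial>count_space UNIV)" for x
      proof (cases "x \<in> S")
        case False
        then show ?thesis by simp
      next
        case True
        then have xZ: "x \<in> Z" and T: "ennreal \<sigma> < dyadic_majorant p q w \<nu> b f x" by (auto simp: S_def)
        obtain k where k: "\<sigma> / A * (if cube_mass w k x \<le> m then (cube_mass w k x / m) powr \<epsilon> else (m /
            cube_mass w k x) powr \<epsilon>) < dyadic_piece p q w \<nu> b f k x"
          using dyadic_majorant_threshold[OF \<beta> rev pos \<epsilon>(1) m \<sigma> T] unfolding A_def by blast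
        define u where "u = cube_mass w k x"
        define G where "G = cube_energy p \<nu> f k x"
        define d where "d = cube_dev b k x"
        have u: "0 < u" and d: "1 \<le> d" and G: "0 \<le> G" unfolding u_def d_def G_def by (auto simp: pos
            cube_dev_ge1)
        have a: "dyadic_piece p q w \<nu> b f k x = u powr (- 1 / q) * G powr (1 / p) * d"
          by (simp add: dyadic_piece_def u_def G_def d_def)
        have "ennreal (w x) \<le> ennreal c1 * F1 k x + ennreal c2 * F2 k x + ennreal c3 * F3 k x"
        proof (cases "k \<le> k0")
          case kk: True
          show ?thesis
          proof (cases "u \<le> m")
            case um: True
            have "(m / u) powr - \<epsilon> = (u / m) powr \<epsilon>"
              using u m by (simp add: powr_divide powr_minus divide_simps)
            then have "\<sigma> / A * (m / u) powr - \<epsilon> \<le> u powr (- 1 / q) * G powr (1 / p) * d"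
              using k a um by (simp add: u_def)
            note threshold_power[OF u m \<sigma> A p0 this]
            also have "- \<epsilon> * p - p / q = - e1" by (simp add: e1_def)
            finally have "1 \<le> c1 * (u powr - e1 * d powr p * G)" using p0 G by (simp add: c1_def powr_powr)
            then have "ennreal (w x) \<le> ennreal c1 * ennreal (u powr - e1 * d powr p * G * w x)"
              using w0 c by (intro ennreal_le_scaled) auto
            also have "\<dots> = ennreal c1 * F1 k x"
              using kk um e1 G w0[of x] unfolding F1_def selected_piece_def mass_selected_def u_def G_def
                  d_def
              by (simp add: mult_ac flip: ennreal_mult)
            finally show ?thesis by (simp add: add_increasing2 add.assoc)
          next
            case um: False
            then have "\<sigma> / A * (m / u) powr \<epsilon> \<le> u powr (- 1 / q) * G powr (1 / p) * d"
              using k a by (simp add: u_def)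
            note threshold_power[OF u m \<sigma> A s(1) this]
            also have "(G powr (1 / p)) powr s = G powr (s / p)" by (simp add: powr_powr)
            \<comment> \<open>Only one factor of the energy is kept, as linearity in
              \<open>selected_piece\<close> demands; the remaining power is bounded by the energy of
              the doubled cube.\<close>
            also have "(A / \<sigma>) powr s * m powr - (\<epsilon> * s) * (u powr (\<epsilon> * s - s / q) * d powr s * G powr (s /
                p)) \<le>
                (A / \<sigma>) powr s * m powr - (\<epsilon> * s) * (u powr (\<epsilon> * s - s / q) * d powr s * (EB powr (s / p - 1)
                    * G))"
            proof (intro mult_left_mono)
              have "scale_cube k x \<subseteq> scale_cube (k0 + 1) x0" using xZ kk unfolding Z_def by (intro
                  scale_cube_subset_Suc_le)
              then have "G \<le> EB" using cube_energy_mono_set[OF f] EZ unfolding G_def EZ_def by (meson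
                  order_trans)
              then have "G powr (s / p - 1) * G \<le> EB powr (s / p - 1) * G"
                using G s p0 by (intro mult_right_mono powr_mono2) auto
              then show "G powr (s / p) \<le> EB powr (s / p - 1) * G" using G by (cases "G = 0") (auto simp:
                  powr_diff)
            qed auto
            also have "\<epsilon> * s - s / q = - e2" by (simp add: e2_def)
            finally have "1 \<le> c2 * (u powr - e2 * d powr s * G)" by (simp add: c2_def mult_ac)
            then have "ennreal (w x) \<le> ennreal c2 * ennreal (u powr - e2 * d powr s * G * w x)"
              using w0 c by (intro ennreal_le_scaled) auto
            also have "\<dots> = ennreal c2 * F2 k x"
              using kk um e2 G w0[of x] unfolding F2_def selected_piece_def mass_selected_def u_def G_def
                  d_def
              by (simp add: mult_ac flip: ennreal_mult)
            finally show ?thesis by (simp add: add_increasing add_increasing2)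
          qed
        next
          case kk: False
          \<comment> \<open>From scale \<open>k0 + 1\<close> on, the cube around x contains
            \<open>Z\<close>. Its mass therefore exceeds \<open>m\<close>, and only the decaying
            branch of the threshold occurs.\<close>
          have "U \<le> u"
          proof -
            have "x0 \<in> scale_cube k0 x" using xZ scale_cube_sym unfolding Z_def by blast
            then have "scale_cube k0 x0 \<subseteq> scale_cube (k0 + 1) x" by (rule scale_cube_subset_Suc)
            moreover have "scale_cube (k0 + 1) x \<subseteq> scale_cube k x" using kk by (intro scale_cube_mono) auto
            ultimately show ?thesis unfolding U_def u_def by (intro cube_mass_mono_set[OF wt]) auto
          qed
          then have "\<sigma> / A * (m / u) powr \<epsilon> \<le> u powr (- 1 / q) * G powr (1 / p) * d"
            using k a mU by (simp add: u_def)
          also have "\<dots> \<le> u powr (- 1 / q) * (N * u powr (\<kappa> / p)) * d"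
          proof (intro mult_right_mono mult_left_mono)
            have "G powr (1 / p) \<le> (N powr p * u powr \<kappa>) powr (1 / p)"
              using en G p0 unfolding G_def u_def by (intro powr_mono2) auto
            also have "\<dots> = N * u powr (\<kappa> / p)" using N p0 by (simp add: powr_mult powr_powr)
            finally show "G powr (1 / p) \<le> N * u powr (\<kappa> / p)" .
          qed (use d in auto)
          finally have "\<sigma> / A * (m / u) powr \<epsilon> \<le> u powr (- 1 / q) * (N * u powr (\<kappa> / p)) * d" .
          note threshold_power[OF u m \<sigma> A s(1) this]
          also have "(N * u powr (\<kappa> / p)) powr s = N powr s * u powr (\<kappa> * s / p)" by (simp add: powr_mult
              powr_powr)
          finally have "1 \<le> c3 * ((u powr (\<epsilon> * s - s / q) * u powr (\<kappa> * s / p)) * d powr s)"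
            by (simp add: c3_def powr_mult powr_divide mult_ac)
          also have "u powr (\<epsilon> * s - s / q) * u powr (\<kappa> * s / p) = u powr - e3"
            by (simp add: e3_def \<eta>_def algebra_simps flip: powr_add)
          finally have "ennreal (w x) \<le> ennreal c3 * ennreal (u powr - e3 * d powr s * w x)"
            using w0 c by (intro ennreal_le_scaled) auto
          also have "\<dots> = ennreal c3 * F3 k x" using kk unfolding F3_def u_def d_def by simp
          finally show ?thesis by (simp add: add_increasing)
        qed
        then have "ennreal (w x) * indicator S x \<le> ennreal c1 * (F1 k x * indicator Z x) + ennreal c2 * (F2 k
            x * indicator Z x) + ennreal c3 * (F3 k x * indicator Z x)"
          using True xZ by simp
        also have "\<dots> \<le> (\<integral>\<^sup>+k. ennreal c1 * (F1 k x * indicator Z x) + ennreal c2 * (F2 k x * indicator Z x) +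
            ennreal c3 * (F3 k x * indicator Z x) \<partial>count_space UNIV)"
          by (rule count_space_single_le)
        finally show ?thesis .
      qed
      have "weight_measure w S \<le> (\<integral>\<^sup>+x. (\<integral>\<^sup>+k. ennreal c1 * (F1 k x * indicator Z x) + ennreal c2 * (F2 k x *
          indicator Z x) + ennreal c3 * (F3 k x * indicator Z x) \<partial>count_space UNIV) \<partial>lebesgue)"
        unfolding weight_measure_def by (intro nn_integral_mono point)
      also have "\<dots> = (\<integral>\<^sup>+k. (\<integral>\<^sup>+x. ennreal c1 * (F1 k x * indicator Z x) + ennreal c2 * (F2 k x * indicator Z
          x) + ennreal c3 * (F3 k x * indicator Z x) \<partial>lebesgue) \<partial>count_space UNIV)"
        by (rule nn_integral_count_space_nn_integral) auto
      also have "\<dots> = (\<integral>\<^sup>+k. ennreal c1 * (\<integral>\<^sup>+x\<in>Z. F1 k x \<partial>lebesgue) + ennreal c2 * (\<integral>\<^sup>+x\<in>Z. F2 k x \<partial>lebesgue)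
          + ennreal c3 * (\<integral>\<^sup>+x\<in>Z. F3 k x \<partial>lebesgue) \<partial>count_space UNIV)"
        by (intro nn_integral_cong nn_integral_linear3) measurable
      also have "\<dots> = ennreal c1 * (\<integral>\<^sup>+k. (\<integral>\<^sup>+x\<in>Z. F1 k x \<partial>lebesgue) \<partial>count_space UNIV) + ennreal c2 * (\<integral>\<^sup>+k.
          (\<integral>\<^sup>+x\<in>Z. F2 k x \<partial>lebesgue) \<partial>count_space UNIV)
          + ennreal c3 * (\<integral>\<^sup>+k. (\<integral>\<^sup>+x\<in>Z. F3 k x \<partial>lebesgue) \<partial>count_space UNIV)"
        by (intro nn_integral_linear3) auto
      also have "\<dots> \<le> ennreal c1 * ennreal (C1 * m powr (1 - e1) * EB) + ennreal c2 * ennreal (C2 * m powr (1 -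
          e2) * EB) + ennreal c3 * ennreal (C3 * (U powr (1 - e3) * B3))"
      proof (intro add_mono mult_left_mono)
        have "(\<integral>\<^sup>+k. (\<integral>\<^sup>+x\<in>Z. F1 k x \<partial>lebesgue) \<partial>count_space UNIV) \<le> ennreal (C1 * m powr (1 - e1) * EZ)"
          unfolding F1_def Z_def EZ_def by (rule L1[OF f m])
        also have "\<dots> \<le> ennreal (C1 * m powr (1 - e1) * EB)" using C1 EZ by (intro ennreal_leI mult_left_mono)
            auto
        finally show "(\<integral>\<^sup>+k. (\<integral>\<^sup>+x\<in>Z. F1 k x \<partial>lebesgue) \<partial>count_space UNIV) \<le> ennreal (C1 * m powr (1 - e1) *
            EB)" .
        have "(\<integral>\<^sup>+k. (\<integral>\<^sup>+x\<in>Z. F2 k x \<partial>lebesgue) \<partial>count_space UNIV) \<le> ennreal (C2 * m powr (1 - e2) * EZ)"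
          unfolding F2_def Z_def EZ_def by (rule L2[OF f m])
        also have "\<dots> \<le> ennreal (C2 * m powr (1 - e2) * EB)" using C2 EZ by (intro ennreal_leI mult_left_mono)
            auto
        finally show "(\<integral>\<^sup>+k. (\<integral>\<^sup>+x\<in>Z. F2 k x \<partial>lebesgue) \<partial>count_space UNIV) \<le> ennreal (C2 * m powr (1 - e2) *
            EB)" .
        \<comment> \<open>At these scales \<open>Z\<close> is enlarged to the concentric cube of
          scale \<open>k\<close>, so that \<open>local_integral_bound\<close> applies; the
          concentric masses form a chain starting above \<open>U\<close>.\<close>
        have "(\<integral>\<^sup>+k. (\<integral>\<^sup>+x\<in>Z. F3 k x \<partial>lebesgue) \<partial>count_space UNIV) \<le>
          (\<integral>\<^sup>+k. ennreal C3 * (if U \<le> cube_mass w k x0 then ennreal (cube_mass w k x0 powr - (e3 - 1)) else 0)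
              \<partial>count_space UNIV)"
        proof (intro nn_integral_mono)
          fix k
          show "(\<integral>\<^sup>+x\<in>Z. F3 k x \<partial>lebesgue) \<le> ennreal C3 * (if U \<le> cube_mass w k x0 then ennreal (cube_mass w k
              x0 powr - (e3 - 1)) else 0)"
          proof (cases "k0 < k")
            case True
            have "(\<integral>\<^sup>+x\<in>Z. F3 k x \<partial>lebesgue) \<le> (\<integral>\<^sup>+x\<in>scale_cube k x0. ennreal (cube_mass w k x powr - e3 *
                cube_dev b k x powr s * w x) \<partial>lebesgue)"
              using scale_cube_mono[of k0 k x0] True by (intro nn_integral_mono) (auto simp: F3_def Z_def
                  indicator_def)
            also have "\<dots> \<le> ennreal (C3 * cube_mass w k x0 powr (1 - e3))" by (rule L3)
            also have "\<dots> = ennreal C3 * (if U \<le> cube_mass w k x0 then ennreal (cube_mass w k x0 powr - (e3 -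
                1)) else 0)"
              using True cube_mass_mono[OF wt, of k0 k x0] C3 by (simp add: U_def ennreal_mult)
            finally show ?thesis .
          qed (simp add: F3_def)
        qed
        also have "\<dots> = ennreal C3 * (\<integral>\<^sup>+k. (if U \<le> cube_mass w k x0 then ennreal (cube_mass w k x0 powr - (e3
            - 1)) else 0) \<partial>count_space UNIV)"
          by (intro nn_integral_cmult) auto
        also have "\<dots> \<le> ennreal C3 * ennreal (U powr - (e3 - 1) / (1 - \<beta> powr (e3 - 1)))"
          using e3 by (intro mult_left_mono chain_sum_above \<beta> pos rev U) auto
        also have "\<dots> = ennreal (C3 * (U powr (1 - e3) * B3))"
          using C3 B3 by (simp add: B3_def flip: ennreal_mult)
        finally show "(\<integral>\<^sup>+k. (\<integral>\<^sup>+x\<in>Z. F3 k x \<partial>lebesgue) \<partial>count_space UNIV) \<le> ennreal (C3 * (U powr (1 - e3) *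
            B3))" .
      qed auto
      also have "\<dots> = ennreal (c1 * (C1 * m powr (1 - e1) * EB) + c2 * (C2 * m powr (1 - e2) * EB) + c3 * (C3 *
          (U powr (1 - e3) * B3)))"
        using c C1 C2 C3 B3 EB by (simp flip: ennreal_mult ennreal_plus)
      also have "\<dots> \<le> ennreal (C * m)"
      proof (intro ennreal_leI)
        have t1: "c1 * (C1 * m powr (1 - e1) * EB) = C1 * A powr p * D powr \<kappa> * m"
        proof -
          have "c1 * (C1 * m powr (1 - e1) * EB) = C1 * D powr \<kappa> * ((A / \<sigma>) powr p * \<sigma> powr p) * (m powr (\<epsilon> *
              p) * m powr (1 - e1) * m powr (p / q))"
            using m by (simp add: c1_def EB_def tm powr_powr mult_ac)
          also have "(A / \<sigma>) powr p * \<sigma> powr p = A powr p" using \<sigma> A by (simp flip: powr_mult)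
          also have "m powr (\<epsilon> * p) * m powr (1 - e1) * m powr (p / q) = m powr 1" unfolding e1_def
              powr_add[symmetric] by simp
          finally show ?thesis using m by (simp add: mult_ac)
        qed
        have t2: "c2 * (C2 * m powr (1 - e2) * EB) = C2 * A powr s * D powr (\<kappa> * s / p) * m"
        proof -
          have "EB powr (s / p - 1) * EB = EB powr (s / p)" using EB by (simp add: powr_diff)
          also have "\<dots> = D powr (\<kappa> * s / p) * \<sigma> powr s * m powr (s / q)"
            using p0 m by (simp add: EB_def tm powr_mult powr_powr)
          finally have e: "EB powr (s / p - 1) * EB = D powr (\<kappa> * s / p) * \<sigma> powr s * m powr (s / q)" .
          have "c2 * (C2 * m powr (1 - e2) * EB) = C2 * (A / \<sigma>) powr s * (EB powr (s / p - 1) * EB) * (m powr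
              - (\<epsilon> * s) * m powr (1 - e2))"
            by (simp add: c2_def mult_ac)
          also have "\<dots> = C2 * D powr (\<kappa> * s / p) * ((A / \<sigma>) powr s * \<sigma> powr s) * (m powr - (\<epsilon> * s) * m powr (1
              - e2) * m powr (s / q))"
            unfolding e by (simp add: mult_ac)
          also have "(A / \<sigma>) powr s * \<sigma> powr s = A powr s" using \<sigma> A by (simp flip: powr_mult)
          also have "m powr - (\<epsilon> * s) * m powr (1 - e2) * m powr (s / q) = m powr 1" unfolding e2_def
              powr_add[symmetric] by simp
          finally show ?thesis using m by (simp add: mult_ac)
        qed
        have t3: "c3 * (C3 * (U powr (1 - e3) * B3)) \<le> C3 * A powr s * B3 * m"
        proof -
          have "A * N / \<sigma> = A * m powr (1 / q) * U powr (- \<kappa> / p)"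
            using U \<sigma> unfolding tm[symmetric] by (simp add: t_def powr_minus divide_simps)
          then have "c3 * U powr (1 - e3) = A powr s * (m powr (s / q) * m powr - (\<epsilon> * s)) * (U powr (- (\<kappa> * s
              / p)) * U powr (1 - e3))"
            by (simp add: c3_def powr_mult powr_powr mult_ac)
          \<comment> \<open>One factor \<open>m\<close> is split off as the target. The rest is
            (m/U)^(e2 - 1), at most 1 since \<open>m < U\<close> and \<open>e2 > 1\<close>.\<close>
          also have "m powr (s / q) * m powr - (\<epsilon> * s) = m powr 1 * m powr (e2 - 1)" unfolding e2_def
              powr_add[symmetric] by simp
          also have "U powr (- (\<kappa> * s / p)) * U powr (1 - e3) = U powr (1 - e2)"
            unfolding powr_add[symmetric] e3_def e2_def \<eta>_def by (simp add: algebra_simps)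
          also have "A powr s * (m powr 1 * m powr (e2 - 1)) * U powr (1 - e2) \<le> A powr s * (m powr 1 * U powr
              (e2 - 1)) * U powr (1 - e2)"
            using mU m e2 by (intro mult_right_mono mult_left_mono powr_mono2) auto
          also have "\<dots> = A powr s * m" using U m by (simp flip: powr_add)
          finally have "C3 * B3 * (c3 * U powr (1 - e3)) \<le> C3 * B3 * (A powr s * m)" using C3 B3 by (intro
              mult_left_mono) auto
          then show ?thesis by (simp add: mult_ac)
        qed
        show "c1 * (C1 * m powr (1 - e1) * EB) + c2 * (C2 * m powr (1 - e2) * EB) + c3 * (C3 * (U powr (1 -
            e3) * B3)) \<le> C * m"
          unfolding t1 t2 using t3 m by (simp add: C_def distrib_right)
      qed
      finally show ?thesis .
    qed
    then show "weight_measure w {x \<in> scale_cube k0 x0. ennreal \<sigma> < dyadic_majorant p q w \<nu> b f x}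
       \<le> ennreal (C * (N * cube_mass w k0 x0 powr (\<kappa> / p) / \<sigma>) powr q)"
      unfolding S_def Z_def m_def t_def U_def .
  qed
qed

section \<open>The commutator\<close>

lemma riesz_integrand_measurable:
  fixes f :: "real ^ 'n \<Rightarrow> real"
  assumes [measurable]: "f \<in> borel_measurable lebesgue"
  shows "case_prod (riesz_integrand \<gamma> f) \<in> borel_measurable (lebesgue \<Otimes>\<^sub>M lebesgue)"
    and "riesz_integrand \<gamma> f x \<in> borel_measurable lebesgue"
proof -
  have "(\<lambda>z. f (snd z) / norm (fst z - snd z) powr (real CARD('n) - \<gamma>)) \<in> borel_measurable (lebesgue \<Otimes>\<^sub>M
      lebesgue)"
    by measurable
  then show "case_prod (riesz_integrand \<gamma> f) \<in> borel_measurable (lebesgue \<Otimes>\<^sub>M lebesgue)"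
    by (simp add: case_prod_beta' riesz_integrand_def)
  note [measurable] = lebesgue_borel_ident
  show "riesz_integrand \<gamma> f x \<in> borel_measurable lebesgue"
    unfolding riesz_integrand_def[abs_def] by measurable
qed

lemma fractional_integral_measurable:
  fixes f :: "real ^ 'n \<Rightarrow> real"
  assumes "f \<in> borel_measurable lebesgue"
  shows "fractional_integral \<gamma> f \<in> borel_measurable lebesgue"
proof -
  interpret sigma_finite_measure "lebesgue :: (real ^ 'n) measure" by (rule sigma_finite_lebesgue)
  have [measurable]: "(\<lambda>x. \<integral>y. riesz_integrand \<gamma> f x y \<partial>lebesgue) \<in> borel_measurable lebesgue"
    by (rule borel_measurable_lebesgue_integral[OF riesz_integrand_measurable(1)[OF assms]])
  show ?thesis unfolding fractional_integral_def[abs_def] by measurable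
qed

text \<open>At fixed x the integrand of f is dominated through the summand 1, that of b f through
  |b(y)| \<le> (1 + |b(x)|) (1 + |b(x) - b(y)|), with |b(x)| a finite constant.\<close>

lemma commutator_exists_of_majorant:
  fixes f :: "real ^ 'n \<Rightarrow> real"
  assumes [measurable]: "f \<in> borel_measurable lebesgue" "b \<in> borel_measurable lebesgue" and fin:
      "riesz_majorant \<gamma> b f x < \<infinity>"
  shows "commutator_exists_at b \<gamma> f x"
proof -
  define k where "k y = (1 + \<bar>b x - b y\<bar>) * \<bar>f y\<bar> / norm (x - y) powr (real CARD('n) - \<gamma>)" for y
  note [measurable] = lebesgue_borel_ident
  have [measurable]: "k \<in> borel_measurable lebesgue" unfolding k_def by measurable
  have k0: "0 \<le> k y" for y by (simp add: k_def)
  have ik: "integrable lebesgue k"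
    using fin k0 unfolding integrable_iff_bounded riesz_majorant_def k_def[symmetric] by simp
  have 1: "\<bar>riesz_integrand \<gamma> f x y\<bar> \<le> k y" for y
  proof -
    have "\<bar>f y\<bar> \<le> (1 + \<bar>b x - b y\<bar>) * \<bar>f y\<bar>" by (simp add: distrib_right)
    then show ?thesis unfolding riesz_integrand_def k_def by (simp add: divide_right_mono)
  qed
  have 2: "\<bar>riesz_integrand \<gamma> (\<lambda>y. b y * f y) x y\<bar> \<le> (1 + \<bar>b x\<bar>) * k y" for y
  proof -
    have "\<bar>b y\<bar> \<le> \<bar>b x\<bar> + \<bar>b x - b y\<bar>" by linarith
    also have "\<dots> \<le> (1 + \<bar>b x\<bar>) * (1 + \<bar>b x - b y\<bar>)" by (simp add: algebra_simps)
    finally have "\<bar>b y\<bar> * \<bar>f y\<bar> \<le> (1 + \<bar>b x\<bar>) * (1 + \<bar>b x - b y\<bar>) * \<bar>f y\<bar>" by (rule mult_right_mono) simp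
    then have "\<bar>b y\<bar> * \<bar>f y\<bar> / norm (x - y) powr (real CARD('n) - \<gamma>) \<le> (1 + \<bar>b x\<bar>) * (1 + \<bar>b x - b y\<bar>) * \<bar>f y\<bar>
        / norm (x - y) powr (real CARD('n) - \<gamma>)"
      by (rule divide_right_mono) simp
    then show ?thesis unfolding riesz_integrand_def k_def by (simp add: abs_mult mult.assoc)
  qed
  show ?thesis unfolding commutator_exists_at_def
  proof
    show "integrable lebesgue (riesz_integrand \<gamma> f x)"
      using 1 by (intro Bochner_Integration.integrable_bound[OF ik] riesz_integrand_measurable AE_I2) (auto
          intro: order_trans[OF _ abs_ge_self])
    show "integrable lebesgue (riesz_integrand \<gamma> (\<lambda>y. b y * f y) x)"
      using 2 by (intro Bochner_Integration.integrable_bound[OF integrable_mult_right[OF ik, of "1 + \<bar>b x\<bar>"]]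
          riesz_integrand_measurable AE_I2) (auto intro: order_trans[OF _ abs_ge_self])
  qed
qed

text \<open>Where the majorant is finite the two integrals may be combined into one. Elsewhere the
  right side must be infinite; the added 1 makes its factor positive without evaluating
  \<open>riesz_const\<close>.\<close>

lemma commutator_le_majorant:
  fixes f :: "real ^ 'n \<Rightarrow> real"
  assumes [measurable]: "f \<in> borel_measurable lebesgue" "b \<in> borel_measurable lebesgue"
  shows "ennreal \<bar>commutator b (fractional_integral \<gamma>) f x\<bar> \<le> ennreal (\<bar>1 / riesz_const (real CARD('n)) \<gamma>\<bar> +
      1) * riesz_majorant \<gamma> b f x"
proof (cases "riesz_majorant \<gamma> b f x < \<infinity>")
  case False
  then have "riesz_majorant \<gamma> b f x = top" by (simp add: not_less top_unique)
  moreover have "0 < \<bar>1 / riesz_const (real CARD('n)) \<gamma>\<bar> + 1" by (intro add_nonneg_pos) auto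
  ultimately show ?thesis by (simp add: ennreal_mult_top del: ennreal_plus)
next
  case True
  define z where "z = 1 / riesz_const (real CARD('n)) \<gamma>"
  have i: "integrable lebesgue (riesz_integrand \<gamma> f x)" "integrable lebesgue (riesz_integrand \<gamma> (\<lambda>y. b y * f
      y) x)"
    using commutator_exists_of_majorant[OF assms True] by (auto simp: commutator_exists_at_def)
  define g where "g y = b x * riesz_integrand \<gamma> f x y - riesz_integrand \<gamma> (\<lambda>y. b y * f y) x y" for y
  have ig: "integrable lebesgue g" unfolding g_def using i by (intro Bochner_Integration.integrable_diff
      integrable_mult_right) auto
  have ig_eq: "(\<integral>y. g y \<partial>lebesgue) = b x * (\<integral>y. riesz_integrand \<gamma> f x y \<partial>lebesgue) - (\<integral>y. riesz_integrand \<gamma>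
      (\<lambda>y. b y * f y) x y \<partial>lebesgue)"
    unfolding g_def using i by simp
  have eq: "commutator b (fractional_integral \<gamma>) f x = z * (\<integral>y. g y \<partial>lebesgue)"
    unfolding commutator_def fractional_integral_def z_def[symmetric] ig_eq by (simp only: right_diff_distrib
        mult.left_commute)
  have "ennreal \<bar>\<integral>y. g y \<partial>lebesgue\<bar> \<le> (\<integral>\<^sup>+y. ennreal \<bar>g y\<bar> \<partial>lebesgue)"
    using integral_norm_bound_ennreal[OF ig] by simp
  also have "\<dots> \<le> riesz_majorant \<gamma> b f x"
    unfolding riesz_majorant_def
  proof (intro nn_integral_mono ennreal_leI)
    fix y
    have "g y = (b x - b y) * f y / norm (x - y) powr (real CARD('n) - \<gamma>)"
      by (simp add: g_def riesz_integrand_def algebra_simps diff_divide_distrib)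
    then have "\<bar>g y\<bar> = \<bar>b x - b y\<bar> * \<bar>f y\<bar> / norm (x - y) powr (real CARD('n) - \<gamma>)" by (simp add: abs_mult)
    also have "\<dots> \<le> (1 + \<bar>b x - b y\<bar>) * \<bar>f y\<bar> / norm (x - y) powr (real CARD('n) - \<gamma>)"
      by (intro divide_right_mono mult_right_mono) auto
    finally show "\<bar>g y\<bar> \<le> (1 + \<bar>b x - b y\<bar>) * \<bar>f y\<bar> / norm (x - y) powr (real CARD('n) - \<gamma>)" .
  qed
  finally have le: "ennreal \<bar>\<integral>y. g y \<partial>lebesgue\<bar> \<le> riesz_majorant \<gamma> b f x" .
  have "ennreal \<bar>commutator b (fractional_integral \<gamma>) f x\<bar> = ennreal \<bar>z\<bar> * ennreal \<bar>\<integral>y. g y \<partial>lebesgue\<bar>"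
    unfolding eq by (simp add: abs_mult ennreal_mult)
  also have "\<dots> \<le> ennreal (\<bar>z\<bar> + 1) * riesz_majorant \<gamma> b f x"
    using le by (intro mult_mono ennreal_leI) auto
  finally show ?thesis unfolding z_def .
qed

lemma morrey_energy_le:
  fixes w \<nu> f :: "real ^ 'n \<Rightarrow> real"
  assumes w: "w \<in> A_infinity" and f: "f \<in> Lp_loc p \<nu>" and p: "0 < p" and \<kappa>: "0 < \<kappa>" and N: "0 < N"
    and le: "morrey_norm p \<kappa> \<nu> w f \<le> ennreal N"
  shows "cube_energy p \<nu> f k x \<le> N powr p * cube_mass w k x powr \<kappa>"
proof -
  define u where "u = cube_mass w k x"
  have u: "0 < u" unfolding u_def by (rule cube_mass_pos[OF w])
  define G where "G = cube_energy p \<nu> f k x"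
  have G: "0 \<le> G" by (simp add: G_def)
  have "(ennreal G / ennreal u epowr \<kappa>) epowr (1 / p) \<le> morrey_norm p \<kappa> \<nu> w f"
    unfolding morrey_norm_def G_def u_def Lp_loc_energy[OF f, symmetric] cube_mass_eq[OF A_infinity_weight[OF
        w], symmetric]
    by (rule SUP_upper) simp
  also have "(ennreal G / ennreal u epowr \<kappa>) epowr (1 / p) = ennreal ((G / u powr \<kappa>) powr (1 / p))"
    using u G \<kappa> p by (simp add: epowr_pos divide_ennreal)
  finally have "ennreal ((G / u powr \<kappa>) powr (1 / p)) \<le> ennreal N" using le by (rule order_trans)
  then have "(G / u powr \<kappa>) powr (1 / p) \<le> N" using N by (subst (asm) ennreal_le_iff) auto
  then have "((G / u powr \<kappa>) powr (1 / p)) powr p \<le> N powr p" using p by (intro powr_mono2) auto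
  then have "G / u powr \<kappa> \<le> N powr p" using p G by (simp add: powr_powr)
  then show ?thesis using u unfolding G_def[symmetric] u_def[symmetric] by (simp add: divide_le_eq)
qed

theorem theorem2p3:
  fixes \<gamma> p q \<kappa> :: real
    and b w \<nu> :: "real ^ 'n \<Rightarrow> real"
  assumes "0 < \<gamma>" and "\<gamma> < real CARD('n)"
    and "1 < p" and "p < q"
    and "0 < \<kappa>" and "\<kappa> < p / q"
    and "b \<in> BMO"
    and "weight w" and "weight \<nu>"
    and "\<exists>r::real. r > 1 \<and> (\<exists>C::real. \<forall>Q\<in>cubes.
           ennreal (measure lebesgue Q powr (\<gamma> / real CARD('n) + 1 / q - 1 / p))
             * nn_average Q (\<lambda>x. ennreal (w x powr r)) epowr (1 / (r * q))
             * luxemburg_norm (log_young p) Q (\<lambda>x. ennreal (\<nu> x) epowr (- 1 / p))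
           \<le> ennreal C)"
    and "w \<in> A_infinity"
  shows "(\<forall>f\<in>morrey_space p \<kappa> \<nu> w. AE x in lebesgue. commutator_exists_at b \<gamma> f x) \<and>
    bounded_operator (commutator b (fractional_integral \<gamma>))
      (morrey_space p \<kappa> \<nu> w) (morrey_norm p \<kappa> \<nu> w)
      (weak_morrey_space q (\<kappa> * q / p) w) (weak_morrey_norm q (\<kappa> * q / p) w)"
proof -
  note \<gamma> = assms(2) and p = assms(3) and pq = assms(4) and \<kappa> = assms(5,6) and wt = assms(8) and \<nu> = assms(9)
      and w = assms(11)
  have p0: "0 < p" and q0: "0 < q" using p pq by auto
  have cond: "two_weight_condition \<gamma> p q w \<nu>" unfolding two_weight_condition_def by (rule assms(10))
  obtain M where b: "bmo_bound b M" using BMO_bound[OF assms(7)] by blast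
  have bl: "locally_integrable b" using b by (auto simp: bmo_bound_def)
  note bm[measurable] = locally_integrable_measurable[OF bl]
  note [measurable] = weight_measurable[OF wt]
  define T where "T f = commutator b (fractional_integral \<gamma>) f" for f
  define Y where "Y f = dyadic_majorant p q w \<nu> b f" for f
  obtain C1 where C1: "0 < C1" and maj: "\<And>f x. f \<in> Lp_loc p \<nu> \<Longrightarrow> riesz_majorant \<gamma> b f x \<le> ennreal C1 * Y f x"
    using riesz_majorant_le_pieces[OF cond wt \<nu> p q0 A_infinity_pos[OF w] b \<gamma>] unfolding Y_def
        dyadic_majorant_def by blast
  obtain C2 where C2: "0 < C2" and weak: "\<And>f N k0 x0 \<sigma>. f \<in> Lp_loc p \<nu> \<Longrightarrow> 0 < N \<Longrightarrow> (\<And>k x. cube_energy p \<nu> f k x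
      \<le> N powr p * cube_mass w k x powr \<kappa>) \<Longrightarrow> 0 < \<sigma> \<Longrightarrow>
      weight_measure w {x \<in> scale_cube k0 x0. ennreal \<sigma> < Y f x} \<le> ennreal (C2 * (N * cube_mass w k0 x0 powr
          (\<kappa> / p) / \<sigma>) powr q)"
    using weak_type_estimate[OF w \<nu> b p pq \<kappa>] unfolding Y_def by blast
  obtain D where D: "1 \<le> D" and dbl: "\<And>x y r s. 0 < r \<Longrightarrow> s \<le> 4 * r \<Longrightarrow> centered_cube y r \<subseteq> centered_cube x s \<Longrightarrow>
      weight_measure w (centered_cube x s) \<le> ennreal D * weight_measure w (centered_cube y r)"
    using A_infinity_doubling[OF w] by blast
  define C3 where "C3 = (\<bar>1 / riesz_const (real CARD('n)) \<gamma>\<bar> + 1) * C1"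
  have C3: "0 < C3" unfolding C3_def using C1 by (intro mult_pos_pos add_nonneg_pos) auto
  have TY: "ennreal \<bar>T f x\<bar> \<le> ennreal C3 * Y f x" if f: "f \<in> Lp_loc p \<nu>" for f x
  proof -
    have fm: "f \<in> borel_measurable lebesgue" using f by (simp add: Lp_loc_def)
    have "ennreal \<bar>T f x\<bar> \<le> ennreal (\<bar>1 / riesz_const (real CARD('n)) \<gamma>\<bar> + 1) * riesz_majorant \<gamma> b f x"
      unfolding T_def by (rule commutator_le_majorant[OF fm bm])
    also have "\<dots> \<le> ennreal (\<bar>1 / riesz_const (real CARD('n)) \<gamma>\<bar> + 1) * (ennreal C1 * Y f x)"
      by (intro mult_left_mono maj[OF f]) simp
    also have "\<dots> = ennreal C3 * Y f x" unfolding C3_def using C1 by (subst ennreal_mult) (auto simp: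
        mult.assoc)
    finally show ?thesis .
  qed
  have energy: "cube_energy p \<nu> f k x \<le> N powr p * cube_mass w k x powr \<kappa>"
    if "f \<in> morrey_space p \<kappa> \<nu> w" "0 < N" "morrey_norm p \<kappa> \<nu> w f \<le> ennreal N" for f N k x
    using that \<kappa> by (intro morrey_energy_le[OF w _ p0]) (auto simp: morrey_space_def)
  \<comment> \<open>The set where the majorant is infinite satisfies the weak estimate at every
    height, hence has w-measure 0 in each cube; as w is positive almost everywhere, it is a Lebesgue
    null set.\<close>
  have exists: "AE x in lebesgue. commutator_exists_at b \<gamma> f x" if fM: "f \<in> morrey_space p \<kappa> \<nu> w" for f
  proof -
    have f: "f \<in> Lp_loc p \<nu>" using fM by (simp add: morrey_space_def)
    have fm[measurable]: "f \<in> borel_measurable lebesgue" using f by (simp add: Lp_loc_def)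
    have [measurable]: "Y f \<in> borel_measurable lebesgue" unfolding Y_def by (rule
        dyadic_majorant_measurable[OF wt \<nu> bl fm])
    define N where "N = enn2real (morrey_norm p \<kappa> \<nu> w f) + 1"
    have N: "0 < N" by (simp add: N_def add_nonneg_pos)
    have "morrey_norm p \<kappa> \<nu> w f = ennreal (enn2real (morrey_norm p \<kappa> \<nu> w f))" using fM by (simp add:
        morrey_space_def less_top)
    also have "\<dots> \<le> ennreal N" by (intro ennreal_leI) (simp add: N_def)
    finally have le: "morrey_norm p \<kappa> \<nu> w f \<le> ennreal N" .
    have "AE x in lebesgue. x \<in> scale_cube (int n) 0 \<longrightarrow> Y f x \<noteq> top" for n
    proof -
      define B where "B = {x \<in> space lebesgue. x \<in> scale_cube (int n) 0 \<and> Y f x = top}"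
      have Bm[measurable]: "B \<in> sets lebesgue"
      proof -
        have "B = scale_cube (int n) 0 \<inter> (Y f -` {top} \<inter> space lebesgue)" by (auto simp: B_def)
        also have "\<dots> \<in> sets lebesgue" by measurable
        finally show ?thesis .
      qed
      define K where "K = N * cube_mass w (int n) 0 powr (\<kappa> / p)"
      have K: "0 < K" using N cube_mass_pos[OF w, of "int n" 0] by (simp add: K_def)
      have small: "weight_measure w B \<le> 0 + ennreal e" if e: "0 < e" for e
      proof -
        \<comment> \<open>The height at which the weak bound equals \<open>e\<close>.\<close>
        define \<sigma> where "\<sigma> = K / (e / C2) powr (1 / q)"
        have \<sigma>: "0 < \<sigma>" using K e C2 by (simp add: \<sigma>_def)
        have "weight_measure w B \<le> weight_measure w {x \<in> scale_cube (int n) 0. ennreal \<sigma> < Y f x}"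
          by (rule weight_measure_mono) (auto simp: B_def)
        also have "\<dots> \<le> ennreal (C2 * (K / \<sigma>) powr q)"
          unfolding K_def by (rule weak[OF f N energy[OF fM N le] \<sigma>])
        also have "C2 * (K / \<sigma>) powr q = e" using K e C2 q0 by (simp add: \<sigma>_def powr_powr)
        finally show ?thesis by simp
      qed
      have "weight_measure w B \<le> 0" by (rule ennreal_le_epsilon) (rule small)
      then have "(\<integral>\<^sup>+x\<in>B. ennreal (w x) \<partial>lebesgue) = 0" by (simp add: weight_measure_def)
      then have "AE x in lebesgue. ennreal (w x) * indicator B x = 0" by (subst (asm) nn_integral_0_iff_AE)
          auto
      then show ?thesis using A_infinity_AE_pos[OF w]
        by eventually_elim (auto simp: B_def indicator_def split: if_splits)
    qed
    then have "AE x in lebesgue. \<forall>n. x \<in> scale_cube (int n) 0 \<longrightarrow> Y f x \<noteq> top" unfolding AE_all_countable by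
        blast
    then show ?thesis
    proof eventually_elim
      case (elim x)
      obtain n :: nat where n: "norm x < real n" using reals_Archimedean2 by blast
      have "\<bar>x $ i\<bar> \<le> 2 powr real n" for i
      proof -
        have "real n < 2 ^ n" by (rule of_nat_less_two_power)
        moreover have "2 powr real n = 2 ^ n" by (simp add: powr_realpow)
        ultimately show ?thesis using component_le_norm_cart[of x i] n by linarith
      qed
      then have "x \<in> scale_cube (int n) 0" by (simp add: scale_cube_def centered_cube_def)
      then have "Y f x < top" using elim[rule_format, of n] by (simp add: less_top)
      then have "riesz_majorant \<gamma> b f x < \<infinity>" using maj[OF f, of x] by (auto simp: ennreal_mult_less_top intro:
          le_less_trans)
      then show ?case by (rule commutator_exists_of_majorant[OF fm bm])
    qed
  qed
  define C where "C = C2 powr (1 / q) * C3 * D powr (\<kappa> / p)"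
  have C: "0 < C" using C2 C3 D by (simp add: C_def)
  have Kq: "\<kappa> * q / p / q = \<kappa> / p" using q0 by simp
  have bound_N: "weak_morrey_norm q (\<kappa> * q / p) w (T f) \<le> ennreal (C * N)"
    if fM: "f \<in> morrey_space p \<kappa> \<nu> w" and N: "0 < N" and le: "morrey_norm p \<kappa> \<nu> w f \<le> ennreal N" for f N
    unfolding weak_morrey_norm_def
  proof (intro SUP_least)
    fix Q :: "(real ^ 'n) set" and \<sigma> :: real
    assume Q: "Q \<in> cubes" and "\<sigma> \<in> {0<..}"
    then have \<sigma>: "0 < \<sigma>" by simp
    have f: "f \<in> Lp_loc p \<nu>" using fM by (simp add: morrey_space_def)
    obtain x0 r where r: "0 < r" "Q = centered_cube x0 r" using Q by (auto simp: mem_cubes_iff)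
    \<comment> \<open>An arbitrary cube is enlarged to the concentric dyadic one; rounding up at
      most doubles the half side, so doubling compares the two masses.\<close>
    define k0 where "k0 = \<lceil>log 2 r\<rceil>"
    have k0: "log 2 r \<le> real_of_int k0" "real_of_int k0 \<le> log 2 r + 1" unfolding k0_def by linarith+
    have r1: "r \<le> 2 powr real_of_int k0" using k0(1) r by (simp add: log_le_iff)
    have "2 powr real_of_int k0 \<le> 2 powr (log 2 r + 1)" using k0(2) by simp
    also have "\<dots> = 2 * r" using r by (simp add: powr_add)
    finally have r2: "2 powr real_of_int k0 \<le> 2 * r" .
    have QZ: "Q \<subseteq> scale_cube k0 x0" unfolding r scale_cube_def by (rule centered_cube_mono[OF r1])
    define U where "U = cube_mass w k0 x0"
    define V where "V = enn2real (weight_measure w Q)"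
    have V: "weight_measure w Q = ennreal V" "0 < V"
      using weight_measure_cube_real[OF wt Q] A_infinity_pos[OF w Q] weight_measure_finite[OF wt
          cubes_compact[OF Q]]
      by (auto simp: V_def enn2real_positive_iff)
    have U: "0 < U" unfolding U_def by (rule cube_mass_pos[OF w])
    have "weight_measure w (centered_cube x0 (2 powr real_of_int k0)) \<le> ennreal D * weight_measure w
        (centered_cube x0 r)"
      using r r2 QZ unfolding scale_cube_def by (intro dbl) auto
    then have "ennreal U \<le> ennreal D * ennreal V"
      unfolding U_def cube_mass_eq[OF wt, symmetric] V(1)[symmetric] by (simp add: scale_cube_def r(2))
    then have UV: "U \<le> D * V" using D V by (simp flip: ennreal_mult)
    have "weight_measure w {x \<in> Q. \<sigma> < \<bar>T f x\<bar>} \<le> weight_measure w {x \<in> scale_cube k0 x0. ennreal (\<sigma> / C3) < Y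
        f x}"
    proof (rule weight_measure_mono, rule subsetI)
      fix x assume "x \<in> {x \<in> Q. \<sigma> < \<bar>T f x\<bar>}"
      then have x: "x \<in> Q" "\<sigma> < \<bar>T f x\<bar>" by auto
      have "ennreal (\<sigma> / C3) < Y f x"
      proof (rule ccontr)
        assume "\<not> ennreal (\<sigma> / C3) < Y f x"
        then have "ennreal C3 * Y f x \<le> ennreal C3 * ennreal (\<sigma> / C3)" by (intro mult_left_mono) auto
        also have "\<dots> = ennreal \<sigma>" using C3 \<sigma> by (simp flip: ennreal_mult)
        finally have "ennreal \<bar>T f x\<bar> \<le> ennreal \<sigma>" using TY[OF f, of x] by (rule order_trans[rotated])
        then show False using x \<sigma> by (subst (asm) ennreal_le_iff) auto
      qed
      then show "x \<in> {x \<in> scale_cube k0 x0. ennreal (\<sigma> / C3) < Y f x}" using x QZ by auto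
    qed
    also have "\<dots> \<le> ennreal (C2 * (N * U powr (\<kappa> / p) / (\<sigma> / C3)) powr q)"
      unfolding U_def using \<sigma> C3 by (intro weak[OF f N energy[OF fM N le]]) auto
    finally have W: "weight_measure w {x \<in> Q. \<sigma> < \<bar>T f x\<bar>} \<le> ennreal (C2 * (N * U powr (\<kappa> / p) / (\<sigma> / C3))
        powr q)" .
    define E where "E = enn2real (weight_measure w {x \<in> Q. \<sigma> < \<bar>T f x\<bar>})"
    have E: "weight_measure w {x \<in> Q. \<sigma> < \<bar>T f x\<bar>} = ennreal E" "0 \<le> E"
      using le_less_trans[OF W ennreal_less_top] by (simp_all add: E_def less_top)
    have "E \<le> C2 * (N * U powr (\<kappa> / p) / (\<sigma> / C3)) powr q"
      using W C2 unfolding E(1) by (subst (asm) ennreal_le_iff) auto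
    then have "E powr (1 / q) \<le> (C2 * (N * U powr (\<kappa> / p) / (\<sigma> / C3)) powr q) powr (1 / q)"
      using E q0 by (intro powr_mono2) auto
    also have "\<dots> = C2 powr (1 / q) * (N * U powr (\<kappa> / p) / (\<sigma> / C3))"
      using N U \<sigma> C3 q0 by (simp add: powr_mult powr_powr)
    finally have "\<sigma> * E powr (1 / q) \<le> \<sigma> * (C2 powr (1 / q) * (N * U powr (\<kappa> / p) / (\<sigma> / C3)))"
      using \<sigma> by (intro mult_left_mono) auto
    also have "\<dots> = C2 powr (1 / q) * C3 * N * U powr (\<kappa> / p)" using \<sigma> by simp
    also have "\<dots> \<le> C2 powr (1 / q) * C3 * N * (D * V) powr (\<kappa> / p)"
      using UV U C3 N \<kappa> p0 by (intro mult_left_mono powr_mono2) auto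
    also have "\<dots> = C * N * V powr (\<kappa> / p)" by (simp add: C_def powr_mult mult_ac)
    finally have fin: "\<sigma> * E powr (1 / q) / V powr (\<kappa> / p) \<le> C * N" using V by (simp add: divide_le_eq)
    have "ennreal \<sigma> * weight_measure w {x \<in> Q. \<bar>T f x\<bar> > \<sigma>} epowr (1 / q) / weight_measure w Q epowr (\<kappa> * q /
        p / q)
       = ennreal (\<sigma> * E powr (1 / q) / V powr (\<kappa> / p))"
      unfolding E(1) V(1) Kq using E(2) V(2) \<sigma> q0 \<kappa> p0 by (simp add: epowr_pos divide_ennreal flip:
          ennreal_mult)
    also have "\<dots> \<le> ennreal (C * N)" by (rule ennreal_leI[OF fin])
    finally show "ennreal \<sigma> * weight_measure w {x \<in> Q. \<bar>T f x\<bar> > \<sigma>} epowr (1 / q) / weight_measure w Q epowr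
        (\<kappa> * q / p / q) \<le> ennreal (C * N)" .
  qed
  have bound: "weak_morrey_norm q (\<kappa> * q / p) w (T f) \<le> ennreal C * morrey_norm p \<kappa> \<nu> w f"
    if fM: "f \<in> morrey_space p \<kappa> \<nu> w" for f
  \<comment> \<open>\<open>bound_N\<close> needs a positive number, so it is applied to the norm
    plus \<open>e / C\<close>; this includes functions of norm 0.\<close>
  proof (rule ennreal_le_epsilon)
    fix e :: real assume e: "0 < e"
    define n where "n = enn2real (morrey_norm p \<kappa> \<nu> w f)"
    have n: "morrey_norm p \<kappa> \<nu> w f = ennreal n" "0 \<le> n" using fM by (auto simp: morrey_space_def less_top
        n_def)
    have "weak_morrey_norm q (\<kappa> * q / p) w (T f) \<le> ennreal (C * (n + e / C))"
      using e C n by (intro bound_N[OF fM]) (auto intro!: add_nonneg_pos ennreal_leI simp del: ennreal_plus)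
    also have "\<dots> = ennreal C * morrey_norm p \<kappa> \<nu> w f + ennreal e"
      unfolding n(1) using C n e by (simp add: distrib_left ennreal_mult)
    finally show "weak_morrey_norm q (\<kappa> * q / p) w (T f) \<le> ennreal C * morrey_norm p \<kappa> \<nu> w f + ennreal e" .
  qed
  have "T f \<in> weak_morrey_space q (\<kappa> * q / p) w" if fM: "f \<in> morrey_space p \<kappa> \<nu> w" for f
  proof -
    have [measurable]: "f \<in> borel_measurable lebesgue" using fM by (simp add: morrey_space_def Lp_loc_def)
    have [measurable]: "fractional_integral \<gamma> f \<in> borel_measurable lebesgue" "fractional_integral \<gamma> (\<lambda>y. b y *
        f y) \<in> borel_measurable lebesgue"
      by (intro fractional_integral_measurable; measurable)+
    have "T f \<in> borel_measurable lebesgue" unfolding T_def commutator_def[abs_def] by measurable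
    moreover have "ennreal C * morrey_norm p \<kappa> \<nu> w f < \<infinity>" using fM by (simp add: morrey_space_def
        ennreal_mult_less_top)
    ultimately show ?thesis using bound[OF fM] by (auto simp: weak_morrey_space_def intro: le_less_trans)
  qed
  then show ?thesis using exists bound unfolding bounded_operator_def T_def by blast
qed

end
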